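(* Let $\mathrm{Malc}^{(2)}$ be the variety of Malcev metabelian algebras over a field $F$ of characteristic $0$, i.e. the variety defined by $xy=-yx$, $\mathrm J(x,y,z)x=\mathrm J(x,y,xz)$, $(xy)(zt)=0$. Then its basic spectrum is $$\mathrm{sp}_b(\mathrm{Malc}^{(2)})=\{(1,1)\}.$$
   Context: All algebras are over a field $F$ of characteristic $0$ and are not assumed associative or unital. $\mathrm J(x,y,z)=(xy)z+(yz)x+(zx)y$ is the Jacobian. A superalgebra is a $\mathbb Z_2$-graded algebra $\mathcal A=\mathcal A_0+\mathcal A_1$, $\mathcal A_i\mathcal A_j\subseteq\mathcal A_{i+j \bmod 2}$. $\mathrm G=\mathrm G_0+\mathrm G_1$ is the Grassmann algebra on countably many anticommuting generators $e_1,e_2,\dots$ ($\mathrm G_0$, $\mathrm G_1$ spanned by words of even, resp. odd, length). The Grassmann envelope of $\mathcal A$ is $\mathrm G(\mathcal A)=\mathrm G_0\otimes\mathcal A_0+\mathrm G_1\otimes\mathcal A_1\subseteq \mathrm G\otimes\mathcal A$. For a multilinear polynomial $f$, its superization $\tilde f$ is obtained by the Koszul sign rule (a sign $(-1)^{ij}$ whenever a variable of parity $i$ passes through one of parity $j$); $\mathcal A$ satisfies the superidentity $\tilde f=0$ if and only if $\mathrm G(\mathcal A)$ satisfies $f=0$. For a variety $\mathcal V$, a $\mathcal V$-superalgebra is a superalgebra $\mathcal A$ with $\mathrm G(\mathcal A)\in\mathcal V$; $\tilde{\mathcal V}$ is the class of all $\mathcal V$-superalgebras. The supervariety generated by a superalgebra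 $\mathcal B$ is the class of all superalgebras satisfying every superidentity $\tilde f=0$ ($f$ multilinear) satisfied by $\mathcal B$. For nonnegative integers $(r,s)\ne(0,0)$, $\mathcal V_{r,s}$ is the supervariety generated by the free $\mathcal V$-superalgebra on $r$ even and $s$ odd generators; $\mathcal V_{0,0}=\{\{0\}\}$. A pair $(r,s)$ is a basic superrank of $\mathcal V$ if $\mathcal V_{r,s}=\tilde{\mathcal V}$ and $(r,s)$ is minimal with this property, i.e. $\mathcal V_{r',s'}\ne\tilde{\mathcal V}$ for every $(r',s')\neq(r,s)$ with $r'\leqslant r$, $s'\leqslant s$. The basic spectrum $\mathrm{sp}_b(\mathcal V)$ is the set of all (finite) basic superranks of $\mathcal V$. *)

theory Defs
  imports
    "HOL-Algebra.Module"
    "HOL-Algebra.QuotRing"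
    "HOL-Library.Poly_Mapping"
    "HOL-Library.Z2"
begin

section \<open>Nonassociative algebras and superalgebras\<close>

definition base_field :: "'f::field_char_0 ring" where
  "base_field = \<lparr>carrier = UNIV, mult = (*), one = 1, zero = 0, add = (+)\<rparr>"

text \<open>
  Algebras over \<^typ>\<open>'f\<close> live on the record type of \<^locale>\<open>module\<close>, so that the vector space
  part is the one of the library. The multiplication is only required to be bilinear, and the
  field \<^const>\<open>one\<close> of the record is never used: algebras need not have a unit.
\<close>

locale nonassoc_algebra = module base_field A
  for A :: "('f::field_char_0, 'a, 'm) module_scheme" (structure) +
  assumes prod_closed:
      "\<lbrakk>x \<in> carrier A; y \<in> carrier A\<rbrakk> \<Longrightarrow> x \<otimes> y \<in> carrier A"
    and prod_add_left:
      "\<lbrakk>x \<in> carrier A; y \<in> carrier A; z \<in> carrier A\<rbrakk> \<Longrightarrow> (x \<oplus> y) \<otimes> z = x \<otimes> z \<oplus> y \<otimes> z"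
    and prod_add_right:
      "\<lbrakk>x \<in> carrier A; y \<in> carrier A; z \<in> carrier A\<rbrakk> \<Longrightarrow> x \<otimes> (y \<oplus> z) = x \<otimes> y \<oplus> x \<otimes> z"
    and prod_smult_left:
      "\<lbrakk>x \<in> carrier A; y \<in> carrier A\<rbrakk> \<Longrightarrow> (c \<odot> x) \<otimes> y = c \<odot> (x \<otimes> y)"
    and prod_smult_right:
      "\<lbrakk>x \<in> carrier A; y \<in> carrier A\<rbrakk> \<Longrightarrow> x \<otimes> (c \<odot> y) = c \<odot> (x \<otimes> y)"

text \<open>Parities are elements of the two-element field \<^typ>\<open>bit\<close>, \<open>1\<close> being the odd one.\<close>

record ('f, 'a) superalgebra = "('f, 'a) module" +
  grade :: "bit \<Rightarrow> 'a set"

locale superalgebra = nonassoc_algebra A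
  for A :: "('f::field_char_0, 'a, 'm) superalgebra_scheme" (structure) +
  assumes grade_subspace: "submodule (grade A i) base_field A"
    and grade_inter: "grade A 0 \<inter> grade A 1 = {\<zero>}"
    and grade_sum: "grade A 0 <+> grade A 1 = carrier A"
    and grade_prod: "\<lbrakk>x \<in> grade A i; y \<in> grade A j\<rbrakk> \<Longrightarrow> x \<otimes> y \<in> grade A (i + j)"

definition graded_ideal :: "'a set \<Rightarrow> ('f::field_char_0, 'a, 'm) superalgebra_scheme \<Rightarrow> bool" where
  "graded_ideal I A \<longleftrightarrow>
     submodule I base_field A \<and>
     (\<forall>x\<in>I. \<forall>y\<in>carrier A. x \<otimes>\<^bsub>A\<^esub> y \<in> I \<and> y \<otimes>\<^bsub>A\<^esub> x \<in> I) \<and>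
     (\<forall>x\<in>grade A 0. \<forall>y\<in>grade A 1. x \<oplus>\<^bsub>A\<^esub> y \<in> I \<longrightarrow> x \<in> I \<and> y \<in> I)"

text \<open>The additive and multiplicative structure is that of \<^const>\<open>FactRing\<close>.\<close>

definition quotient_superalgebra ::
  "('f::field_char_0, 'a) superalgebra \<Rightarrow> 'a set \<Rightarrow> ('f, 'a set) superalgebra" where
  "quotient_superalgebra A I =
    \<lparr>carrier = a_rcosets\<^bsub>A\<^esub> I, mult = rcoset_mult A I, one = undefined,
     zero = I, add = set_add A,
     smult = (\<lambda>c X. \<Union>x\<in>X. I +>\<^bsub>A\<^esub> (c \<odot>\<^bsub>A\<^esub> x)),
     grade = (\<lambda>i. (\<lambda>x. I +>\<^bsub>A\<^esub> x) ` grade A i)\<rparr>"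


section \<open>Nonassociative polynomials, identities and varieties\<close>

text \<open>Nonassociative words, i.e. the elements of the free magma.\<close>

datatype 'x nword = Gen 'x | Prod "'x nword" "'x nword"

fun letters :: "'x nword \<Rightarrow> 'x list" where
  "letters (Gen x) = [x]"
| "letters (Prod u v) = letters u @ letters v"

text \<open>The free nonassociative algebra on the set of all \<^typ>\<open>'x\<close> is the space of finitely
  supported functions on words.\<close>

type_synonym ('x, 'f) npoly = "'x nword \<Rightarrow>\<^sub>0 'f"

definition nvar :: "'x \<Rightarrow> ('x, 'f::field_char_0) npoly" where
  "nvar x = Poly_Mapping.single (Gen x) 1"

definition nmult :: "('x, 'f::field_char_0) npoly \<Rightarrow> ('x, 'f) npoly \<Rightarrow> ('x, 'f) npoly"
  (infixl \<open>\<star>\<close> 70) where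
  "f \<star> g = (\<Sum>u\<in>Poly_Mapping.keys f. \<Sum>v\<in>Poly_Mapping.keys g.
     Poly_Mapping.single (Prod u v) (Poly_Mapping.lookup f u * Poly_Mapping.lookup g v))"

definition nscale :: "'f::field_char_0 \<Rightarrow> ('x, 'f) npoly \<Rightarrow> ('x, 'f) npoly" where
  "nscale c f = Poly_Mapping.map ((*) c) f"

fun eval_word :: "('f, 'a, 'm) module_scheme \<Rightarrow> ('x \<Rightarrow> 'a) \<Rightarrow> 'x nword \<Rightarrow> 'a" where
  "eval_word A a (Gen x) = a x"
| "eval_word A a (Prod u v) = eval_word A a u \<otimes>\<^bsub>A\<^esub> eval_word A a v"

definition eval :: "('f::field_char_0, 'a, 'm) module_scheme \<Rightarrow> ('x \<Rightarrow> 'a) \<Rightarrow> ('x, 'f) npoly \<Rightarrow> 'a" where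
  "eval A a f =
     (\<Oplus>\<^bsub>A\<^esub> w \<in> Poly_Mapping.keys f. Poly_Mapping.lookup f w \<odot>\<^bsub>A\<^esub> eval_word A a w)"

definition satisfies :: "('f::field_char_0, 'a, 'm) module_scheme \<Rightarrow> (nat, 'f) npoly \<Rightarrow> bool" where
  "satisfies A f \<longleftrightarrow> (\<forall>a. (\<forall>i. a i \<in> carrier A) \<longrightarrow> eval A a f = \<zero>\<^bsub>A\<^esub>)"

text \<open>A variety is given by a set of defining identities in the variables \<open>0, 1, 2, \<dots>\<close>.\<close>

definition in_variety ::
  "('f::field_char_0, 'a, 'm) module_scheme \<Rightarrow> (nat, 'f) npoly set \<Rightarrow> bool" where
  "in_variety A Ids \<longleftrightarrow> nonassoc_algebra A \<and> (\<forall>f\<in>Ids. satisfies A f)"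


section \<open>The Grassmann envelope\<close>

text \<open>
  The Grassmann algebra has the basis \<open>e\<^sub>S = e\<^sub>i\<^sub>1 \<dots> e\<^sub>i\<^sub>k\<close>, where \<open>S = {i\<^sub>1 < \<dots> < i\<^sub>k}\<close> ranges over the
  finite sets of naturals (\<open>e\<^sub>\<emptyset> = 1\<close>), and \<open>e\<^sub>S e\<^sub>T = grassmann_sign S T e\<^bsub>S \<union> T\<^esub>\<close> if \<open>S\<close> and \<open>T\<close>
  are disjoint, \<open>e\<^sub>S e\<^sub>T = 0\<close> otherwise.
\<close>

definition grassmann_sign :: "nat set \<Rightarrow> nat set \<Rightarrow> 'f::field_char_0" where
  "grassmann_sign S T = (- 1) ^ card {(i, j). i \<in> S \<and> j \<in> T \<and> j < i}"

text \<open>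
  A function \<open>u\<close> stands for the tensor \<open>\<Sum>S. e\<^sub>S \<otimes> u S\<close>. Functions vanish on infinite sets, so that
  this representation is unique.
\<close>

definition grassmann_envelope ::
  "('f::field_char_0, 'a, 'm) superalgebra_scheme \<Rightarrow> ('f, nat set \<Rightarrow> 'a) module" where
  "grassmann_envelope A =
    \<lparr>carrier = {u. finite {S. u S \<noteq> \<zero>\<^bsub>A\<^esub>} \<and> (\<forall>S. infinite S \<longrightarrow> u S = \<zero>\<^bsub>A\<^esub>) \<and>
                   (\<forall>S. finite S \<longrightarrow> u S \<in> grade A (of_nat (card S)))},
     mult = (\<lambda>u v R. if finite R
               then \<Oplus>\<^bsub>A\<^esub> S \<in> Pow R. grassmann_sign S (R - S) \<odot>\<^bsub>A\<^esub> (u S \<otimes>\<^bsub>A\<^esub> v (R - S))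
               else \<zero>\<^bsub>A\<^esub>),
     one = undefined,
     zero = (\<lambda>S. \<zero>\<^bsub>A\<^esub>),
     add = (\<lambda>u v S. u S \<oplus>\<^bsub>A\<^esub> v S),
     smult = (\<lambda>c u S. c \<odot>\<^bsub>A\<^esub> u S)\<rparr>"

definition variety_superalgebra ::
  "(nat, 'f::field_char_0) npoly set \<Rightarrow> ('f, 'a) superalgebra \<Rightarrow> bool" where
  "variety_superalgebra Ids A \<longleftrightarrow> superalgebra A \<and> in_variety (grassmann_envelope A) Ids"


section \<open>Superidentities\<close>

definition multilinear :: "(nat, 'f::field_char_0) npoly \<Rightarrow> bool" where
  "multilinear f \<longleftrightarrow>
     (\<exists>X. \<forall>w\<in>Poly_Mapping.keys f. distinct (letters w) \<and> set (letters w) = X)"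

text \<open>
  The Koszul sign of a word without repeated letters, for variables \<open>i\<close> of parity \<open>p i\<close>: the sign
  picked up when its letters are brought into increasing order.
\<close>

definition koszul_sign :: "(nat \<Rightarrow> bit) \<Rightarrow> nat list \<Rightarrow> 'f::field_char_0" where
  "koszul_sign p xs = (- 1) ^ card {(k, l). k < l \<and> l < length xs \<and> xs ! l < xs ! k \<and>
     p (xs ! k) = 1 \<and> p (xs ! l) = 1}"

definition superization ::
  "(nat \<Rightarrow> bit) \<Rightarrow> (nat, 'f::field_char_0) npoly \<Rightarrow> (nat, 'f) npoly" where
  "superization p f = (\<Sum>w\<in>Poly_Mapping.keys f.
     Poly_Mapping.single w (koszul_sign p (letters w) * Poly_Mapping.lookup f w))"

definition satisfies_super ::
  "('f::field_char_0, 'a, 'm) superalgebra_scheme \<Rightarrow> (nat, 'f) npoly \<Rightarrow> bool" where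
  "satisfies_super A f \<longleftrightarrow>
     (\<forall>p a. (\<forall>i. a i \<in> grade A (p i)) \<longrightarrow> eval A a (superization p f) = \<zero>\<^bsub>A\<^esub>)"


section \<open>Free superalgebras\<close>

text \<open>Generators \<open>Inl i\<close> are even, generators \<open>Inr j\<close> are odd.\<close>

fun word_parity :: "(nat + nat) nword \<Rightarrow> bit" where
  "word_parity (Gen (Inl i)) = 0"
| "word_parity (Gen (Inr j)) = 1"
| "word_parity (Prod u v) = word_parity u + word_parity v"

definition super_words :: "nat \<Rightarrow> nat \<Rightarrow> (nat + nat) nword set" where
  "super_words r s = {w. set (letters w) \<subseteq> Inl ` {..<r} \<union> Inr ` {..<s}}"

definition free_nonassoc_superalgebra ::
  "nat \<Rightarrow> nat \<Rightarrow> ('f::field_char_0, (nat + nat, 'f) npoly) superalgebra" where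
  "free_nonassoc_superalgebra r s =
    \<lparr>carrier = {f. Poly_Mapping.keys f \<subseteq> super_words r s}, mult = (\<star>), one = undefined,
     zero = 0, add = (+), smult = nscale,
     grade = (\<lambda>i. {f. Poly_Mapping.keys f \<subseteq> {w \<in> super_words r s. word_parity w = i}})\<rparr>"

text \<open>
  The free superalgebra of a variety is the quotient of the free nonassociative superalgebra by
  the least graded ideal whose quotient is a superalgebra of the variety.
\<close>

definition free_superalgebra ::
  "(nat, 'f::field_char_0) npoly set \<Rightarrow> nat \<Rightarrow> nat \<Rightarrow>
    ('f, (nat + nat, 'f) npoly set) superalgebra" where
  "free_superalgebra Ids r s =
     quotient_superalgebra (free_nonassoc_superalgebra r s)
       (\<Inter>{I. graded_ideal I (free_nonassoc_superalgebra r s) \<and>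
            variety_superalgebra Ids (quotient_superalgebra (free_nonassoc_superalgebra r s) I)})"


section \<open>Supervarieties and the basic spectrum\<close>

text \<open>
  HOL has no class of all superalgebras, so the classes below consist of the superalgebras whose
  carrier is a subset of a universe \<^typ>\<open>'u\<close>. The free superalgebras that generate supervarieties
  do not depend on the universe. A nonzero superalgebra exists in \<^typ>\<open>'u\<close> iff \<^typ>\<open>'f\<close> injects
  into \<^typ>\<open>'u\<close>; then all superalgebras of countable dimension have a copy there, and these
  decide whether two classes given by superidentities are equal.
\<close>

definition all_variety_superalgebras ::
  "(nat, 'f::field_char_0) npoly set \<Rightarrow> ('f, 'u) superalgebra set" where
  "all_variety_superalgebras Ids = {A. variety_superalgebra Ids A}"

definition supervariety_generated ::
  "('f::field_char_0, 'b) superalgebra \<Rightarrow> ('f, 'u) superalgebra set" where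
  "supervariety_generated B =
     {A. superalgebra A \<and> (\<forall>f. multilinear f \<and> satisfies_super B f \<longrightarrow> satisfies_super A f)}"

definition supervariety_rank ::
  "(nat, 'f::field_char_0) npoly set \<Rightarrow> nat \<times> nat \<Rightarrow> ('f, 'u) superalgebra set" where
  "supervariety_rank Ids = (\<lambda>(r, s).
     if (r, s) = (0, 0) then {A. superalgebra A \<and> carrier A = {\<zero>\<^bsub>A\<^esub>}}
     else supervariety_generated (free_superalgebra Ids r s))"

definition basic_superrank ::
  "'u itself \<Rightarrow> (nat, 'f::field_char_0) npoly set \<Rightarrow> nat \<times> nat \<Rightarrow> bool" where
  "basic_superrank U Ids = (\<lambda>(r, s).
     (supervariety_rank Ids (r, s) :: ('f, 'u) superalgebra set) = all_variety_superalgebras Ids \<and>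
     (\<forall>r' s'. (r', s') \<noteq> (r, s) \<and> r' \<le> r \<and> s' \<le> s \<longrightarrow>
       (supervariety_rank Ids (r', s') :: ('f, 'u) superalgebra set)
         \<noteq> all_variety_superalgebras Ids))"

definition basic_spectrum ::
  "'u itself \<Rightarrow> (nat, 'f::field_char_0) npoly set \<Rightarrow> (nat \<times> nat) set" where
  "basic_spectrum U Ids = {rs. basic_superrank U Ids rs}"


section \<open>Metabelian Malcev algebras\<close>

definition jacobian ::
  "('x, 'f::field_char_0) npoly \<Rightarrow> ('x, 'f) npoly \<Rightarrow> ('x, 'f) npoly \<Rightarrow> ('x, 'f) npoly" where
  "jacobian x y z = (x \<star> y) \<star> z + (y \<star> z) \<star> x + (z \<star> x) \<star> y"

definition malcev_metabelian :: "(nat, 'f::field_char_0) npoly set" where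
  "malcev_metabelian =
    (let x = nvar 0; y = nvar 1; z = nvar 2; t = nvar 3 in
      {x \<star> y + y \<star> x,
       jacobian x y z \<star> x - jacobian x y (x \<star> z),
       (x \<star> y) \<star> (z \<star> t)})"

end

theory Submission
  imports Defs "HOL-Library.Disjoint_Sets" "HOL.Vector_Spaces"
begin

text \<open>
  In a metabelian Malcev algebra, three consecutive right multiplications acting on a product may be
  permuted cyclically (\<open>cyclic_mem\<close>). A multilinear left-normed word \<open>(ab)c\<^sub>1\<dots>c\<^sub>k\<close> is therefore the sum
  of a part that is symmetric in the \<open>c\<^sub>i\<close> and a part that is alternating in them, each depending only
  on \<open>a\<close> and \<open>b\<close> (up to the sign of the arrangement). The rest of the Malcev identity says that the
  symmetric part has the form \<open>P a - P b\<close>, as in metabelian Lie algebras, and that the alternating part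
  has the form \<open>\<plusminus>(E a + E b)\<close> (\<open>sum_of_symmetric_and_alternating\<close>). So a multilinear polynomial in
  left-normed words is an identity as soon as, for each variable \<open>a\<close>, two linear functionals of its
  coefficients vanish: the coefficients of \<open>P a\<close> and of \<open>E a\<close> (\<open>malcev_ideal_membership\<close>).

  Both functionals can be read off in a superalgebra with one even generator \<open>x\<close> and one odd generator
  \<open>y\<close>. In the Lie superalgebra with \<open>yx = y\<close>, put \<open>y\<close> for \<open>a\<close> and \<open>x\<close> for all other variables; in the
  superalgebra with \<open>xy = z\<close>, \<open>zy = x\<close>, put \<open>x\<close> for \<open>a\<close> and \<open>y\<close> for the others. Hence the free
  superalgebra on one even and one odd generator has no other superidentities than the variety
  (\<open>free_superalgebra_1_1_identity\<close>).

  If all generators have the same parity, a word with more letters \<open>c\<^sub>i\<close> than generators has two equal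
  letters among the \<open>c\<^sub>i\<close>. This kills the alternating part if the generators are even and the
  symmetric part if they are odd, so that the free superalgebra satisfies an identity
  (\<open>parity_identity_if_generated\<close>) that fails in one of the two small superalgebras. Thus no pair
  \<open>(r, 0)\<close> or \<open>(0, s)\<close> generates the variety, and \<open>(1, 1)\<close> is the only minimal pair.

  Two devices carry the formal proof. Superidentities are exchanged for identities of the Grassmann
  envelope, so that signs occur only where words are evaluated at tensors; and relations between words
  are studied through linear functionals on the free algebra that vanish on a given ideal, so that
  all linear algebra takes place in the field.
\<close>

section \<open>Rearranging lists by adjacent transpositions\<close>

lemma count_list_distinct: "distinct xs \<Longrightarrow> count_list xs z = (if z \<in> set xs then 1 else 0)"
  by (induction xs) auto

lemma adjacent_swap_invariant_eq:
  assumes swap: "\<And>us x y vs. h (us @ x # y # vs) = h (us @ y # x # vs)"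
    and "\<And>z. count_list xs z = count_list ys z"
  shows "h xs = h ys"
  using assms
proof (induction xs arbitrary: h ys)
  case Nil
  have "hd ys \<notin> set ys"
    using Nil.prems(2)[of "hd ys"] count_list_0_iff[of ys "hd ys"] by simp
  then show ?case by (cases ys) auto
next
  case (Cons x xs)
  obtain us vs where ys: "ys = us @ x # vs"
    using Cons.prems(2)[of x] split_list[of x ys] count_list_0_iff[of ys x] by auto
  have front: "h (us @ x # vs) = h (x # us @ vs)"
  proof (induction us arbitrary: vs rule: rev_induct)
    case (snoc u us)
    then show ?case using Cons.prems(1)[of us u x vs] by simp
  qed simp
  have "h (x # xs) = h (x # us @ vs)"
  proof (rule Cons.IH[of "\<lambda>l. h (x # l)"])
    show "h (x # us @ y # z # vs) = h (x # us @ z # y # vs)" for us y z vs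
      using Cons.prems(1)[of "x # us"] by simp
    show "count_list xs z = count_list (us @ vs) z" for z
      using Cons.prems(2)[of z] ys by (simp split: if_splits)
  qed
  then show ?case using front ys by simp
qed

fun swap2 :: "'x list \<Rightarrow> 'x list" where
  "swap2 (x # y # xs) = y # x # xs"
| "swap2 xs = xs"

text \<open>A cycle of three consecutive entries is the product of two neighbouring transpositions. A function
  that is invariant under all such cycles therefore changes in the same way under every adjacent
  transposition, hence as under the transposition of the first two entries.\<close>

lemma cyclic_imp_swap2:
  assumes cyc: "\<And>us x y z vs. h (us @ x # y # z # vs) = h (us @ y # z # x # vs)"
  shows "h (us @ y # x # vs) = h (swap2 (us @ x # y # vs))"
proof (induction us arbitrary: x y vs rule: rev_induct)
  case (snoc u us)
  have "h (us @ u # y # x # vs) = h (us @ x # u # y # vs)"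
    using cyc[of us u y x vs] cyc[of us y x u vs] by simp
  also have "\<dots> = h (swap2 (us @ u # x # y # vs))"
    by (rule snoc.IH)
  finally show ?case by simp
qed simp

text \<open>On the rearrangements of a list, \<open>h\<close> takes at most two values, which the odd permutations
  interchange.\<close>

lemma cyclic_imp_swap2_pair:
  assumes cyc: "\<And>us x y z vs. h (us @ x # y # z # vs) = h (us @ y # z # x # vs)"
    and "\<And>z. count_list xs z = count_list ys z"
  shows "{h xs, h (swap2 xs)} = {h ys, h (swap2 ys)}"
proof (rule adjacent_swap_invariant_eq[where h = "\<lambda>l. {h l, h (swap2 l)}"])
  show "{h (us @ x # y # vs), h (swap2 (us @ x # y # vs))}
      = {h (us @ y # x # vs), h (swap2 (us @ y # x # vs))}" for us x y vs
    using cyclic_imp_swap2[of h us y x vs, OF cyc] cyclic_imp_swap2[of h us x y vs, OF cyc]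
    by auto
qed (fact assms(2))

text \<open>Once two equal entries have been moved to the front, \<^const>\<open>swap2\<close> fixes the list, so the two
  values coincide.\<close>

lemma cyclic_repeated_swap2:
  assumes cyc: "\<And>us x y z vs. h (us @ x # y # z # vs) = h (us @ y # z # x # vs)"
    and "\<not> distinct xs"
  shows "h xs = h (swap2 xs)"
proof -
  obtain us x vs ws where xs: "xs = us @ [x] @ vs @ [x] @ ws"
    using assms(2) not_distinct_decomp by blast
  have "{h xs, h (swap2 xs)} = {h (x # x # us @ vs @ ws), h (swap2 (x # x # us @ vs @ ws))}"
    using cyc by (rule cyclic_imp_swap2_pair) (simp add: xs)
  then show ?thesis by auto
qed

section \<open>Signs\<close>

lemma grassmann_sign_empty [simp]:
  "grassmann_sign {} T = 1" "grassmann_sign S {} = 1"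
  by (simp_all add: grassmann_sign_def)

lemma finite_inversions: "finite S \<Longrightarrow> finite T \<Longrightarrow> finite {(i, j). i \<in> S \<and> j \<in> T \<and> (j::nat) < i}"
  by (rule finite_subset[of _ "S \<times> T"]) auto

lemma grassmann_sign_Un_right:
  assumes "finite S" "finite T" "finite U" "T \<inter> U = {}"
  shows "grassmann_sign S (T \<union> U) = (grassmann_sign S T * grassmann_sign S U :: 'f::field_char_0)"
proof -
  have "{(i, j). i \<in> S \<and> j \<in> T \<union> U \<and> j < i}
      = {(i, j). i \<in> S \<and> j \<in> T \<and> j < i} \<union> {(i, j). i \<in> S \<and> j \<in> U \<and> j < i}" by auto
  moreover have "{(i, j). i \<in> S \<and> j \<in> T \<and> j < i} \<inter> {(i, j). i \<in> S \<and> j \<in> U \<and> j < i} = {}"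
    using assms(4) by auto
  ultimately have "card {(i, j). i \<in> S \<and> j \<in> T \<union> U \<and> j < i}
      = card {(i, j). i \<in> S \<and> j \<in> T \<and> j < i} + card {(i, j). i \<in> S \<and> j \<in> U \<and> j < i}"
    by (simp add: card_Un_disjoint finite_inversions assms)
  then show ?thesis by (simp add: grassmann_sign_def power_add)
qed

lemma grassmann_sign_Un_left:
  assumes "finite S" "finite T" "finite U" "T \<inter> U = {}"
  shows "grassmann_sign (T \<union> U) S = (grassmann_sign T S * grassmann_sign U S :: 'f::field_char_0)"
proof -
  have "{(i, j). i \<in> T \<union> U \<and> j \<in> S \<and> j < i}
      = {(i, j). i \<in> T \<and> j \<in> S \<and> j < i} \<union> {(i, j). i \<in> U \<and> j \<in> S \<and> j < i}" by auto
  moreover have "{(i, j). i \<in> T \<and> j \<in> S \<and> j < i} \<inter> {(i, j). i \<in> U \<and> j \<in> S \<and> j < i} = {}"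
    using assms(4) by auto
  ultimately have "card {(i, j). i \<in> T \<union> U \<and> j \<in> S \<and> j < i}
      = card {(i, j). i \<in> T \<and> j \<in> S \<and> j < i} + card {(i, j). i \<in> U \<and> j \<in> S \<and> j < i}"
    by (simp add: card_Un_disjoint finite_inversions assms)
  then show ?thesis by (simp add: grassmann_sign_def power_add)
qed

lemma grassmann_sign_commute:
  assumes "finite S" "finite T" "S \<inter> T = {}"
  shows "grassmann_sign T S = ((- 1) ^ (card S * card T) * grassmann_sign S T :: 'f::field_char_0)"
proof -
  let ?A = "{(i, j). i \<in> S \<and> j \<in> T \<and> j < i}" and ?B = "{(i, j). i \<in> T \<and> j \<in> S \<and> j < i}"
  have "card (prod.swap ` ?B) = card ?B" by (rule card_image) (simp add: inj_on_def)
  moreover have "?A \<union> prod.swap ` ?B = S \<times> T" using assms(3) by (auto simp: image_iff not_less_iff_gr_or_eq)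
  moreover have "?A \<inter> prod.swap ` ?B = {}" by auto
  moreover have "finite ?A" "finite ?B" using assms finite_inversions by auto
  ultimately have "card ?A + card ?B = card (S \<times> T)"
    using card_Un_disjoint[of ?A "prod.swap ` ?B"] by simp
  also have "\<dots> = card S * card T" by (rule card_cartesian_product)
  finally have "card ?A + card ?B = card S * card T" .
  then have "(- 1::'f) ^ (card S * card T) * (- 1) ^ card ?A = (- 1) ^ (card ?A + card ?B + card ?A)"
    by (simp add: power_add)
  also have "\<dots> = ((- 1) ^ card ?A * (- 1) ^ card ?A) * (- 1) ^ card ?B"
    by (simp add: power_add)
  also have "((- 1) ^ card ?A * (- 1) ^ card ?A) = (1::'f)"
    by (simp flip: power_mult_distrib)
  finally show ?thesis by (simp add: grassmann_sign_def)
qed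

lemma grassmann_sign_square [simp]:
  "grassmann_sign S T * grassmann_sign S T = (1::'f::field_char_0)"
  by (simp add: grassmann_sign_def flip: power_mult_distrib)

lemma grassmann_sign_nonzero [simp]: "grassmann_sign S T \<noteq> (0::'f::field_char_0)"
  by (simp add: grassmann_sign_def)

text \<open>The sign in \<open>e\<^bsub>S x\<^esub> e\<^bsub>S y\<^esub> \<dots> = \<plusminus> e\<^bsub>S x \<union> S y \<union> \<dots>\<^esub>\<close> for pairwise disjoint factors.\<close>

fun grassmann_list_sign :: "(nat \<Rightarrow> nat set) \<Rightarrow> nat list \<Rightarrow> 'f::field_char_0" where
  "grassmann_list_sign S [] = 1"
| "grassmann_list_sign S (x # xs) =
     grassmann_sign (S x) (\<Union>i\<in>set xs. S i) * grassmann_list_sign S xs"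

lemma grassmann_list_sign_cong:
  "(\<And>i. i \<in> set xs \<Longrightarrow> S i = T i) \<Longrightarrow> grassmann_list_sign S xs = grassmann_list_sign T xs"
  by (induction xs) auto

lemma disjoint_family_on_UN_Int:
  assumes "disjoint_family_on S X" "A \<subseteq> X" "B \<subseteq> X" "A \<inter> B = {}"
  shows "(\<Union>i\<in>A. S i) \<inter> (\<Union>i\<in>B. S i) = {}"
proof -
  have "S i \<inter> S j = {}" if "i \<in> A" "j \<in> B" for i j
    using that assms by (intro disjoint_family_onD[of S X]) auto
  then show ?thesis by blast
qed

lemma grassmann_list_sign_append:
  assumes "\<And>i. finite (S i)" "disjoint_family_on S (set (xs @ ys))" "distinct (xs @ ys)"
  shows "grassmann_list_sign S (xs @ ys) =
    (grassmann_list_sign S xs * grassmann_list_sign S ys *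
     grassmann_sign (\<Union>i\<in>set xs. S i) (\<Union>i\<in>set ys. S i) :: 'f::field_char_0)"
  using assms(2,3)
proof (induction xs)
  case (Cons x xs)
  have IH: "grassmann_list_sign S (xs @ ys) =
    (grassmann_list_sign S xs * grassmann_list_sign S ys *
     grassmann_sign (\<Union>i\<in>set xs. S i) (\<Union>i\<in>set ys. S i) :: 'f)"
    using Cons.prems by (intro Cons.IH) (auto simp add: disjoint_family_on_def)
  have disj: "(\<Union>i\<in>set xs. S i) \<inter> (\<Union>i\<in>set ys. S i) = {}" "S x \<inter> (\<Union>i\<in>set xs. S i) = {}"
    using Cons.prems disjoint_family_on_UN_Int[of S "set (x # xs @ ys)" "set xs" "set ys"]
      disjoint_family_on_UN_Int[of S "set (x # xs @ ys)" "{x}" "set xs"] by auto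
  have "grassmann_sign (S x) (\<Union>i\<in>set (xs @ ys). S i) =
     (grassmann_sign (S x) (\<Union>i\<in>set xs. S i) * grassmann_sign (S x) (\<Union>i\<in>set ys. S i) :: 'f)"
    using grassmann_sign_Un_right[OF _ _ _ disj(1), of "S x"] assms(1) by simp
  moreover have "grassmann_sign (\<Union>i\<in>set (x # xs). S i) (\<Union>i\<in>set ys. S i) =
     (grassmann_sign (S x) (\<Union>i\<in>set ys. S i)
      * grassmann_sign (\<Union>i\<in>set xs. S i) (\<Union>i\<in>set ys. S i) :: 'f)"
    using grassmann_sign_Un_left[OF _ _ _ disj(2), of "\<Union>i\<in>set ys. S i"] assms(1) by simp
  ultimately show ?case using IH by (simp add: mult_ac)
qed simp

lemma grassmann_list_sign_swap:
  assumes "\<And>i. finite (S i)"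
    and "disjoint_family_on S (set (us @ x # y # vs))" "distinct (us @ x # y # vs)"
  shows "grassmann_list_sign S (us @ y # x # vs) =
    ((- 1) ^ (card (S x) * card (S y)) * grassmann_list_sign S (us @ x # y # vs) :: 'f::field_char_0)"
  using assms(2,3)
proof (induction us)
  case Nil
  let ?V = "\<Union>i\<in>set vs. S i"
  have d: "S x \<inter> S y = {}" "S x \<inter> ?V = {}" "S y \<inter> ?V = {}"
    using Nil disjoint_family_on_UN_Int[of S "set (x # y # vs)" "{x}" "{y}"]
      disjoint_family_on_UN_Int[of S "set (x # y # vs)" "{x}" "set vs"]
      disjoint_family_on_UN_Int[of S "set (x # y # vs)" "{y}" "set vs"] by auto
  have "grassmann_sign (S x) (S y \<union> ?V) = (grassmann_sign (S x) (S y) * grassmann_sign (S x) ?V :: 'f)"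
    using d by (intro grassmann_sign_Un_right) (auto simp: assms(1))
  moreover have "grassmann_sign (S y) (S x \<union> ?V) = (grassmann_sign (S y) (S x) * grassmann_sign (S y) ?V :: 'f)"
    using d by (intro grassmann_sign_Un_right) (auto simp: assms(1))
  ultimately show ?case
    using grassmann_sign_commute[OF assms(1) assms(1) d(1), where 'f = 'f] by (simp add: mult_ac)
next
  case (Cons u us)
  have "grassmann_list_sign S (us @ y # x # vs) =
    ((- 1) ^ (card (S x) * card (S y)) * grassmann_list_sign S (us @ x # y # vs) :: 'f::field_char_0)"
    using Cons.prems by (intro Cons.IH) (auto simp: disjoint_family_on_def)
  moreover have "set (us @ y # x # vs) = set (us @ x # y # vs)" by auto
  ultimately show ?case by (simp only: append_Cons grassmann_list_sign.simps mult_ac)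
qed

text \<open>With these sets, the basis element \<open>e\<^sub>i\<close> represents an odd variable \<open>i\<close> and \<open>1\<close> represents an even one.\<close>

definition odd_singleton :: "(nat \<Rightarrow> bit) \<Rightarrow> nat \<Rightarrow> nat set" where
  "odd_singleton p i = (if p i = 1 then {i} else {})"

lemma disjoint_odd_singleton [simp]: "disjoint_family_on (odd_singleton p) X"
  by (auto simp: disjoint_family_on_def odd_singleton_def)

lemma finite_odd_singleton [simp]: "finite (odd_singleton p i)"
  by (simp add: odd_singleton_def)

lemma card_odd_singleton [simp]: "of_nat (card (odd_singleton p i)) = p i"
  by (cases "p i") (auto simp: odd_singleton_def)

lemma UN_odd_singleton: "(\<Union>i\<in>X. odd_singleton p i) = {i \<in> X. p i = 1}"
  by (auto simp: odd_singleton_def split: if_splits)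

text \<open>Sorting a product of the generators \<open>e\<^sub>i\<close> costs one sign for each inversion, which is exactly what
  the Koszul sign counts.\<close>

lemma koszul_sign_eq_grassmann:
  "distinct xs \<Longrightarrow> koszul_sign p xs = (grassmann_list_sign (odd_singleton p) xs :: 'f::field_char_0)"
proof (induction xs)
  case Nil
  then show ?case by (simp add: koszul_sign_def)
next
  case (Cons x xs)
  let ?I = "\<lambda>xs. {(k, l). k < l \<and> l < length xs \<and> xs ! l < xs ! k \<and> p (xs ! k) = 1 \<and> p (xs ! l) = 1}"
  let ?H = "{(i, j). i \<in> odd_singleton p x \<and> j \<in> (\<Union>i\<in>set xs. odd_singleton p i) \<and> j < i}"
  let ?T = "{(k::nat, l). k = 0 \<and> 0 < l \<and> l < Suc (length xs) \<and> (x # xs) ! l < x \<and> p x = 1 \<and> p ((x # xs) ! l) = 1}"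
  have fin: "finite (?I l)" for l
    by (rule finite_subset[of _ "{..<length l} \<times> {..<length l}"]) auto
  have split: "?I (x # xs) = ?T \<union> (\<lambda>(k, l). (Suc k, Suc l)) ` ?I xs"
  proof (rule Set.set_eqI)
    fix kl :: "nat \<times> nat"
    obtain k l where kl: "kl = (k, l)" by fastforce
    show "(kl \<in> ?I (x # xs)) = (kl \<in> ?T \<union> (\<lambda>(k, l). (Suc k, Suc l)) ` ?I xs)"
      unfolding kl by (cases k; cases l) (auto simp: image_iff)
  qed
  have finT: "finite ?T"
    by (rule finite_subset[of _ "{..<Suc (length xs)} \<times> {..<Suc (length xs)}"]) auto
  have "card (?I (x # xs)) = card ?T + card ((\<lambda>(k, l). (Suc k, Suc l)) ` ?I xs)"
    unfolding split by (rule card_Un_disjoint) (use finT fin in auto)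
  also have "card ((\<lambda>(k, l). (Suc k, Suc l)) ` ?I xs) = card (?I xs)"
    by (rule card_image) (auto simp: inj_on_def)
  also have "card ?T = card ?H"
  proof (rule bij_betw_same_card)
    show "bij_betw (\<lambda>(k, l). (x, (x # xs) ! l)) ?T ?H"
      unfolding bij_betw_def
    proof
      show "inj_on (\<lambda>(k, l). (x, (x # xs) ! l)) ?T"
        using Cons.prems by (auto simp: inj_on_def nth_eq_iff_index_eq nth_Cons split: nat.splits)
      show "(\<lambda>(k, l). (x, (x # xs) ! l)) ` ?T = ?H"
      proof
        show "(\<lambda>(k, l). (x, (x # xs) ! l)) ` ?T \<subseteq> ?H"
          by (auto simp: odd_singleton_def nth_Cons split: nat.splits)
        show "?H \<subseteq> (\<lambda>(k, l). (x, (x # xs) ! l)) ` ?T"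
        proof clarify
          fix i j k assume "i \<in> odd_singleton p x" "j < i" "k \<in> set xs" "j \<in> odd_singleton p k"
          then have *: "i = x" "p x = 1" "j = k" "p k = 1" "k < x" by (auto simp: odd_singleton_def split: if_splits)
          obtain m where "m < length xs" "xs ! m = k" using \<open>k \<in> set xs\<close> by (metis in_set_conv_nth)
          then show "(i, j) \<in> (\<lambda>(k, l). (x, (x # xs) ! l)) ` ?T"
            using * by (intro image_eqI[where x = "(0, Suc m)"]) auto
        qed
      qed
    qed
  qed
  finally have "card (?I (x # xs)) = card ?H + card (?I xs)" .
  then have "koszul_sign p (x # xs) = (grassmann_sign (odd_singleton p x) (\<Union>i\<in>set xs. odd_singleton p i)
      * koszul_sign p xs :: 'f)"
    unfolding koszul_sign_def grassmann_sign_def by (simp add: power_add)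
  then show ?case using Cons by simp
qed

lemma koszul_sign_square [simp]: "koszul_sign p xs * koszul_sign p xs = (1::'f::field_char_0)"
  by (simp add: koszul_sign_def flip: power_mult_distrib)

lemma koszul_sign_nonzero [simp]: "koszul_sign p xs \<noteq> (0::'f::field_char_0)"
  by (simp add: koszul_sign_def)

definition pair_sign :: "(nat \<Rightarrow> bit) \<Rightarrow> nat \<Rightarrow> nat \<Rightarrow> 'f::field_char_0" where
  "pair_sign p x y = (if y < x \<and> p x = 1 \<and> p y = 1 then - 1 else 1)"

lemma koszul_sign_Nil [simp]: "koszul_sign p [] = (1::'f::field_char_0)"
  by (simp add: koszul_sign_def)

lemma koszul_sign_Cons:
  assumes "distinct (x # xs)"
  shows "koszul_sign p (x # xs) = (prod_list (map (pair_sign p x) xs) * koszul_sign p xs :: 'f::field_char_0)"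
proof -
  have pair: "grassmann_sign (odd_singleton p x) (odd_singleton p y) = (pair_sign p x y :: 'f)" for y
  proof -
    have "{(i, j). i = x \<and> j = y \<and> j < i} = (if y < x then {(x, y)} else {})" by auto
    then show ?thesis by (simp add: odd_singleton_def pair_sign_def grassmann_sign_def)
  qed
  have "grassmann_sign (odd_singleton p x) (\<Union>i\<in>set xs. odd_singleton p i)
      = (prod_list (map (pair_sign p x) xs) :: 'f)" if "distinct xs" for xs
    using that
  proof (induction xs)
    case (Cons y ys)
    have "odd_singleton p y \<inter> (\<Union>i\<in>set ys. odd_singleton p i) = {}"
      using Cons.prems by (auto simp: odd_singleton_def split: if_splits)
    then show ?case using Cons by (simp add: grassmann_sign_Un_right pair)
  qed simp
  then show ?thesis using assms by (simp add: koszul_sign_eq_grassmann)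
qed

lemma koszul_sign_one_odd: "koszul_sign (\<lambda>i. if i = a then 1 else 0) l = (1 :: 'f::field_char_0)"
proof -
  have "{(k, n). k < n \<and> n < length l \<and> l ! n < l ! k \<and> (if l ! k = a then 1 else 0) = (1::bit)
      \<and> (if l ! n = a then 1 else 0) = (1::bit)} = {}" by (auto split: if_splits)
  then show ?thesis unfolding koszul_sign_def by (simp only: card.empty power_0)
qed

lemma koszul_sign_sorted:
  assumes "sorted l"
  shows "koszul_sign p l = (1 :: 'f::field_char_0)"
proof -
  have "\<not> (k < n \<and> n < length l \<and> l ! n < l ! k)" for k n
    using sorted_nth_mono[OF assms, of k n] by auto
  then have "{(k, n). k < n \<and> n < length l \<and> l ! n < l ! k \<and> p (l ! k) = 1 \<and> p (l ! n) = 1} = {}"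
    by blast
  then show ?thesis unfolding koszul_sign_def by (simp only: card.empty power_0)
qed

lemma minus_one_power_parity:
  assumes "of_nat m = (of_nat n :: bit)"
  shows "(- 1::'f::field_char_0) ^ m = (- 1) ^ n"
proof -
  have "even m \<longleftrightarrow> even n"
    using assms by (metis even_of_nat_iff)
  then show ?thesis by (simp add: minus_one_power_iff)
qed

text \<open>A transposition of two neighbours changes both signs by the same factor, since \<open>e\<^sub>S\<close> and \<open>e\<^sub>T\<close>
  anticommute if both sets have odd size, and commute otherwise.\<close>

lemma grassmann_koszul_order_independent:
  assumes fin: "\<And>i. finite (S i)" and par: "\<And>i. p i = of_nat (card (S i))"
    and disj: "disjoint_family_on S X"
    and xs: "distinct xs" "set xs = X" and ys: "distinct ys" "set ys = X"
  shows "grassmann_list_sign S xs * koszul_sign p xs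
    = (grassmann_list_sign S ys * koszul_sign p ys :: 'f::field_char_0)"
proof -
  define h where "h l = (if distinct l \<and> set l = X
    then grassmann_list_sign S l * koszul_sign p l else (0::'f))" for l
  have "h xs = h ys"
  proof (rule adjacent_swap_invariant_eq[where h = h])
    show "count_list xs z = count_list ys z" for z using xs ys by (simp add: count_list_distinct)
    fix us x y vs
    show "h (us @ x # y # vs) = h (us @ y # x # vs)"
    proof (cases "distinct (us @ x # y # vs) \<and> set (us @ x # y # vs) = X")
      case True
      then have d: "distinct (us @ x # y # vs)" and d': "distinct (us @ y # x # vs)"
        and s': "set (us @ y # x # vs) = X" by auto
      have "(- 1::'f) ^ (card (S x) * card (S y)) = (- 1) ^ (card (odd_singleton p x) * card (odd_singleton p y))"
        by (rule minus_one_power_parity) (simp flip: par)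
      then have e: "(- 1::'f) ^ (card (S x) * card (S y)) *
          (- 1) ^ (card (odd_singleton p x) * card (odd_singleton p y)) = 1"
        by (simp flip: power_mult_distrib)
      have "h (us @ y # x # vs) = (- 1) ^ (card (S x) * card (S y)) *
          (- 1) ^ (card (odd_singleton p x) * card (odd_singleton p y)) * h (us @ x # y # vs)"
        using True d' s' grassmann_list_sign_swap[of S us x y vs, where 'f = 'f, OF fin _ d]
          grassmann_list_sign_swap[of "odd_singleton p" us x y vs, where 'f = 'f, OF _ _ d] disj
        by (simp add: h_def koszul_sign_eq_grassmann mult_ac del: set_append)
      then show ?thesis by (simp only: e mult_1)
    next
      case False
      then have "\<not> (distinct (us @ y # x # vs) \<and> set (us @ y # x # vs) = X)" by auto
      with False show ?thesis unfolding h_def by argo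
    qed
  qed
  then show ?thesis using xs ys by (simp add: h_def)
qed

text \<open>The value \<open>0\<close> on lists with repetitions makes \<open>permutation_sign_swap\<close> hold without side
  conditions.\<close>

definition permutation_sign :: "nat list \<Rightarrow> 'f::field_char_0" where
  "permutation_sign xs = (if distinct xs then koszul_sign (\<lambda>_. 1) xs else 0)"

lemma permutation_sign_swap:
  "permutation_sign (us @ y # x # vs) = - (permutation_sign (us @ x # y # vs) :: 'f::field_char_0)"
proof (cases "distinct (us @ x # y # vs)")
  case True
  then have "distinct (us @ y # x # vs)" by auto
  then show ?thesis
    using True grassmann_list_sign_swap[of "odd_singleton (\<lambda>_. 1)" us x y vs, where 'f = 'f]
    by (simp add: permutation_sign_def koszul_sign_eq_grassmann odd_singleton_def)
next
  case False
  then have "\<not> distinct (us @ y # x # vs)" by auto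
  with False show ?thesis unfolding permutation_sign_def by (simp only: if_False minus_zero)
qed

lemma permutation_sign_square:
  "distinct xs \<Longrightarrow> permutation_sign xs * permutation_sign xs = (1::'f::field_char_0)"
  by (simp add: permutation_sign_def)

lemma permutation_sign_nonzero: "distinct l \<Longrightarrow> permutation_sign l \<noteq> (0::'f::field_char_0)"
  by (simp add: permutation_sign_def)

section \<open>Evaluating nonassociative polynomials\<close>

abbreviation "coeff \<equiv> Poly_Mapping.lookup"
abbreviation "supp \<equiv> Poly_Mapping.keys"
abbreviation "monomial \<equiv> Poly_Mapping.single"

lemma base_field_simps [simp]:
  "carrier base_field = (UNIV :: 'f::field_char_0 set)"
  "mult base_field = ((*) :: 'f::field_char_0 \<Rightarrow> _)" "one base_field = (1 :: 'f::field_char_0)"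
  "zero base_field = (0 :: 'f::field_char_0)" "add base_field = ((+) :: 'f::field_char_0 \<Rightarrow> _)"
  by (simp_all add: base_field_def)

lemma cring_base_field: "cring (base_field :: 'f::field_char_0 ring)"
proof (rule cringI)
  show "abelian_group (base_field :: 'f ring)"
  proof (rule abelian_groupI)
    show "\<exists>y\<in>carrier base_field. y \<oplus>\<^bsub>base_field\<^esub> x = \<zero>\<^bsub>base_field\<^esub>" for x :: 'f
      by (auto intro: exI[of _ "- x"])
  qed auto
  show "Group.comm_monoid (base_field :: 'f ring)"
    by (rule comm_monoidI) auto
qed (auto simp: distrib_right)

lemma a_inv_base_field [simp]: "\<ominus>\<^bsub>base_field\<^esub> x = - (x :: 'f::field_char_0)"
proof -
  interpret cring "base_field :: 'f ring" by (rule cring_base_field)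
  show ?thesis by (rule minus_equality) auto
qed

text \<open>Algebras live on records, the free algebra on a type class. Identities are therefore derived
  in the free algebra, where the simplifier can normalize sums, and then evaluated.\<close>

lemma lookup_nscale [simp]: "coeff (nscale c f) w = c * coeff f w"
  by (simp add: nscale_def map.rep_eq when_def)

lemma keys_nscale: "supp (nscale c f) \<subseteq> supp f"
  by (auto simp: in_keys_iff)

lemma nscale_single [simp]: "nscale c (monomial w d) = monomial w (c * d)"
  by (rule poly_mapping_eqI) (simp add: lookup_single when_def)

lemma vector_space_nscale: "vector_space (nscale :: 'f::field_char_0 \<Rightarrow> ('x, 'f) npoly \<Rightarrow> _)"
  by unfold_locales (auto intro!: poly_mapping_eqI simp: lookup_add algebra_simps)

lemma npoly_sum_single:
  "f = (\<Sum>w\<in>supp f. monomial w (coeff f w))"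
  by (rule poly_mapping_eqI) (simp add: lookup_sum lookup_single when_def in_keys_iff)

lemma npoly_induct [case_names zero single add]:
  fixes f :: "('x, 'f::field_char_0) npoly"
  assumes "P 0" "\<And>w c. P (monomial w c)" "\<And>f g. P f \<Longrightarrow> P g \<Longrightarrow> P (f + g)"
  shows "P f"
proof -
  have "P (\<Sum>w\<in>K. monomial w (coeff f w))" if "finite K" for K
    using that by induction (auto intro: assms)
  then show ?thesis by (subst npoly_sum_single) simp
qed

lemma nmult_eq_sum:
  assumes "finite K" "finite L" "supp f \<subseteq> K" "supp g \<subseteq> L"
  shows "f \<star> g = (\<Sum>u\<in>K. \<Sum>v\<in>L.
     monomial (Prod u v) (coeff f u * coeff g v))"
proof -
  have "f \<star> g = (\<Sum>u\<in>supp f. \<Sum>v\<in>L.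
     monomial (Prod u v) (coeff f u * coeff g v))"
    unfolding nmult_def
    by (intro sum.cong sum.mono_neutral_left refl assms) (auto simp: in_keys_iff)
  also have "\<dots> = (\<Sum>u\<in>K. \<Sum>v\<in>L.
     monomial (Prod u v) (coeff f u * coeff g v))"
    by (intro sum.mono_neutral_left assms) (auto simp: in_keys_iff)
  finally show ?thesis .
qed

lemma nmult_single [simp]:
  "monomial u c \<star> monomial v d = monomial (Prod u v) (c * d)"
  by (subst nmult_eq_sum[of "{u}" "{v}"]) auto

lemma nmult_zero [simp]: "0 \<star> f = 0" "f \<star> 0 = 0"
  by (simp_all add: nmult_def)

lemma nmult_add_left: "(f + g) \<star> h = f \<star> h + g \<star> h"
proof -
  let ?K = "supp f \<union> supp g" and ?L = "supp h"
  have "supp (f + g) \<subseteq> ?K" by (rule keys_add)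
  then show ?thesis
    by (simp add: nmult_eq_sum[of ?K ?L] lookup_add distrib_right single_add sum.distrib)
qed

lemma nmult_add_right: "h \<star> (f + g) = h \<star> f + h \<star> g"
proof -
  let ?K = "supp f \<union> supp g" and ?L = "supp h"
  have "supp (f + g) \<subseteq> ?K" by (rule keys_add)
  then show ?thesis
    by (simp add: nmult_eq_sum[of ?L ?K] lookup_add distrib_left single_add sum.distrib)
qed

lemma nmult_minus_left: "(- f) \<star> h = - (f \<star> h)"
  using nmult_add_left[of f "- f" h] by (simp add: add_eq_0_iff)

lemma nmult_minus_right: "h \<star> (- f) = - (h \<star> f)"
  using nmult_add_right[of h f "- f"] by (simp add: add_eq_0_iff)

lemma nmult_diff_left: "(f - g) \<star> h = f \<star> h - g \<star> h"
  using nmult_add_left[of f "- g" h] by (simp add: nmult_minus_left)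

lemma nmult_diff_right: "h \<star> (f - g) = h \<star> f - h \<star> g"
  using nmult_add_right[of h f "- g"] by (simp add: nmult_minus_right)

lemmas nmult_distribs = nmult_add_left nmult_add_right nmult_minus_left nmult_minus_right
  nmult_diff_left nmult_diff_right

lemma nmult_nscale_left:
  fixes f g :: "('x, 'f::field_char_0) npoly"
  shows "nscale c f \<star> g = nscale c (f \<star> g)"
proof -
  interpret vector_space "nscale :: 'f \<Rightarrow> ('x, 'f) npoly \<Rightarrow> _" by (rule vector_space_nscale)
  have "nscale c f \<star> g = (\<Sum>u\<in>supp f. \<Sum>v\<in>supp g.
     monomial (Prod u v) (c * coeff f u * coeff g v))"
    by (subst nmult_eq_sum[OF _ _ keys_nscale order_refl]) auto
  also have "\<dots> = nscale c (f \<star> g)"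
    unfolding nmult_def
    by (simp add: scale_sum_right mult.assoc)
  finally show ?thesis .
qed

lemma nmult_nscale_right:
  fixes f g :: "('x, 'f::field_char_0) npoly"
  shows "g \<star> nscale c f = nscale c (g \<star> f)"
proof -
  interpret vector_space "nscale :: 'f \<Rightarrow> ('x, 'f) npoly \<Rightarrow> _" by (rule vector_space_nscale)
  have "g \<star> nscale c f = (\<Sum>u\<in>supp g. \<Sum>v\<in>supp f.
     monomial (Prod u v) (coeff g u * (c * coeff f v)))"
    by (subst nmult_eq_sum[OF _ _ order_refl keys_nscale]) auto
  also have "\<dots> = nscale c (g \<star> f)"
    unfolding nmult_def by (simp add: scale_sum_right mult_ac)
  finally show ?thesis .
qed

lemma submodule_base_fieldD:
  assumes "submodule H base_field A" "nonassoc_algebra A"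
  shows "H \<subseteq> carrier A" "\<zero>\<^bsub>A\<^esub> \<in> H" "\<And>x y. x \<in> H \<Longrightarrow> y \<in> H \<Longrightarrow> x \<oplus>\<^bsub>A\<^esub> y \<in> H"
    "\<And>c x. x \<in> H \<Longrightarrow> c \<odot>\<^bsub>A\<^esub> x \<in> H"
proof -
  interpret nonassoc_algebra A by fact
  show "H \<subseteq> carrier A" "\<And>x y. x \<in> H \<Longrightarrow> y \<in> H \<Longrightarrow> x \<oplus>\<^bsub>A\<^esub> y \<in> H"
    "\<And>c x. x \<in> H \<Longrightarrow> c \<odot>\<^bsub>A\<^esub> x \<in> H"
    using submoduleE[OF assms(1)] by auto
  show "\<zero>\<^bsub>A\<^esub> \<in> H"
    using subgroup.one_closed[OF submodule.axioms(1)[OF assms(1)]] by simp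
qed

text \<open>Linear combinations are avoided: a spanning set is used by exhibiting a submodule that contains
  it.\<close>

definition spans :: "('f::field_char_0, 'a, 'm) module_scheme \<Rightarrow> 'a set \<Rightarrow> bool" where
  "spans A M \<longleftrightarrow> M \<subseteq> carrier A \<and>
     (\<forall>H. submodule H base_field A \<and> M \<subseteq> H \<longrightarrow> carrier A \<subseteq> H)"

context nonassoc_algebra
begin

lemma scalar_closed [simp, intro]: "x \<in> carrier A \<Longrightarrow> c \<odot> x \<in> carrier A"
  using smult_closed[of c x] by simp

lemma scalar_add: "x \<in> carrier A \<Longrightarrow> (c + d) \<odot> x = c \<odot> x \<oplus> d \<odot> x"
  using smult_l_distr[of c d x] by simp

lemma scalar_add_right:
  "x \<in> carrier A \<Longrightarrow> y \<in> carrier A \<Longrightarrow> c \<odot> (x \<oplus> y) = c \<odot> x \<oplus> c \<odot> y"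
  using smult_r_distr[of c x y] by simp

lemma scalar_scalar [simp]: "x \<in> carrier A \<Longrightarrow> c \<odot> (d \<odot> x) = (c * d) \<odot> x"
  using smult_assoc1[of c d x] by simp

lemma scalar_one [simp]: "x \<in> carrier A \<Longrightarrow> 1 \<odot> x = x"
  using smult_one[of x] by simp

lemma scalar_zero [simp]: "x \<in> carrier A \<Longrightarrow> 0 \<odot> x = \<zero>" "c \<odot> \<zero> = \<zero>"
  using smult_l_null[of x] smult_r_null[of c] by simp_all

lemma scalar_minus_one: "x \<in> carrier A \<Longrightarrow> (- 1) \<odot> x = \<ominus> x"
  using smult_l_minus[of 1 x] by simp

lemma minus_eq_zero_iff:
  assumes "x \<in> carrier A" "y \<in> carrier A"
  shows "x \<ominus> y = \<zero> \<longleftrightarrow> x = y"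
  using assms by (metis a_minus_def add.inv_closed minus_equality minus_minus r_neg)

lemma prod_zero [simp]: "x \<in> carrier A \<Longrightarrow> \<zero> \<otimes> x = \<zero>" "x \<in> carrier A \<Longrightarrow> x \<otimes> \<zero> = \<zero>"
  using prod_smult_left[of \<zero> x 0] prod_smult_right[of x \<zero> 0] prod_closed[of \<zero> x] prod_closed[of x \<zero>]
  by simp_all

lemma submodule_base_fieldI:
  assumes "H \<subseteq> carrier A" "\<zero> \<in> H" "\<And>x y. x \<in> H \<Longrightarrow> y \<in> H \<Longrightarrow> x \<oplus> y \<in> H"
    "\<And>c x. x \<in> H \<Longrightarrow> c \<odot> x \<in> H"
  shows "submodule H base_field A"
proof (rule submoduleI)
  show "\<ominus> x \<in> H" if "x \<in> H" for x
    using assms(4)[OF that, of "- 1"] scalar_minus_one[of x] assms(1) that by auto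
qed (use assms in auto)

lemma finsum_in_submodule:
  assumes H: "submodule H base_field A" and "finite I" "\<And>i. i \<in> I \<Longrightarrow> f i \<in> H"
  shows "(\<Oplus>i\<in>I. f i) \<in> H"
  using assms(2,3)
proof (induction I)
  case empty
  then show ?case using submodule_base_fieldD[OF H nonassoc_algebra_axioms] by simp
next
  case (insert i I)
  note D = submodule_base_fieldD[OF H nonassoc_algebra_axioms]
  have "f \<in> I \<rightarrow> carrier A" "f i \<in> carrier A" using D(1) insert by auto
  then show ?case using insert D(3) by simp
qed

lemma eval_word_closed [simp]: "(\<And>i. a i \<in> carrier A) \<Longrightarrow> eval_word A a w \<in> carrier A"
  by (induction w) (auto intro: prod_closed)

lemma eval_eq_finsum:
  assumes "\<And>i. a i \<in> carrier A" "finite K" "supp f \<subseteq> K"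
  shows "eval A a f = (\<Oplus>w\<in>K. coeff f w \<odot> eval_word A a w)"
  unfolding eval_def
  by (rule add.finprod_mono_neutral_cong_left) (auto simp: assms in_keys_iff)

lemma eval_closed [simp]: "(\<And>i. a i \<in> carrier A) \<Longrightarrow> eval A a f \<in> carrier A"
  unfolding eval_def by (rule finsum_closed) auto

lemma eval_zero [simp]: "eval A a 0 = \<zero>"
  by (simp add: eval_def)

lemma eval_single [simp]:
  assumes "\<And>i. a i \<in> carrier A"
  shows "eval A a (monomial w c) = c \<odot> eval_word A a w"
  by (subst eval_eq_finsum[of a "{w}"]) (auto simp: assms finsum_insert)

lemma eval_nvar [simp]: "(\<And>i. a i \<in> carrier A) \<Longrightarrow> eval A a (nvar i) = a i"
  by (simp add: nvar_def)

lemma eval_add: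
  assumes a: "\<And>i. a i \<in> carrier A"
  shows "eval A a (f + g) = eval A a f \<oplus> eval A a g"
proof -
  let ?K = "supp f \<union> supp g"
  have "supp (f + g) \<subseteq> ?K" by (rule keys_add)
  then have "eval A a (f + g) = (\<Oplus>w\<in>?K. coeff f w \<odot> eval_word A a w
      \<oplus> coeff g w \<odot> eval_word A a w)"
    by (simp add: eval_eq_finsum[OF a, of ?K] lookup_add scalar_add a)
  also have "\<dots> = (\<Oplus>w\<in>?K. coeff f w \<odot> eval_word A a w)
      \<oplus> (\<Oplus>w\<in>?K. coeff g w \<odot> eval_word A a w)"
    by (rule finsum_addf) (auto simp: a)
  finally show ?thesis by (simp add: eval_eq_finsum[OF a, of ?K])
qed

lemma eval_nscale:
  assumes a: "\<And>i. a i \<in> carrier A"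
  shows "eval A a (nscale c f) = c \<odot> eval A a f"
proof -
  have "eval A a (nscale c f) = (\<Oplus>w\<in>supp f. c \<odot> (coeff f w \<odot> eval_word A a w))"
    by (simp add: eval_eq_finsum[OF a, of "supp f" "nscale c f"] keys_nscale a)
  also have "\<dots> = c \<odot> eval A a f"
    unfolding eval_def by (rule finsum_smult_ldistr[symmetric]) (auto simp: a)
  finally show ?thesis .
qed

lemma eval_uminus:
  assumes a: "\<And>i. a i \<in> carrier A"
  shows "eval A a (- f) = \<ominus> eval A a f"
proof -
  have "- f = nscale (- 1) f" by (rule poly_mapping_eqI) simp
  then show ?thesis using eval_nscale[of a "- 1" f, OF a] by (simp add: scalar_minus_one a)
qed

lemma eval_diff:
  assumes a: "\<And>i. a i \<in> carrier A"
  shows "eval A a (f - g) = eval A a f \<ominus> eval A a g"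
  using eval_add[of a f "- g", OF a] eval_uminus[of a g, OF a] by (simp add: a_minus_def)

lemma eval_nmult:
  assumes a: "\<And>i. a i \<in> carrier A"
  shows "eval A a (f \<star> g) = eval A a f \<otimes> eval A a g"
proof (induction f rule: npoly_induct)
  case zero
  then show ?case by (simp add: a)
next
  case (add f f')
  then show ?case by (simp add: nmult_add_left eval_add a prod_add_left)
next
  case (single w c)
  show ?case
  proof (induction g rule: npoly_induct)
    case zero
    then show ?case by (simp add: a)
  next
    case (add f f')
    then show ?case by (simp add: nmult_add_right eval_add a prod_add_right)
  next
    case (single v d)
    show ?case by (simp add: a prod_smult_left prod_smult_right prod_closed mult.commute)
  qed
qed

lemma eval_word_slot_add:
  assumes "\<And>i. a i \<in> carrier A" "x \<in> carrier A" "y \<in> carrier A"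
    "distinct (letters w)" "i \<in> set (letters w)"
  shows "eval_word A (a(i := x \<oplus> y)) w = eval_word A (a(i := x)) w \<oplus> eval_word A (a(i := y)) w"
  using assms(4,5)
proof (induction w)
  case (Prod u v)
  have indep: "eval_word A (a(i := z)) w = eval_word A a w" if "i \<notin> set (letters w)" for w z
    using that by (induction w) auto
  have slot: "(a(i := z)) j \<in> carrier A" if "z \<in> carrier A" for z j using that assms(1) by simp
  show ?case
  proof (cases "i \<in> set (letters u)")
    case True
    then have "i \<notin> set (letters v)" using Prod.prems by auto
    then show ?thesis using Prod True by (simp add: indep prod_add_left assms(1-3) slot del: fun_upd_apply)
  next
    case False
    then have "i \<in> set (letters v)" using Prod.prems by auto
    then show ?thesis using Prod False by (simp add: indep prod_add_right assms(1-3) slot del: fun_upd_apply)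
  qed
qed (use assms in simp)

lemma eval_word_slot_scalar:
  assumes "\<And>i. a i \<in> carrier A" "x \<in> carrier A" "distinct (letters w)" "i \<in> set (letters w)"
  shows "eval_word A (a(i := c \<odot> x)) w = c \<odot> eval_word A (a(i := x)) w"
  using assms(3,4)
proof (induction w)
  case (Prod u v)
  have indep: "eval_word A (a(i := z)) w = eval_word A a w" if "i \<notin> set (letters w)" for w z
    using that by (induction w) auto
  have slot: "(a(i := z)) j \<in> carrier A" if "z \<in> carrier A" for z j using that assms(1) by simp
  show ?case
  proof (cases "i \<in> set (letters u)")
    case True
    then have "i \<notin> set (letters v)" using Prod.prems by auto
    then show ?thesis using Prod True by (simp add: indep prod_smult_left assms(1,2) slot del: fun_upd_apply)
  next
    case False
    then have "i \<in> set (letters v)" using Prod.prems by auto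
    then show ?thesis using Prod False by (simp add: indep prod_smult_right assms(1,2) slot del: fun_upd_apply)
  qed
qed (use assms in simp)

lemma vanishing_slot_submodule:
  assumes a: "\<And>i. a i \<in> carrier A"
    and f: "\<And>w. w \<in> supp f \<Longrightarrow> distinct (letters w) \<and> i \<in> set (letters w)"
  shows "submodule {x \<in> carrier A. eval A (a(i := x)) f = \<zero>} base_field A"
proof -
  have slot: "(a(i := x)) j \<in> carrier A" if "x \<in> carrier A" for x j using that a by simp
  have add: "eval A (a(i := x \<oplus> y)) f = eval A (a(i := x)) f \<oplus> eval A (a(i := y)) f"
    if xy: "x \<in> carrier A" "y \<in> carrier A" for x y
  proof -
    have "eval A (a(i := x \<oplus> y)) f = (\<Oplus>w\<in>supp f.
        coeff f w \<odot> eval_word A (a(i := x)) w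
        \<oplus> coeff f w \<odot> eval_word A (a(i := y)) w)"
      unfolding eval_def
      by (rule finsum_cong')
        (use f in \<open>auto simp: eval_word_slot_add[OF a xy] scalar_add_right slot xy simp del: fun_upd_apply\<close>)
    also have "\<dots> = eval A (a(i := x)) f \<oplus> eval A (a(i := y)) f"
      unfolding eval_def
      by (rule finsum_addf) (auto simp: slot xy simp del: fun_upd_apply)
    finally show ?thesis .
  qed
  have scal: "eval A (a(i := c \<odot> x)) f = c \<odot> eval A (a(i := x)) f"
    if x: "x \<in> carrier A" for c x
  proof -
    have "eval A (a(i := c \<odot> x)) f = (\<Oplus>w\<in>supp f.
        c \<odot> (coeff f w \<odot> eval_word A (a(i := x)) w))"
      unfolding eval_def
      by (rule finsum_cong')
        (use f in \<open>auto simp: eval_word_slot_scalar[OF a x] slot x mult.commute simp del: fun_upd_apply\<close>)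
    also have "\<dots> = c \<odot> eval A (a(i := x)) f"
      unfolding eval_def
      by (rule finsum_smult_ldistr[symmetric]) (auto simp: slot x simp del: fun_upd_apply)
    finally show ?thesis .
  qed
  show ?thesis
  proof (rule submodule_base_fieldI)
    have "eval A (a(i := 0 \<odot> \<zero>)) f = 0 \<odot> eval A (a(i := \<zero>)) f"
      by (rule scal) simp
    then show "\<zero> \<in> {x \<in> carrier A. eval A (a(i := x)) f = \<zero>}"
      by (simp add: slot del: fun_upd_apply)
  qed (auto simp: add scal simp del: fun_upd_apply)
qed

text \<open>The variables of \<open>Y\<close> are released one at a time: with the others fixed, the values of one
  variable at which \<open>f\<close> vanishes form a submodule.\<close>

lemma eval_zero_on_spanning_set:
  assumes "spans A M" "finite Y"
    and f: "\<And>w. w \<in> supp f \<Longrightarrow> distinct (letters w) \<and> Y \<subseteq> set (letters w)"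
    and "\<And>i. a i \<in> carrier A"
    and "\<And>b. (\<And>i. i \<notin> Y \<Longrightarrow> b i = a i) \<Longrightarrow> (\<And>i. i \<in> Y \<Longrightarrow> b i \<in> M) \<Longrightarrow> eval A b f = \<zero>"
  shows "eval A a f = \<zero>"
  using assms(2-)
proof (induction Y arbitrary: a)
  case empty
  then show ?case by auto
next
  case (insert i Y)
  let ?N = "{x \<in> carrier A. eval A (a(i := x)) f = \<zero>}"
  have "submodule ?N base_field A"
    by (rule vanishing_slot_submodule) (use insert.prems in auto)
  moreover have "M \<subseteq> ?N"
  proof
    fix x assume x: "x \<in> M"
    then have xA: "x \<in> carrier A" using assms(1) by (auto simp: spans_def)
    have "eval A (a(i := x)) f = \<zero>"
    proof (rule insert.IH)
      fix b assume b: "\<And>j. j \<notin> Y \<Longrightarrow> b j = (a(i := x)) j" "\<And>j. j \<in> Y \<Longrightarrow> b j \<in> M"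
      show "eval A b f = \<zero>"
        by (rule insert.prems(3)) (use b x insert.hyps in \<open>auto split: if_splits\<close>)
    qed (use insert.prems xA in auto)
    then show "x \<in> ?N" using xA by simp
  qed
  ultimately have "carrier A \<subseteq> ?N" using assms(1) by (auto simp: spans_def)
  then have "a i \<in> ?N" using insert.prems(2) by blast
  then show ?case by simp
qed

end

definition algebra_hom ::
  "('f::field_char_0, 'a, 'm) module_scheme \<Rightarrow> ('f, 'b, 'n) module_scheme \<Rightarrow> ('a \<Rightarrow> 'b) \<Rightarrow> bool" where
  "algebra_hom A B \<phi> \<longleftrightarrow> \<phi> \<in> carrier A \<rightarrow> carrier B \<and>
     (\<forall>x\<in>carrier A. \<forall>y\<in>carrier A. \<phi> (x \<oplus>\<^bsub>A\<^esub> y) = \<phi> x \<oplus>\<^bsub>B\<^esub> \<phi> y \<and> \<phi> (x \<otimes>\<^bsub>A\<^esub> y) = \<phi> x \<otimes>\<^bsub>B\<^esub> \<phi> y) \<and>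
     (\<forall>c. \<forall>x\<in>carrier A. \<phi> (c \<odot>\<^bsub>A\<^esub> x) = c \<odot>\<^bsub>B\<^esub> \<phi> x)"

lemma algebra_hom_eval:
  assumes A: "nonassoc_algebra A" and B: "nonassoc_algebra B" and \<phi>: "algebra_hom A B \<phi>"
    and a: "\<And>i. a i \<in> carrier A"
  shows "\<phi> (eval A a f) = eval B (\<lambda>i. \<phi> (a i)) f"
proof -
  interpret A: nonassoc_algebra A by fact
  interpret B: nonassoc_algebra B by fact
  have b: "\<phi> (a i) \<in> carrier B" for i using a \<phi> by (auto simp: algebra_hom_def)
  have word: "\<phi> (eval_word A a w) = eval_word B (\<lambda>i. \<phi> (a i)) w" for w
  proof (induction w)
    case (Prod u v)
    then show ?case
      using \<phi> A.eval_word_closed[of a u] A.eval_word_closed[of a v] a by (simp add: algebra_hom_def)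
  qed simp
  have zero: "\<phi> \<zero>\<^bsub>A\<^esub> = \<zero>\<^bsub>B\<^esub>"
  proof -
    have "\<phi> (0 \<odot>\<^bsub>A\<^esub> \<zero>\<^bsub>A\<^esub>) = 0 \<odot>\<^bsub>B\<^esub> \<phi> \<zero>\<^bsub>A\<^esub>" "\<phi> \<zero>\<^bsub>A\<^esub> \<in> carrier B"
      using \<phi> A.zero_closed unfolding algebra_hom_def by (blast, auto)
    then show ?thesis by simp
  qed
  show ?thesis
  proof (induction f rule: npoly_induct)
    case zero
    then show ?case by (simp add: \<open>\<phi> \<zero>\<^bsub>A\<^esub> = \<zero>\<^bsub>B\<^esub>\<close>)
  next
    case (single w c)
    then show ?case using \<phi> a b by (simp add: algebra_hom_def word)
  next
    case (add f g)
    then show ?case using \<phi> a b by (simp add: algebra_hom_def A.eval_add B.eval_add)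
  qed
qed

lemma lookup_superization [simp]:
  "coeff (superization p f) w = koszul_sign p (letters w) * coeff f w"
  by (simp add: superization_def lookup_sum lookup_single when_def in_keys_iff)

lemma keys_superization [simp]: "supp (superization p f) = supp f"
  by (auto simp: in_keys_iff)

lemma superization_add: "superization p (f + g) = superization p f + superization p g"
  by (rule poly_mapping_eqI) (simp add: lookup_add algebra_simps)

lemma superization_diff: "superization p (f - g) = superization p f - superization p g"
  by (rule poly_mapping_eqI) (simp add: lookup_minus algebra_simps)

lemma superization_single [simp]:
  "superization p (monomial w c) = monomial w (koszul_sign p (letters w) * c)"
  by (rule poly_mapping_eqI) (simp add: lookup_single when_def)

section \<open>Superidentities and the Grassmann envelope\<close>

lemma eval_word_cong: "(\<And>i. i \<in> set (letters w) \<Longrightarrow> a i = b i) \<Longrightarrow> eval_word A a w = eval_word A b w"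
  by (induction w) auto

lemma (in nonassoc_algebra) eval_cong:
  assumes "\<And>w i. w \<in> supp f \<Longrightarrow> i \<in> set (letters w) \<Longrightarrow> a i = b i"
    and "\<And>i. b i \<in> carrier A"
  shows "eval A a f = eval A b f"
  unfolding eval_def
proof (rule finsum_cong')
  show "coeff f w \<odot> eval_word A a w = coeff f w \<odot> eval_word A b w"
    if "w \<in> supp f" for w
    using eval_word_cong[of w a b A] assms(1) that by simp
qed (use assms(2) in auto)

text \<open>The element \<open>e\<^sub>S \<otimes> x\<close> of the envelope.\<close>

definition tensor :: "('f::field_char_0, 'a, 'm) module_scheme \<Rightarrow> nat set \<Rightarrow> 'a \<Rightarrow> nat set \<Rightarrow> 'a" where
  "tensor A S x = (\<lambda>R. if R = S then x else \<zero>\<^bsub>A\<^esub>)"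

lemma tensor_apply [simp]: "tensor A S x S = x" "R \<noteq> S \<Longrightarrow> tensor A S x R = \<zero>\<^bsub>A\<^esub>"
  by (simp_all add: tensor_def)

context superalgebra
begin

abbreviation "G \<equiv> grassmann_envelope A"

lemma grade_carrier: "x \<in> grade A i \<Longrightarrow> x \<in> carrier A"
  using submodule_base_fieldD(1)[OF grade_subspace nonassoc_algebra_axioms] by auto

lemma grade_zero [simp]: "\<zero> \<in> grade A i"
  using submodule_base_fieldD(2)[OF grade_subspace nonassoc_algebra_axioms] .

lemma grade_add: "x \<in> grade A i \<Longrightarrow> y \<in> grade A i \<Longrightarrow> x \<oplus> y \<in> grade A i"
  using submodule_base_fieldD(3)[OF grade_subspace nonassoc_algebra_axioms] .

lemma grade_scalar: "x \<in> grade A i \<Longrightarrow> c \<odot> x \<in> grade A i"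
  using submodule_base_fieldD(4)[OF grade_subspace nonassoc_algebra_axioms] .

lemma carrier_decomp:
  assumes "x \<in> carrier A"
  obtains y z where "y \<in> grade A 0" "z \<in> grade A 1" "x = y \<oplus> z"
  using assms unfolding grade_sum[symmetric] set_add_def' by auto

lemma spans_homogeneous: "spans A (grade A 0 \<union> grade A 1)"
  unfolding spans_def
proof (intro conjI allI impI subsetI)
  fix H x assume H: "submodule H base_field A \<and> grade A 0 \<union> grade A 1 \<subseteq> H" and "x \<in> carrier A"
  then obtain y z where "y \<in> grade A 0" "z \<in> grade A 1" "x = y \<oplus> z" using carrier_decomp by blast
  then show "x \<in> H" using H submodule_base_fieldD(3)[OF _ nonassoc_algebra_axioms, of H y z] by auto
qed (auto intro: grade_carrier)

lemma envelope_carrier_iff: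
  "u \<in> carrier G \<longleftrightarrow> finite {S. u S \<noteq> \<zero>} \<and> (\<forall>S. infinite S \<longrightarrow> u S = \<zero>) \<and>
                   (\<forall>S. finite S \<longrightarrow> u S \<in> grade A (of_nat (card S)))"
  by (simp add: grassmann_envelope_def)

lemma envelope_value_closed [simp]: "u \<in> carrier G \<Longrightarrow> u S \<in> carrier A"
  by (cases "finite S") (auto simp: envelope_carrier_iff intro: grade_carrier)

lemma envelope_add [simp]: "(u \<oplus>\<^bsub>G\<^esub> v) S = u S \<oplus> v S"
  by (simp add: grassmann_envelope_def)

lemma envelope_zero [simp]: "\<zero>\<^bsub>G\<^esub> S = \<zero>"
  by (simp add: grassmann_envelope_def)

lemma envelope_scalar [simp]: "(c \<odot>\<^bsub>G\<^esub> u) S = c \<odot> u S"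
  by (simp add: grassmann_envelope_def)

lemma envelope_mult:
  "(u \<otimes>\<^bsub>G\<^esub> v) R = (if finite R
     then \<Oplus>S \<in> Pow R. grassmann_sign S (R - S) \<odot> (u S \<otimes> v (R - S)) else \<zero>)"
  by (simp add: grassmann_envelope_def)

lemma envelope_mult_closed:
  assumes u: "u \<in> carrier G" and v: "v \<in> carrier G"
  shows "u \<otimes>\<^bsub>G\<^esub> v \<in> carrier G"
  unfolding envelope_carrier_iff
proof (intro conjI allI impI)
  show "infinite R \<Longrightarrow> (u \<otimes>\<^bsub>G\<^esub> v) R = \<zero>" for R by (simp add: envelope_mult)
  show "(u \<otimes>\<^bsub>G\<^esub> v) R \<in> grade A (of_nat (card R))" if R: "finite R" for R
  proof -
    have "grassmann_sign S (R - S) \<odot> (u S \<otimes> v (R - S)) \<in> grade A (of_nat (card R))"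
      if "S \<in> Pow R" for S
    proof -
      have S: "finite S" using that R finite_subset by auto
      have "card R = card S + card (R - S)"
        using that R S by (simp add: card_Diff_subset card_mono)
      moreover have "u S \<in> grade A (of_nat (card S))" "v (R - S) \<in> grade A (of_nat (card (R - S)))"
        using u v S R by (auto simp: envelope_carrier_iff)
      ultimately show ?thesis using grade_prod grade_scalar by fastforce
    qed
    then show ?thesis
      using finsum_in_submodule[OF grade_subspace, of "Pow R"] R by (simp add: envelope_mult)
  qed
  let ?P = "(\<lambda>(S, T). S \<union> T) ` ({S. u S \<noteq> \<zero>} \<times> {S. v S \<noteq> \<zero>})"
  have "{R. (u \<otimes>\<^bsub>G\<^esub> v) R \<noteq> \<zero>} \<subseteq> ?P"
  proof
    fix R assume "R \<in> {R. (u \<otimes>\<^bsub>G\<^esub> v) R \<noteq> \<zero>}"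
    then have R: "finite R" "(\<Oplus>S \<in> Pow R. grassmann_sign S (R - S) \<odot> (u S \<otimes> v (R - S))) \<noteq> \<zero>"
      by (auto simp: envelope_mult split: if_splits)
    then obtain S where S: "S \<subseteq> R" "grassmann_sign S (R - S) \<odot> (u S \<otimes> v (R - S)) \<noteq> \<zero>"
      using add.finprod_one_eqI[of "Pow R" "\<lambda>S. grassmann_sign S (R - S) \<odot> (u S \<otimes> v (R - S))"] by auto
    then have "u S \<noteq> \<zero>" "v (R - S) \<noteq> \<zero>" using u v by auto
    moreover have "R = S \<union> (R - S)" using S by auto
    ultimately show "R \<in> ?P" by (auto intro!: image_eqI[where x = "(S, R - S)"])
  qed
  moreover have "finite ?P" using u v by (auto simp: envelope_carrier_iff)
  ultimately show "finite {R. (u \<otimes>\<^bsub>G\<^esub> v) R \<noteq> \<zero>}" by (rule finite_subset)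
qed

lemma envelope_scalar_closed: "u \<in> carrier G \<Longrightarrow> c \<odot>\<^bsub>G\<^esub> u \<in> carrier G"
proof -
  assume u: "u \<in> carrier G"
  then have "{S. (c \<odot>\<^bsub>G\<^esub> u) S \<noteq> \<zero>} \<subseteq> {S. u S \<noteq> \<zero>}" by auto
  then show ?thesis using u finite_subset by (auto simp: envelope_carrier_iff grade_scalar)
qed

lemma envelope_abelian_group: "abelian_group G"
proof (rule abelian_groupI)
  fix u v assume u: "u \<in> carrier G" and v: "v \<in> carrier G"
  have "{S. (u \<oplus>\<^bsub>G\<^esub> v) S \<noteq> \<zero>} \<subseteq> {S. u S \<noteq> \<zero>} \<union> {S. v S \<noteq> \<zero>}" by auto
  then have "finite {S. (u \<oplus>\<^bsub>G\<^esub> v) S \<noteq> \<zero>}"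
    using u v by (auto simp: envelope_carrier_iff intro: finite_subset)
  then show "u \<oplus>\<^bsub>G\<^esub> v \<in> carrier G"
    using u v by (auto simp: envelope_carrier_iff grade_add)
  show "u \<oplus>\<^bsub>G\<^esub> v = v \<oplus>\<^bsub>G\<^esub> u" using u v by (auto simp: fun_eq_iff a_comm)
next
  fix u assume u: "u \<in> carrier G"
  have "(- 1) \<odot>\<^bsub>G\<^esub> u \<oplus>\<^bsub>G\<^esub> u = \<zero>\<^bsub>G\<^esub>"
    using u by (auto simp: fun_eq_iff scalar_minus_one l_neg)
  then show "\<exists>v\<in>carrier G. v \<oplus>\<^bsub>G\<^esub> u = \<zero>\<^bsub>G\<^esub>" using envelope_scalar_closed[OF u] by blast
  show "\<zero>\<^bsub>G\<^esub> \<oplus>\<^bsub>G\<^esub> u = u" using u by (auto simp: fun_eq_iff)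
next
  show "\<zero>\<^bsub>G\<^esub> \<in> carrier G" by (simp add: envelope_carrier_iff)
qed (auto simp: fun_eq_iff a_assoc)

lemma envelope_module: "Module.module base_field G"
  by (rule moduleI)
    (auto simp: fun_eq_iff cring_base_field envelope_abelian_group envelope_scalar_closed
      scalar_add scalar_add_right)

lemma envelope_algebra: "nonassoc_algebra G"
proof (rule nonassoc_algebra.intro[OF envelope_module])
  show "nonassoc_algebra_axioms G"
  proof
    fix u v w c assume uvw: "u \<in> carrier G" "v \<in> carrier G" "w \<in> carrier G"
    note mult_simps = envelope_mult uvw prod_closed scalar_add_right Pi_def
    have "((u \<oplus>\<^bsub>G\<^esub> v) \<otimes>\<^bsub>G\<^esub> w) R = (u \<otimes>\<^bsub>G\<^esub> w \<oplus>\<^bsub>G\<^esub> v \<otimes>\<^bsub>G\<^esub> w) R"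
      "(u \<otimes>\<^bsub>G\<^esub> (v \<oplus>\<^bsub>G\<^esub> w)) R = (u \<otimes>\<^bsub>G\<^esub> v \<oplus>\<^bsub>G\<^esub> u \<otimes>\<^bsub>G\<^esub> w) R" for R
      by (cases "finite R"; simp add: mult_simps prod_add_left prod_add_right finsum_addf)+
    then show "(u \<oplus>\<^bsub>G\<^esub> v) \<otimes>\<^bsub>G\<^esub> w = u \<otimes>\<^bsub>G\<^esub> w \<oplus>\<^bsub>G\<^esub> v \<otimes>\<^bsub>G\<^esub> w"
      "u \<otimes>\<^bsub>G\<^esub> (v \<oplus>\<^bsub>G\<^esub> w) = u \<otimes>\<^bsub>G\<^esub> v \<oplus>\<^bsub>G\<^esub> u \<otimes>\<^bsub>G\<^esub> w"
      by auto
  next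
    fix u v c assume uv: "u \<in> carrier G" "v \<in> carrier G"
    note mult_simps = envelope_mult uv prod_closed Pi_def mult.commute
    have "((c \<odot>\<^bsub>G\<^esub> u) \<otimes>\<^bsub>G\<^esub> v) R = (c \<odot>\<^bsub>G\<^esub> (u \<otimes>\<^bsub>G\<^esub> v)) R"
      "(u \<otimes>\<^bsub>G\<^esub> (c \<odot>\<^bsub>G\<^esub> v)) R = (c \<odot>\<^bsub>G\<^esub> (u \<otimes>\<^bsub>G\<^esub> v)) R" for R
      by (cases "finite R"; simp add: mult_simps prod_smult_left prod_smult_right finsum_smult_ldistr)+
    then show "(c \<odot>\<^bsub>G\<^esub> u) \<otimes>\<^bsub>G\<^esub> v = c \<odot>\<^bsub>G\<^esub> (u \<otimes>\<^bsub>G\<^esub> v)"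
      "u \<otimes>\<^bsub>G\<^esub> (c \<odot>\<^bsub>G\<^esub> v) = c \<odot>\<^bsub>G\<^esub> (u \<otimes>\<^bsub>G\<^esub> v)"
      by auto
  qed (rule envelope_mult_closed)
qed

sublocale envelope: nonassoc_algebra G by (rule envelope_algebra)

lemma envelope_finsum_apply:
  assumes "finite I" "\<And>i. i \<in> I \<Longrightarrow> h i \<in> carrier G"
  shows "(\<Oplus>\<^bsub>G\<^esub>i\<in>I. h i) R = (\<Oplus>i\<in>I. h i R)"
  using assms
proof (induction I)
  case (insert i I)
  then have "h \<in> I \<rightarrow> carrier G" "h i \<in> carrier G" "(\<lambda>i. h i R) \<in> I \<rightarrow> carrier A" "h i R \<in> carrier A" by auto
  then show ?case using insert by simp
qed simp

lemma tensor_closed [simp]: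
  assumes "finite S" "x \<in> grade A (of_nat (card S))"
  shows "tensor A S x \<in> carrier G"
  using assms finite_subset[of "{R. tensor A S x R \<noteq> \<zero>}" "{S}"]
  by (auto simp: envelope_carrier_iff tensor_def)

lemma tensor_mult:
  assumes S: "finite S" and T: "finite T" and x: "x \<in> carrier A" and y: "y \<in> carrier A"
  shows "tensor A S x \<otimes>\<^bsub>G\<^esub> tensor A T y =
    (if S \<inter> T = {} then tensor A (S \<union> T) (grassmann_sign S T \<odot> (x \<otimes> y)) else \<zero>\<^bsub>G\<^esub>)"
proof
  fix R
  have c: "tensor A S x Q \<in> carrier A" "tensor A T y Q \<in> carrier A" for Q
    using x y by (auto simp: tensor_def)
  let ?h = "\<lambda>Q. grassmann_sign Q (R - Q) \<odot> (tensor A S x Q \<otimes> tensor A T y (R - Q))"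
  have zero: "?h Q = \<zero>" if "\<not> (Q = S \<and> R - S = T)" for Q
    using that x y by (auto simp: tensor_def)
  show "(tensor A S x \<otimes>\<^bsub>G\<^esub> tensor A T y) R =
    (if S \<inter> T = {} then tensor A (S \<union> T) (grassmann_sign S T \<odot> (x \<otimes> y)) else \<zero>\<^bsub>G\<^esub>) R"
  proof (cases "finite R \<and> S \<inter> T = {} \<and> R = S \<union> T")
    case True
    then have RS: "R - S = T" by auto
    have "(\<Oplus>Q\<in>Pow R. ?h Q) = (\<Oplus>Q\<in>Pow R. if S = Q then ?h Q else \<zero>)"
      by (rule finsum_cong') (use zero c x in \<open>auto simp: prod_closed\<close>)
    also have "\<dots> = ?h S"
      by (rule finsum_singleton) (use True c in \<open>auto simp: prod_closed\<close>)
    finally show ?thesis using True RS S T by (simp add: envelope_mult tensor_def)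
  next
    case False
    have "(\<Oplus>Q\<in>Pow R. ?h Q) = \<zero>" if "finite R"
      by (rule add.finprod_one_eqI, rule zero) (use False that in auto)
    moreover have "tensor A (S \<union> T) z R = \<zero>" if "S \<inter> T = {}" for z
      using False that S T by (auto simp: tensor_def)
    ultimately show ?thesis by (auto simp: envelope_mult)
  qed
qed

lemma spans_tensors: "spans G {tensor A S x | S x. finite S \<and> x \<in> grade A (of_nat (card S))}"
  (is "spans G ?M")
  unfolding spans_def
proof (intro conjI allI impI subsetI)
  fix H u assume H: "submodule H base_field G \<and> ?M \<subseteq> H" and u: "u \<in> carrier G"
  note D = submodule_base_fieldD[OF conjunct1[OF H] envelope_algebra]
  have "u \<in> H" if "finite F" "u \<in> carrier G" "{S. u S \<noteq> \<zero>} \<subseteq> F" for F u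
    using that
  proof (induction F arbitrary: u)
    case empty
    then have "u = \<zero>\<^bsub>G\<^esub>" by (auto simp: fun_eq_iff)
    then show ?case using D(2) by (simp only:)
  next
    case (insert S F)
    show ?case
    proof (cases "finite S")
      case True
      have "u(S := \<zero>) \<in> H"
      proof (rule insert.IH)
        have "{R. (u(S := \<zero>)) R \<noteq> \<zero>} \<subseteq> {R. u R \<noteq> \<zero>}" by auto
        then have "finite {R. (u(S := \<zero>)) R \<noteq> \<zero>}"
          by (rule finite_subset) (use insert.prems(1) in \<open>simp add: envelope_carrier_iff\<close>)
        then show "u(S := \<zero>) \<in> carrier G"
          using insert.prems(1) by (simp add: envelope_carrier_iff)
        show "{R. (u(S := \<zero>)) R \<noteq> \<zero>} \<subseteq> F" using insert.prems by auto
      qed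
      moreover have "tensor A S (u S) \<in> H"
      proof -
        have "u S \<in> grade A (of_nat (card S))"
          using True insert.prems(1) by (simp add: envelope_carrier_iff)
        then show ?thesis using H True by blast
      qed
      moreover have "u = u(S := \<zero>) \<oplus>\<^bsub>G\<^esub> tensor A S (u S)"
        using insert.prems(1) by (auto simp: fun_eq_iff tensor_def)
      ultimately show ?thesis using D(3) by metis
    next
      case False
      then have "{S. u S \<noteq> \<zero>} \<subseteq> F" using insert.prems by (auto simp: envelope_carrier_iff)
      then show ?thesis using insert by simp
    qed
  qed
  then show "u \<in> H" using u by (auto simp: envelope_carrier_iff)
qed auto

text \<open>Each letter is used once, so the Grassmann factors contribute a single sign, or zero if
  two of them share a generator.\<close>

lemma eval_word_tensor:
  assumes S: "\<And>i. finite (S i)" and a: "\<And>i. a i \<in> grade A (of_nat (card (S i)))"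
    and "distinct (letters w)"
  shows "eval_word G (\<lambda>i. tensor A (S i) (a i)) w =
    (if disjoint_family_on S (set (letters w))
     then tensor A (\<Union>i\<in>set (letters w). S i) (grassmann_list_sign S (letters w) \<odot> eval_word A a w)
     else \<zero>\<^bsub>G\<^esub>)"
  using assms(3)
proof (induction w)
  case (Gen x)
  then show ?case using a[of x] grade_carrier by (simp add: disjoint_family_on_def)
next
  case (Prod u v)
  let ?e = "eval_word G (\<lambda>i. tensor A (S i) (a i))"
  let ?U = "\<lambda>w. \<Union>i\<in>set (letters w). S i"
  have e: "?e w \<in> carrier G" for w using S a by simp
  have ac: "eval_word A a w \<in> carrier A" for w using grade_carrier[OF a] by simp
  have fin: "finite (?U w)" for w using S by simp
  have dist: "set (letters u) \<inter> set (letters v) = {}" using Prod.prems by simp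
  show ?case
  proof (cases "disjoint_family_on S (set (letters u)) \<and> disjoint_family_on S (set (letters v))")
    case False
    then have "\<not> disjoint_family_on S (set (letters (Prod u v)))"
      by (auto simp: disjoint_family_on_def)
    moreover have "?e u = \<zero>\<^bsub>G\<^esub> \<or> ?e v = \<zero>\<^bsub>G\<^esub>" using False Prod by auto
    ultimately show ?thesis using e by auto
  next
    case True
    have "disjoint_family_on S (set (letters (Prod u v))) \<longleftrightarrow> ?U u \<inter> ?U v = {}"
    proof
      assume "disjoint_family_on S (set (letters (Prod u v)))"
      then show "?U u \<inter> ?U v = {}" using dist by (intro disjoint_family_on_UN_Int) auto
    next
      assume "?U u \<inter> ?U v = {}"
      then show "disjoint_family_on S (set (letters (Prod u v)))"
        using True unfolding disjoint_family_on_def by auto blast+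
    qed
    moreover have "grassmann_list_sign S (letters u @ letters v) =
      grassmann_list_sign S (letters u) * grassmann_list_sign S (letters v) * (grassmann_sign (?U u) (?U v) :: 'f)"
      if "disjoint_family_on S (set (letters (Prod u v)))"
      using grassmann_list_sign_append[of S "letters u" "letters v"] S Prod.prems that by simp
    ultimately show ?thesis
      using Prod True by (auto simp: tensor_mult fin ac prod_smult_left prod_smult_right prod_closed
          UN_Un mult_ac simp del: UN_simps)
  qed
qed

text \<open>The factor \<open>\<epsilon>\<close> by which Grassmann and Koszul signs differ is the same for all words of a
  multilinear polynomial, so the evaluation is that of its superization.\<close>

lemma eval_tensor:
  assumes S: "\<And>i. finite (S i)" and a: "\<And>i. a i \<in> grade A (of_nat (card (S i)))"
    and f: "\<And>w. w \<in> supp f \<Longrightarrow> distinct (letters w) \<and> set (letters w) = X"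
    and disj: "disjoint_family_on S X"
    and \<epsilon>: "\<And>w. w \<in> supp f \<Longrightarrow>
      grassmann_list_sign S (letters w) = \<epsilon> * koszul_sign p (letters w)"
  shows "eval G (\<lambda>i. tensor A (S i) (a i)) f =
    tensor A (\<Union>i\<in>X. S i) (\<epsilon> \<odot> eval A a (superization p f))"
proof
  fix R
  let ?e = "eval_word G (\<lambda>i. tensor A (S i) (a i))"
  have e: "?e w \<in> carrier G" for w using S a by simp
  have ac: "eval_word A a w \<in> carrier A" for w using grade_carrier[OF a] by simp
  have w: "?e w = tensor A (\<Union>i\<in>X. S i) ((\<epsilon> * koszul_sign p (letters w)) \<odot> eval_word A a w)"
    if "w \<in> supp f" for w
    using eval_word_tensor[of S a w, OF S a] f[OF that] disj \<epsilon>[OF that] by simp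
  have "eval G (\<lambda>i. tensor A (S i) (a i)) f R
     = (\<Oplus>w\<in>supp f. coeff f w \<odot> ?e w R)"
    unfolding eval_def by (subst envelope_finsum_apply) (auto intro: envelope.scalar_closed e)
  also have "\<dots> = tensor A (\<Union>i\<in>X. S i) (\<epsilon> \<odot> eval A a (superization p f)) R"
  proof (cases "R = (\<Union>i\<in>X. S i)")
    case False
    have "(\<Oplus>w\<in>supp f. coeff f w \<odot> ?e w R) = \<zero>"
      by (rule add.finprod_one_eqI) (simp add: w False)
    then show ?thesis using False by simp
  next
    case True
    have "(\<Oplus>w\<in>supp f. coeff f w \<odot> ?e w R)
      = (\<Oplus>w\<in>supp f. \<epsilon> \<odot> (coeff (superization p f) w \<odot> eval_word A a w))"
      by (rule finsum_cong') (use True w in \<open>auto simp: ac mult_ac\<close>)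
    also have "\<dots> = \<epsilon> \<odot> eval A a (superization p f)"
      unfolding eval_def by (subst finsum_smult_ldistr) (auto simp: ac)
    finally show ?thesis using True by simp
  qed
  finally show "eval G (\<lambda>i. tensor A (S i) (a i)) f R
     = tensor A (\<Union>i\<in>X. S i) (\<epsilon> \<odot> eval A a (superization p f)) R" .
qed

text \<open>By multilinearity it suffices to evaluate at tensors \<open>e\<^sub>S \<otimes> x\<close>. If two of the sets meet, every
  word vanishes; otherwise the value is that of a superization.\<close>

lemma satisfies_super_imp_envelope_satisfies:
  assumes "multilinear f" "satisfies_super A f"
  shows "satisfies G f"
  unfolding satisfies_def
proof (intro allI impI)
  obtain X where f: "\<And>w. w \<in> supp f \<Longrightarrow> distinct (letters w) \<and> set (letters w) = X"
    using assms(1) by (auto simp: multilinear_def)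
  fix u :: "nat \<Rightarrow> nat set \<Rightarrow> 'a" assume u: "\<forall>i. u i \<in> carrier G"
  show "eval G u f = \<zero>\<^bsub>G\<^esub>"
  proof (cases "f = 0")
    case False
    then obtain w0 where w0: "w0 \<in> supp f" by fastforce
    have X: "finite X" using f[OF w0] by auto
    show ?thesis
    proof (rule envelope.eval_zero_on_spanning_set[OF spans_tensors X])
      fix b :: "nat \<Rightarrow> nat set \<Rightarrow> 'a"
      assume "\<And>i. i \<in> X \<Longrightarrow> b i \<in> {tensor A S x | S x. finite S \<and> x \<in> grade A (of_nat (card S))}"
      then have "\<exists>Sx. \<forall>i\<in>X. finite (fst (Sx i)) \<and> snd (Sx i) \<in> grade A (of_nat (card (fst (Sx i))))
          \<and> b i = tensor A (fst (Sx i)) (snd (Sx i))"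
        by (intro bchoice) fastforce
      then obtain Sx where Sx: "\<And>i. i \<in> X \<Longrightarrow> finite (fst (Sx i)) \<and>
        snd (Sx i) \<in> grade A (of_nat (card (fst (Sx i)))) \<and> b i = tensor A (fst (Sx i)) (snd (Sx i))" by blast
      define S where "S i = (if i \<in> X then fst (Sx i) else {})" for i
      define a where "a i = (if i \<in> X then snd (Sx i) else \<zero>)" for i
      have S: "finite (S i)" and a: "a i \<in> grade A (of_nat (card (S i)))" for i
        using Sx[of i] by (auto simp: S_def a_def)
      have eq: "eval G b f = eval G (\<lambda>i. tensor A (S i) (a i)) f"
        by (rule envelope.eval_cong) (use f Sx S a in \<open>auto simp: S_def a_def\<close>)
      show "eval G b f = \<zero>\<^bsub>G\<^esub>"
      proof (cases "disjoint_family_on S X")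
        case True
        define p :: "nat \<Rightarrow> bit" where "p i = of_nat (card (S i))" for i
        define \<epsilon> :: 'f where "\<epsilon> = grassmann_list_sign S (letters w0) * koszul_sign p (letters w0)"
        have "grassmann_list_sign S (letters w) = \<epsilon> * koszul_sign p (letters w)"
          if w: "w \<in> supp f" for w
        proof -
          have "grassmann_list_sign S (letters w) * koszul_sign p (letters w) = \<epsilon>"
            unfolding \<epsilon>_def
            by (rule grassmann_koszul_order_independent[OF S _ True])
              (use f[OF w] f[OF w0] in \<open>auto simp: p_def\<close>)
          then have "\<epsilon> * koszul_sign p (letters w) =
            grassmann_list_sign S (letters w) * (koszul_sign p (letters w) * koszul_sign p (letters w))"
            by (metis mult.assoc)
          then show ?thesis by simp
        qed
        then have "eval G (\<lambda>i. tensor A (S i) (a i)) f =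
            tensor A (\<Union>i\<in>X. S i) (\<epsilon> \<odot> eval A a (superization p f))"
          using S a f True by (intro eval_tensor) auto
        also have "eval A a (superization p f) = \<zero>"
          using assms(2) a by (auto simp: satisfies_super_def p_def)
        finally show ?thesis unfolding eq by (auto simp: tensor_def fun_eq_iff)
      next
        case False
        have "eval_word G (\<lambda>i. tensor A (S i) (a i)) w = \<zero>\<^bsub>G\<^esub>" if "w \<in> supp f" for w
          using eval_word_tensor[of S a w, OF S a] f[OF that] False by simp
        then show ?thesis unfolding eq unfolding eval_def
          by (intro envelope.add.finprod_one_eqI) simp
      qed
    qed (use f u in auto)
  qed simp
qed

text \<open>Tensoring the odd arguments with distinct generators \<open>e\<^sub>i\<close> produces the Koszul signs.\<close>

lemma envelope_satisfies_imp_satisfies_super: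
  assumes "multilinear f" "satisfies G f"
  shows "satisfies_super A f"
  unfolding satisfies_super_def
proof (intro allI impI)
  obtain X where f: "\<And>w. w \<in> supp f \<Longrightarrow> distinct (letters w) \<and> set (letters w) = X"
    using assms(1) by (auto simp: multilinear_def)
  fix p :: "nat \<Rightarrow> bit" and a assume a: "\<forall>i. a i \<in> grade A (p i)"
  let ?u = "\<lambda>i. tensor A (odd_singleton p i) (a i)"
  have "eval G ?u f = tensor A (\<Union>i\<in>X. odd_singleton p i) (1 \<odot> eval A a (superization p f))"
    using a f by (intro eval_tensor) (auto simp: koszul_sign_eq_grassmann)
  moreover have "eval G ?u f = \<zero>\<^bsub>G\<^esub>"
    using assms(2) a by (simp add: satisfies_def)
  ultimately have "1 \<odot> eval A a (superization p f) = \<zero>"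
    by (metis envelope_zero tensor_def)
  moreover have "eval A a (superization p f) \<in> carrier A"
    by (rule eval_closed) (use a grade_carrier in blast)
  ultimately show "eval A a (superization p f) = \<zero>" by simp
qed

end

section \<open>Ideals of metabelian Malcev identities\<close>

definition multilinear_on :: "nat set \<Rightarrow> (nat, 'f::field_char_0) npoly \<Rightarrow> bool" where
  "multilinear_on X f \<longleftrightarrow> (\<forall>w\<in>supp f. distinct (letters w) \<and> set (letters w) = X)"

lemma multilinear_iff: "multilinear f \<longleftrightarrow> (\<exists>X. multilinear_on X f)"
  by (auto simp: multilinear_def multilinear_on_def)

lemma multilinear_on_add:
  "multilinear_on X f \<Longrightarrow> multilinear_on X g \<Longrightarrow> multilinear_on X (f + g)"
  using keys_add[of f g] unfolding multilinear_on_def by blast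

lemma multilinear_on_diff:
  "multilinear_on X f \<Longrightarrow> multilinear_on X g \<Longrightarrow> multilinear_on X (f - g)"
  using keys_diff[of f g] unfolding multilinear_on_def by blast

lemma multilinear_on_single:
  "distinct (letters w) \<Longrightarrow> set (letters w) = X \<Longrightarrow> multilinear_on X (monomial w c)"
  by (simp add: multilinear_on_def)

text \<open>The polarization in \<open>x\<close> of \<open>((xy)z)x + ((yz)x)x + ((zx)x)y\<close>. Modulo anticommutativity and the
  metabelian law, that cubic form is the Malcev identity.\<close>

definition malcev_linear ::
  "('x, 'f::field_char_0) npoly \<Rightarrow> ('x, 'f) npoly \<Rightarrow> ('x, 'f) npoly \<Rightarrow> ('x, 'f) npoly \<Rightarrow> ('x, 'f) npoly" where
  "malcev_linear x y z t = x \<star> y \<star> z \<star> t + t \<star> y \<star> z \<star> x + y \<star> z \<star> x \<star> t + y \<star> z \<star> t \<star> x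
     + z \<star> x \<star> t \<star> y + z \<star> t \<star> x \<star> y"

fun extend_word :: "'x nword \<Rightarrow> 'x list \<Rightarrow> 'x nword" where
  "extend_word w [] = w"
| "extend_word w (c # cs) = extend_word (Prod w (Gen c)) cs"

definition left_word :: "'x list \<Rightarrow> 'x nword" where
  "left_word xs = extend_word (Gen (hd xs)) (tl xs)"

fun extend :: "('x, 'f::field_char_0) npoly \<Rightarrow> 'x list \<Rightarrow> ('x, 'f) npoly" where
  "extend f [] = f"
| "extend f (c # cs) = extend (f \<star> nvar c) cs"

lemma extend_word_append: "extend_word w (xs @ ys) = extend_word (extend_word w xs) ys"
  by (induction xs arbitrary: w) auto

lemma letters_extend_word [simp]: "letters (extend_word w xs) = letters w @ xs"
  by (induction xs arbitrary: w) auto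

lemma letters_left_word [simp]: "xs \<noteq> [] \<Longrightarrow> letters (left_word xs) = xs"
  by (simp add: left_word_def)

lemma left_word_append: "xs \<noteq> [] \<Longrightarrow> left_word (xs @ ys) = extend_word (left_word xs) ys"
  by (cases xs) (auto simp: left_word_def extend_word_append)

lemma left_word_snoc: "xs \<noteq> [] \<Longrightarrow> left_word (xs @ [c]) = Prod (left_word xs) (Gen c)"
  by (simp add: left_word_append)

lemma extend_single [simp]:
  "extend (monomial w c) cs = monomial (extend_word w cs) c"
  by (induction cs arbitrary: w) (auto simp: nvar_def)

lemma extend_add: "extend (f + g) cs = extend f cs + extend g cs"
  by (induction cs arbitrary: f g) (auto simp: nmult_distribs)

lemma extend_diff: "extend (f - g) cs = extend f cs - extend g cs"
  by (induction cs arbitrary: f g) (auto simp: nmult_distribs)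

text \<open>Modulo anticommutativity and the metabelian law every word is, up to a sign, the left-normed word
  on a rearrangement of its letters, or zero. In the last equation the zero is recorded by the sign;
  the list keeps the letters, so that straightening preserves multilinearity.\<close>

fun straighten :: "'x nword \<Rightarrow> 'x list" where
  "straighten (Gen x) = [x]"
| "straighten (Prod u (Gen c)) = straighten u @ [c]"
| "straighten (Prod (Gen c) (Prod u v)) = straighten (Prod u v) @ [c]"
| "straighten (Prod (Prod u v) (Prod u' v')) = letters (Prod (Prod u v) (Prod u' v'))"

fun straighten_sign :: "'x nword \<Rightarrow> 'f::field_char_0" where
  "straighten_sign (Gen x) = 1"
| "straighten_sign (Prod u (Gen c)) = straighten_sign u"
| "straighten_sign (Prod (Gen c) (Prod u v)) = - straighten_sign (Prod u v)"
| "straighten_sign (Prod (Prod u v) (Prod u' v')) = 0"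

lemma letters_nonempty [simp]: "letters w \<noteq> []"
  by (induction w) auto

lemma straighten_counts:
  "count_list (straighten w) x = count_list (letters w) x"
  by (induction w rule: straighten.induct) auto

lemma distinct_iff_count_list: "distinct xs \<longleftrightarrow> (\<forall>x. count_list xs x \<le> 1)"
proof (induction xs)
  case (Cons y ys)
  have "count_list (y # ys) x \<le> 1 \<longleftrightarrow> count_list ys x \<le> 1 \<and> (x = y \<longrightarrow> y \<notin> set ys)" for x
    using count_list_0_iff[of ys y] by auto
  then show ?case using Cons.IH by auto
qed simp

lemma straighten_letters:
  "distinct (straighten w) \<longleftrightarrow> distinct (letters w)" "set (straighten w) = set (letters w)"
  "straighten w \<noteq> []"
proof -
  have iff: "x \<in> set (straighten w) \<longleftrightarrow> x \<in> set (letters w)" for x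
    using straighten_counts[of w x] count_list_0_iff[of "straighten w" x] count_list_0_iff[of "letters w" x]
    by simp
  show "distinct (straighten w) \<longleftrightarrow> distinct (letters w)"
    by (simp add: distinct_iff_count_list straighten_counts)
  show s: "set (straighten w) = set (letters w)" using iff by blast
  have "set (letters w) \<noteq> {}" by simp
  then show "straighten w \<noteq> []" using s by force
qed

text \<open>For example, the polynomials that vanish at a fixed point of an anticommutative metabelian
  algebra.\<close>

locale metabelian_ideal =
  fixes N :: "('x, 'f::field_char_0) npoly set"
  assumes zero_mem: "0 \<in> N"
    and add_mem: "f \<in> N \<Longrightarrow> g \<in> N \<Longrightarrow> f + g \<in> N"
    and nscale_mem: "f \<in> N \<Longrightarrow> nscale c f \<in> N"
    and nmult_left_mem: "f \<in> N \<Longrightarrow> f \<star> g \<in> N"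
    and anticommutative: "f \<star> g + g \<star> f \<in> N"
    and metabelian: "(f \<star> g) \<star> (h \<star> k) \<in> N"
begin

lemma uminus_mem: "f \<in> N \<Longrightarrow> - f \<in> N"
proof -
  have "nscale (- 1) f = - f" by (rule poly_mapping_eqI) simp
  then show "f \<in> N \<Longrightarrow> - f \<in> N" using nscale_mem[of f "- 1"] by simp
qed

lemma diff_mem: "f \<in> N \<Longrightarrow> g \<in> N \<Longrightarrow> f - g \<in> N"
  using add_mem[of f "- g"] uminus_mem[of g] by simp

lemma sum_mem: "(\<And>i. i \<in> I \<Longrightarrow> h i \<in> N) \<Longrightarrow> sum h I \<in> N"
  by (induction I rule: infinite_finite_induct) (auto intro: zero_mem add_mem)

lemma extend_mem: "f \<in> N \<Longrightarrow> extend f cs \<in> N"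
  by (induction cs arbitrary: f) (auto intro: nmult_left_mem)

text \<open>The correction \<open>?D\<close> collects what it costs to bring all words of the Malcev identity into
  left-normed form; the product \<open>(xy)(xz)\<close> in it vanishes by the metabelian law.\<close>

lemma malcev_iff_cubic:
  "jacobian x y z \<star> x - jacobian x y (x \<star> z) \<in> N \<longleftrightarrow>
   x \<star> y \<star> z \<star> x + y \<star> z \<star> x \<star> x + z \<star> x \<star> x \<star> y \<in> N"
proof -
  let ?M = "jacobian x y z \<star> x - jacobian x y (x \<star> z)"
  let ?T = "x \<star> y \<star> z \<star> x + y \<star> z \<star> x \<star> x + z \<star> x \<star> x \<star> y"
  let ?a = "z \<star> x + x \<star> z" and ?b = "y \<star> (x \<star> z) + (x \<star> z) \<star> y"
  let ?D = "?a \<star> x \<star> y + (x \<star> y) \<star> (x \<star> z) + ?b \<star> x - ?a \<star> y \<star> x"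
  have "?D \<in> N"
    by (intro add_mem diff_mem nmult_left_mem anticommutative metabelian)
  moreover have "?T = ?M + ?D"
    by (simp add: jacobian_def nmult_distribs)
  moreover have "?M = ?T - ?D"
    by (simp add: jacobian_def nmult_distribs)
  ultimately show ?thesis by (metis add_mem diff_mem)
qed

lemma straighten_mem:
  "monomial w 1 - monomial (left_word (straighten w)) (straighten_sign w) \<in> N"
proof (induction w rule: straighten.induct)
  case (1 x)
  then show ?case by (simp add: left_word_def zero_mem)
next
  case (2 u c)
  have "monomial (Prod u (Gen c)) 1 -
      monomial (left_word (straighten (Prod u (Gen c)))) (straighten_sign (Prod u (Gen c)))
    = (monomial u 1 - monomial (left_word (straighten u)) (straighten_sign u))
      \<star> monomial (Gen c) 1"
    using straighten_letters(3)[of u] by (simp add: nmult_distribs left_word_snoc)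
  then show ?case using nmult_left_mem 2 by metis
next
  case (3 c u v)
  let ?u = "Prod u v" and ?c = "monomial (Gen c) 1"
  let ?l = "monomial (left_word (straighten ?u)) (straighten_sign ?u)"
  have "monomial (Prod (Gen c) ?u) 1 -
      monomial (left_word (straighten (Prod (Gen c) ?u))) (straighten_sign (Prod (Gen c) ?u))
    = (?c \<star> monomial ?u 1 + monomial ?u 1 \<star> ?c) - (monomial ?u 1 - ?l) \<star> ?c"
    using straighten_letters(3)[of ?u] by (simp add: nmult_distribs left_word_snoc single_uminus)
  moreover have "\<dots> \<in> N"
    by (intro diff_mem nmult_left_mem anticommutative 3)
  ultimately show ?case by metis
next
  case (4 u v u' v')
  show ?case
    using metabelian[of "monomial u 1" "monomial v 1"
        "monomial u' 1" "monomial v' 1"] by simp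
qed

end

locale malcev_ideal = metabelian_ideal +
  assumes malcev_linear_mem: "malcev_linear x y z t \<in> N"
begin

text \<open>Take for one argument of the linearized Malcev identity a product \<open>w\<close>. The four terms in which \<open>w\<close>
  is multiplied by a product vanish, and the two remaining ones form the claim: on the square of the
  algebra, three right multiplications may be permuted cyclically.\<close>

lemma cyclic_mem: "(f \<star> g) \<star> x \<star> y \<star> z - (f \<star> g) \<star> y \<star> z \<star> x \<in> N"
proof -
  let ?w = "f \<star> g"
  let ?a = "y \<star> ?w + ?w \<star> y"
  have *: "u \<star> v \<star> ?w \<in> N" for u v by (rule metabelian)
  have "?w \<star> x \<star> y \<star> z - ?w \<star> y \<star> z \<star> x
    = malcev_linear z x y ?w - z \<star> x \<star> y \<star> ?w - x \<star> y \<star> z \<star> ?w - x \<star> y \<star> ?w \<star> z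
      - y \<star> z \<star> ?w \<star> x - ?a \<star> z \<star> x"
    by (simp add: malcev_linear_def nmult_distribs)
  also have "\<dots> \<in> N"
    by (intro diff_mem malcev_linear_mem nmult_left_mem anticommutative *)
  finally show ?thesis .
qed

end

lemma (in metabelian_ideal) malcev_ideal_iff_cubic:
  "malcev_ideal N \<longleftrightarrow> (\<forall>x y z. x \<star> y \<star> z \<star> x + y \<star> z \<star> x \<star> x + z \<star> x \<star> x \<star> y \<in> N)"
  (is "_ \<longleftrightarrow> (\<forall>x y z. ?T x y z \<in> N)")
proof
  assume "malcev_ideal N"
  then interpret malcev_ideal N .
  show "\<forall>x y z. ?T x y z \<in> N"
  proof (intro allI)
    fix x y z
    have "?T x y z = nscale (1 / 2) (malcev_linear x y z x)"
      by (rule poly_mapping_eqI) (simp add: malcev_linear_def lookup_add)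
    then show "?T x y z \<in> N" using nscale_mem[OF malcev_linear_mem] by simp
  qed
next
  assume T: "\<forall>x y z. ?T x y z \<in> N"
  show "malcev_ideal N"
  proof
    fix x y z t
    have "malcev_linear x y z t = ?T (x + t) y z - ?T x y z - ?T t y z"
      by (simp add: malcev_linear_def nmult_distribs)
    also have "\<dots> \<in> N" using T by (intro diff_mem) auto
    finally show "malcev_linear x y z t \<in> N" .
  qed
qed

definition normal_form :: "('x, 'f::field_char_0) npoly \<Rightarrow> ('x, 'f) npoly" where
  "normal_form f = (\<Sum>w\<in>supp f. monomial
     (left_word (straighten w)) (straighten_sign w * coeff f w))"

lemma (in metabelian_ideal) normal_form_mem: "f - normal_form f \<in> N"
proof -
  let ?c = "coeff f"
  have "f - normal_form f = (\<Sum>w\<in>supp f. monomial w (?c w))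
     - (\<Sum>w\<in>supp f. monomial (left_word (straighten w)) (straighten_sign w * ?c w))"
    by (rule arg_cong2[where f = minus, OF npoly_sum_single normal_form_def])
  also have "\<dots> = (\<Sum>w\<in>supp f. nscale (?c w)
     (monomial w 1 - monomial (left_word (straighten w)) (straighten_sign w)))"
    unfolding sum_subtractf[symmetric]
    by (rule sum.cong[OF refl], rule poly_mapping_eqI)
      (simp add: lookup_minus lookup_single when_def algebra_simps)
  also have "\<dots> \<in> N"
    by (intro sum_mem nscale_mem straighten_mem)
  finally show ?thesis .
qed

lemma keys_normal_form:
  assumes "w \<in> supp (normal_form f)"
  obtains w' where "w' \<in> supp f" "w = left_word (straighten w')"
proof -
  have "w \<in> (\<Union>w'\<in>supp f. supp (monomial
     (left_word (straighten w')) (straighten_sign w' * coeff f w')))"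
    by (rule subsetD[OF keys_sum assms[unfolded normal_form_def]])
  then show thesis using that by (auto split: if_splits)
qed

lemma multilinear_on_normal_form:
  assumes "multilinear_on X f"
  shows "multilinear_on X (normal_form f)"
  unfolding multilinear_on_def
proof
  fix w assume "w \<in> supp (normal_form f)"
  then obtain w' where "w' \<in> supp f" "w = left_word (straighten w')"
    by (rule keys_normal_form)
  then show "distinct (letters w) \<and> set (letters w) = X"
    using assms by (simp add: straighten_letters multilinear_on_def)
qed

section \<open>Metabelian Malcev superalgebras\<close>

abbreviation "anticommutative_poly \<equiv> nvar 0 \<star> nvar 1 + nvar 1 \<star> nvar 0"
abbreviation "metabelian_poly \<equiv> (nvar 0 \<star> nvar 1) \<star> (nvar 2 \<star> nvar 3)"
abbreviation "malcev_poly \<equiv> malcev_linear (nvar 0) (nvar 1) (nvar 2) (nvar 3)"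

lemma multilinear_polys:
  "multilinear (anticommutative_poly :: (nat, 'f::field_char_0) npoly)"
  "multilinear (metabelian_poly :: (nat, 'f::field_char_0) npoly)"
  "multilinear (malcev_poly :: (nat, 'f::field_char_0) npoly)"
  unfolding multilinear_iff malcev_linear_def nvar_def
  by (rule exI[of _ "{0,1}"] exI[of _ "{0,1,2,3}"],
      auto intro!: multilinear_on_add multilinear_on_single)+

context nonassoc_algebra
begin

abbreviation "kernel_at u \<equiv> {f. eval A u f = \<zero>}"

lemma kernel_metabelian_ideal:
  fixes u :: "nat \<Rightarrow> 'a"
  assumes u: "\<And>i. u i \<in> carrier A"
    and "satisfies A anticommutative_poly" "satisfies A metabelian_poly"
  shows "metabelian_ideal (kernel_at u)"
proof
  note [simp] = eval_add eval_diff eval_nscale eval_nmult eval_nvar u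
  fix f g h k :: "(nat, 'f) npoly"
  let ?b = "\<lambda>i::nat. if i = 0 then eval A u f else if i = 1 then eval A u g
    else if i = 2 then eval A u h else eval A u k"
  have "eval A ?b anticommutative_poly = \<zero>"
    by (rule assms(2)[unfolded satisfies_def, rule_format]) simp
  moreover have "eval A ?b metabelian_poly = \<zero>"
    by (rule assms(3)[unfolded satisfies_def, rule_format]) simp
  ultimately show "f \<star> g + g \<star> f \<in> kernel_at u" "(f \<star> g) \<star> (h \<star> k) \<in> kernel_at u"
    by auto
qed (auto simp: eval_add eval_nscale eval_nmult u)

lemma kernel_malcev_ideal:
  fixes u :: "nat \<Rightarrow> 'a"
  assumes u: "\<And>i. u i \<in> carrier A"
    and "satisfies A anticommutative_poly" "satisfies A metabelian_poly" "satisfies A malcev_poly"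
  shows "malcev_ideal (kernel_at u)"
proof -
  interpret metabelian_ideal "kernel_at u" by (rule kernel_metabelian_ideal[OF u assms(2,3)])
  show ?thesis
  proof
    note [simp] = eval_add eval_diff eval_nscale eval_nmult eval_nvar u
    fix f g h k :: "(nat, 'f) npoly"
    let ?b = "\<lambda>i::nat. if i = 0 then eval A u f else if i = 1 then eval A u g
      else if i = 2 then eval A u h else eval A u k"
    have "eval A ?b malcev_poly = \<zero>"
      by (rule assms(4)[unfolded satisfies_def, rule_format]) simp
    then show "malcev_linear f g h k \<in> kernel_at u"
      by (auto simp: malcev_linear_def)
  qed
qed

lemma in_variety_malcev_metabelian_iff:
  "in_variety A malcev_metabelian \<longleftrightarrow>
    satisfies A anticommutative_poly \<and> satisfies A metabelian_poly \<and> satisfies A malcev_poly"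
proof -
  let ?J = "\<lambda>x y z. jacobian x y z \<star> x - jacobian x y (x \<star> z) :: (nat, 'f) npoly"
  have "satisfies A (?J (nvar 0) (nvar 1) (nvar 2)) \<longleftrightarrow> satisfies A malcev_poly"
    if am: "satisfies A anticommutative_poly" "satisfies A metabelian_poly"
  proof
    assume J: "satisfies A (?J (nvar 0) (nvar 1) (nvar 2))"
    show "satisfies A malcev_poly"
      unfolding satisfies_def
    proof (intro allI impI)
      fix u :: "nat \<Rightarrow> 'a" assume u: "\<forall>i. u i \<in> carrier A"
      then interpret metabelian_ideal "kernel_at u" by (intro kernel_metabelian_ideal am) auto
      have "?J f g h \<in> kernel_at u" for f g h
      proof -
        note [simp] = eval_add eval_diff eval_nscale eval_nmult eval_nvar u[rule_format]
        let ?b = "\<lambda>i::nat. if i = 0 then eval A u f else if i = 1 then eval A u g else eval A u h"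
        have "eval A ?b (?J (nvar 0) (nvar 1) (nvar 2)) = \<zero>"
          by (rule J[unfolded satisfies_def, rule_format]) simp
        then show ?thesis by (auto simp: jacobian_def)
      qed
      then have "malcev_ideal (kernel_at u)"
        unfolding malcev_ideal_iff_cubic malcev_iff_cubic[symmetric] by blast
      then show "eval A u malcev_poly = \<zero>"
        using malcev_ideal.malcev_linear_mem by blast
    qed
  next
    assume M: "satisfies A malcev_poly"
    show "satisfies A (?J (nvar 0) (nvar 1) (nvar 2))"
      unfolding satisfies_def
    proof (intro allI impI)
      fix u :: "nat \<Rightarrow> 'a" assume u: "\<forall>i. u i \<in> carrier A"
      then interpret malcev_ideal "kernel_at u" by (intro kernel_malcev_ideal am M) auto
      have "?J (nvar 0) (nvar 1) (nvar 2) \<in> kernel_at u"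
        using malcev_ideal_iff_cubic malcev_ideal_axioms malcev_iff_cubic by blast
      then show "eval A u (?J (nvar 0) (nvar 1) (nvar 2)) = \<zero>" by simp
    qed
  qed
  then show ?thesis
    unfolding in_variety_def malcev_metabelian_def Let_def
    using nonassoc_algebra_axioms by auto
qed

end

text \<open>The Malcev identity is not multilinear; its polarization is, and so it can be tested in \<open>A\<close>
  instead of the envelope.\<close>

lemma variety_superalgebra_malcev_metabelian_iff:
  "variety_superalgebra malcev_metabelian A \<longleftrightarrow> superalgebra A \<and>
     satisfies_super A anticommutative_poly \<and> satisfies_super A metabelian_poly \<and>
     satisfies_super A malcev_poly"
proof (cases "superalgebra A")
  case True
  then interpret superalgebra A .
  have *: "satisfies (grassmann_envelope A) f \<longleftrightarrow> satisfies_super A f" if "multilinear f" for f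
    using that envelope_satisfies_imp_satisfies_super satisfies_super_imp_envelope_satisfies by blast
  then show ?thesis
    unfolding variety_superalgebra_def envelope.in_variety_malcev_metabelian_iff
    using *[OF multilinear_polys(1)] *[OF multilinear_polys(2)] *[OF multilinear_polys(3)] True
    by blast
qed (simp add: variety_superalgebra_def)

section \<open>The multilinear components of the free metabelian Malcev algebra\<close>

text \<open>Membership in \<open>N\<close> is decided by the linear functionals that vanish on \<open>N\<close>. Applied to words, they
  turn the relations modulo \<open>N\<close> into equations in the field.\<close>

lemma (in metabelian_ideal) separating_functional:
  assumes "f \<notin> N"
  obtains \<theta> :: "('x, 'f) npoly \<Rightarrow> 'f" where
    "\<And>g h. \<theta> (g + h) = \<theta> g + \<theta> h" "\<And>c g. \<theta> (nscale c g) = c * \<theta> g"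
    "\<And>g. g \<in> N \<Longrightarrow> \<theta> g = 0" "\<theta> f \<noteq> 0"
proof -
  interpret V: vector_space "nscale :: 'f \<Rightarrow> ('x, 'f) npoly \<Rightarrow> _" by (rule vector_space_nscale)
  interpret F: vector_space "(*) :: 'f \<Rightarrow> 'f \<Rightarrow> 'f"
    by unfold_locales (auto simp: algebra_simps)
  interpret vector_space_pair "nscale :: 'f \<Rightarrow> ('x, 'f) npoly \<Rightarrow> _" "(*) :: 'f \<Rightarrow> 'f \<Rightarrow> 'f"
    by unfold_locales
  obtain B where B: "B \<subseteq> N" "V.independent B" "N \<subseteq> V.span B"
    using V.maximal_independent_subset by blast
  have "V.subspace N"
    by (auto simp: V.subspace_def zero_mem add_mem nscale_mem)
  then have "V.span B \<subseteq> N" using B(1) by (rule V.span_minimal[rotated])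
  then have "f \<notin> V.span B" using assms by auto
  then have "V.independent (insert f B)" using B(2) by (simp add: V.independent_insertI)
  then obtain \<theta> where l: "Vector_Spaces.linear nscale (*) \<theta>"
    and lB: "\<And>x. x \<in> insert f B \<Longrightarrow> \<theta> x = (if x = f then 1 else 0)"
    using linear_independent_extend[of "insert f B" "\<lambda>x. if x = f then 1 else 0"] by blast
  interpret l: Vector_Spaces.linear nscale "(*)" \<theta> by (rule l)
  have "f \<notin> B" using assms B(1) by auto
  then have "\<theta> x = 0" if "x \<in> B" for x using lB[of x] that by auto
  then have "\<theta> g = 0" if "g \<in> N" for g
    using linear_eq_0_on_span[OF l, of B g] that B(3) by auto
  then show thesis
    using that[of \<theta>] l.add l.scale lB[of f] by auto
qed

text \<open>A function on the edges of a complete graph. If \<open>q\<close> comes from \<open>E\<close>, then \<open>2 E u\<close> equals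
  \<open>q u v + q u w - q v w\<close> on any triangle; this determines \<open>E\<close> from one triangle, and the four-point
  condition carries the equation \<open>q a b = E a + E b\<close> from its edges to all others.\<close>

lemma edge_function_is_vertex_sum:
  fixes q :: "'a \<Rightarrow> 'a \<Rightarrow> 'f::field_char_0"
  assumes "3 \<le> card X"
    and sym: "\<And>a b. a \<in> X \<Longrightarrow> b \<in> X \<Longrightarrow> a \<noteq> b \<Longrightarrow> q a b = q b a"
    and four: "\<And>x y z t. {x, y, z, t} \<subseteq> X \<Longrightarrow> distinct [x, y, z, t] \<Longrightarrow> q x y + q z t = q x z + q y t"
  obtains E where "\<And>a b. a \<in> X \<Longrightarrow> b \<in> X \<Longrightarrow> a \<noteq> b \<Longrightarrow> q a b = E a + E b"
proof -
  obtain Y where "Y \<subseteq> X" "card Y = 3" using assms(1) by (meson obtain_subset_with_card_n)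
  then obtain u v w where X: "u \<in> X" "v \<in> X" "w \<in> X" and d: "u \<noteq> v" "u \<noteq> w" "v \<noteq> w"
    by (auto simp: card_3_iff)
  define e where "e = (q u v + q u w - q v w) / 2"
  have e2: "e + e = q u v + q u w - q v w" by (simp add: e_def)
  define E where "E a = (if a = u then e else q a u - e)" for a
  have main: "q a b = q a u + q b u - (e + e)"
    if "a \<in> X" "b \<in> X" "a \<noteq> b" "a \<noteq> u" "b \<noteq> u" for a b
  proof -
    have *: "q a b = q a u + q b u - (e + e)" if "a \<in> X" "b \<in> X" "a \<noteq> b" "a \<noteq> u" "b \<noteq> u" "b \<noteq> v" "b \<noteq> w" for a b
    proof (cases "a = v \<or> a = w")
      case True
      then show ?thesis
      proof
        assume "a = v"
        then have "q v b + q w u = q v w + q b u"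
          using four[of v b w u] that X d by auto
        then show ?thesis unfolding e2 using \<open>a = v\<close> sym[of w u] sym[of v u] X d
          by (simp add: algebra_simps)
      next
        assume "a = w"
        then have "q w b + q v u = q w v + q b u"
          using four[of w b v u] that X d by auto
        then show ?thesis unfolding e2 using \<open>a = w\<close> sym[of w u] sym[of v u] sym[of w v] X d
          by (simp add: algebra_simps)
      qed
    next
      case False
      have 1: "q a b + q u w = q a u + q b w"
        using four[of a b u w] that X d False by auto
      have 2: "q b w + q u v = q b u + q w v"
        using four[of b w u v] that X d False by auto
      have "q a b = q a u + q b w - q u w" using 1 by (simp add: algebra_simps)
      also have "q b w = q b u + q w v - q u v" using 2 by (simp add: algebra_simps)
      finally show ?thesis unfolding e2 using sym[of w v] X d by (simp add: algebra_simps)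
    qed
    show ?thesis
    proof (cases "b = v \<or> b = w")
      case False
      then show ?thesis using * that by auto
    next
      case bvw: True
      show ?thesis
      proof (cases "a = v \<or> a = w")
        case False
        then show ?thesis using *[of b a] that sym[of a b] by (auto simp: add.commute)
      next
        case True
        then show ?thesis unfolding e2 using bvw that sym[of w v] sym[of v u] sym[of w u] X d by auto
      qed
    qed
  qed
  have "q a b = E a + E b" if "a \<in> X" "b \<in> X" "a \<noteq> b" for a b
    using main[OF that] sym[OF that] that unfolding E_def by (auto simp: algebra_simps)
  then show thesis by (rule that)
qed

text \<open>Think of \<open>\<Phi> l\<close> as the value at the left-normed word on \<open>l\<close> of a linear functional that vanishes on
  an ideal as above.\<close>

locale malcev_word_function =
  fixes \<Phi> :: "nat list \<Rightarrow> 'f::field_char_0"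
  assumes swap_head: "\<Phi> (b # a # cs) = - \<Phi> (a # b # cs)"
    and cyclic: "\<Phi> (a # b # us @ x # y # z # vs) = \<Phi> (a # b # us @ y # z # x # vs)"
    and six_term: "\<Phi> (x # y # z # t # vs) + \<Phi> (t # y # z # x # vs) + \<Phi> (y # z # x # t # vs)
      + \<Phi> (y # z # t # x # vs) + \<Phi> (z # x # t # y # vs) + \<Phi> (z # t # x # y # vs) = 0"
begin

lemma tail_swap: "\<Phi> (a # b # us @ y # x # vs) = \<Phi> (a # b # swap2 (us @ x # y # vs))"
  by (rule cyclic_imp_swap2[where h = "\<lambda>l. \<Phi> (a # b # l)"]) (rule cyclic)

text \<open>A transposition of neighbours in the tail interchanges the two summands.\<close>

lemma symmetric_tail:
  assumes "\<And>z. count_list cs z = count_list ds z"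
  shows "\<Phi> (a # b # cs) + \<Phi> (a # b # swap2 cs) = \<Phi> (a # b # ds) + \<Phi> (a # b # swap2 ds)"
proof (rule adjacent_swap_invariant_eq[where h = "\<lambda>l. \<Phi> (a # b # l) + \<Phi> (a # b # swap2 l)"])
  fix us x y vs
  show "\<Phi> (a # b # us @ x # y # vs) + \<Phi> (a # b # swap2 (us @ x # y # vs))
      = \<Phi> (a # b # us @ y # x # vs) + \<Phi> (a # b # swap2 (us @ y # x # vs))"
    using tail_swap[of a b us x y vs] tail_swap[of a b us y x vs] by simp
qed (rule assms)

lemma alternating_tail:
  assumes "\<And>z. count_list cs z = count_list ds z"
  shows "(\<Phi> (a # b # cs) - \<Phi> (a # b # swap2 cs)) * permutation_sign (a # b # cs)
    = (\<Phi> (a # b # ds) - \<Phi> (a # b # swap2 ds)) * permutation_sign (a # b # ds)"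
proof (rule adjacent_swap_invariant_eq[where h =
      "\<lambda>l. (\<Phi> (a # b # l) - \<Phi> (a # b # swap2 l)) * permutation_sign (a # b # l)"])
  fix us x y vs
  have "permutation_sign (a # b # us @ y # x # vs) = - (permutation_sign (a # b # us @ x # y # vs) :: 'f)"
    using permutation_sign_swap[of "a # b # us"] by simp
  then show "(\<Phi> (a # b # us @ x # y # vs) - \<Phi> (a # b # swap2 (us @ x # y # vs)))
      * permutation_sign (a # b # us @ x # y # vs)
    = (\<Phi> (a # b # us @ y # x # vs) - \<Phi> (a # b # swap2 (us @ y # x # vs)))
      * permutation_sign (a # b # us @ y # x # vs)"
    using tail_swap[of a b us x y vs] tail_swap[of a b us y x vs] by (simp add: algebra_simps)
qed (rule assms)

text \<open>Let \<open>s a b\<close> be the part of \<open>\<Phi> (a # b # cs)\<close> symmetric in \<open>cs\<close>, and \<open>q a b\<close> the alternating part freed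
  from its sign; by \<open>symmetric_tail\<close> and \<open>alternating_tail\<close> they depend only on \<open>a\<close> and \<open>b\<close>. The
  six-term relation separates into the Jacobi relation for \<open>s\<close>, so that \<open>s\<close> is a coboundary, and the
  four-point condition for \<open>q\<close>.\<close>

lemma sum_of_symmetric_and_alternating:
  assumes X: "finite X" "4 \<le> card X"
  obtains P E where "\<And>a b cs. distinct (a # b # cs) \<Longrightarrow> set (a # b # cs) = X \<Longrightarrow>
    \<Phi> (a # b # cs) = P a - P b + permutation_sign (a # b # cs) * (E a + E b)"
proof -
  let ?r = "\<lambda>a b. sorted_list_of_set (X - {a, b})"
  define s where "s a b = (\<Phi> (a # b # ?r a b) + \<Phi> (a # b # swap2 (?r a b))) / 2" for a b
  define q where "q a b = (\<Phi> (a # b # ?r a b) - \<Phi> (a # b # swap2 (?r a b)))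
      * permutation_sign (a # b # ?r a b) / 2" for a b
  have \<Phi>: "\<Phi> (a # b # cs) = s a b + permutation_sign (a # b # cs) * q a b"
    if d: "distinct (a # b # cs)" and "set (a # b # cs) = X" for a b cs
  proof -
    have "set cs = X - {a, b}" using that by auto
    then have cnt: "count_list cs z = count_list (?r a b) z" for z
      using d X by (simp add: count_list_distinct)
    let ?p = "permutation_sign (a # b # cs) :: 'f"
    have "?p * q a b = (\<Phi> (a # b # cs) - \<Phi> (a # b # swap2 cs)) * (?p * ?p) / 2"
      unfolding q_def alternating_tail[OF cnt, symmetric] by (simp add: mult_ac)
    also have "?p * ?p = 1" using d by (rule permutation_sign_square)
    finally show ?thesis
      unfolding s_def symmetric_tail[OF cnt, symmetric] by (simp add: field_simps)
  qed
  have comm: "X - {b, a} = X - {a, b}" for a b by auto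
  have anti: "s b a = - s a b" for a b
    unfolding s_def comm[of b a] by (simp add: swap_head[of b a] add_divide_distrib)
  have sym: "q b a = q a b" for a b
    unfolding q_def comm[of b a]
    using permutation_sign_swap[of "[]" b a, where 'f = 'f]
    by (simp add: swap_head[of b a] algebra_simps)
  have rel: "s x y + s t y + 2 * s y z + s z x + s z t
      + permutation_sign (x # y # z # t # sorted_list_of_set (X - {x, y, z, t}))
        * (q x y - q t y - q z x + q z t) = 0"
    if "{x, y, z, t} \<subseteq> X" "distinct [x, y, z, t]" for x y z t
  proof -
    let ?v = "sorted_list_of_set (X - {x, y, z, t})"
    let ?p = "permutation_sign :: nat list \<Rightarrow> 'f"
    have v: "set ?v = X - {x, y, z, t}" "distinct ?v" using X by auto
    have w: "\<Phi> (a # b # c # d # ?v) = s a b + ?p (a # b # c # d # ?v) * q a b"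
      if "{a, b, c, d} = {x, y, z, t}" "distinct [a, b, c, d]" for a b c d
    proof (rule \<Phi>)
      have "set [a, b, c, d] = {x, y, z, t}" using that(1) by simp
      then have "distinct ([a, b, c, d] @ ?v)" "set ([a, b, c, d] @ ?v) = X"
        using that(2) v \<open>{x, y, z, t} \<subseteq> X\<close> unfolding distinct_append set_append by blast+
      then show "distinct (a # b # c # d # ?v)" "set (a # b # c # d # ?v) = X" by simp_all
    qed
    have p0: "?p (b # a # l) = - ?p (a # b # l)" for a b l
      using permutation_sign_swap[of "[]" b a l] by simp
    have p1: "?p (c # b # a # l) = - ?p (c # a # b # l)" for a b c l
      using permutation_sign_swap[of "[c]" b a l] by simp
    have p2: "?p (c # d # b # a # l) = - ?p (c # d # a # b # l)" for a b c d l
      using permutation_sign_swap[of "[c, d]" b a l] by simp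
    have P: "?p (y # z # x # t # ?v) = ?p (x # y # z # t # ?v)"
      using p1[of y z x] p0[of y x] by simp
    have P1: "?p (y # z # t # x # ?v) = - ?p (x # y # z # t # ?v)"
      using P p2[of y z t x] by simp
    have P2: "?p (t # y # z # x # ?v) = - ?p (x # y # z # t # ?v)"
      using P1 p1[of y t z] p0[of t y] by simp
    have P3: "?p (z # x # t # y # ?v) = - ?p (x # y # z # t # ?v)"
      using p1[of x z y "t # ?v"] p0[of z x "y # t # ?v"] p2[of z x t y ?v] by simp
    have P4: "?p (z # t # x # y # ?v) = ?p (x # y # z # t # ?v)"
      using P3 p1[of z t x] by simp
    have sets: "{t, y, z, x} = {x, y, z, t}" "{y, z, x, t} = {x, y, z, t}" "{y, z, t, x} = {x, y, z, t}"
       "{z, x, t, y} = {x, y, z, t}" "{z, t, x, y} = {x, y, z, t}" by auto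
    have "\<Phi> (x # y # z # t # ?v) + \<Phi> (t # y # z # x # ?v) + \<Phi> (y # z # x # t # ?v)
      + \<Phi> (y # z # t # x # ?v) + \<Phi> (z # x # t # y # ?v) + \<Phi> (z # t # x # y # ?v)
      = s x y + s t y + 2 * s y z + s z x + s z t + ?p (x # y # z # t # ?v)
        * (q x y - q t y - q z x + q z t)"
      using that(2) by (simp add: w sets P P1 P2 P3 P4 algebra_simps)
    then show ?thesis using six_term[of x y z t ?v] by simp
  qed
  have four: "q x y + q z t = q x z + q y t" if "{x, y, z, t} \<subseteq> X" "distinct [x, y, z, t]" for x y z t
  proof -
    let ?p = "permutation_sign (x # y # z # t # sorted_list_of_set (X - {x, y, z, t})) :: 'f"
    have set: "X - {x, z, y, t} = X - {x, y, z, t}" by auto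
    have "permutation_sign (x # z # y # t # sorted_list_of_set (X - {x, z, y, t})) = - ?p"
      unfolding set using permutation_sign_swap[of "[x]" z y] by simp
    let ?S = "s x y + s t y + 2 * s y z + s z x + s z t" and ?A = "q x y - q t y - q z x + q z t"
    let ?S' = "s x z + s t z + 2 * s z y + s y x + s y t" and ?B = "q x z - q t z - q y x + q y t"
    \<comment> \<open>Interchanging \<open>y\<close> and \<open>z\<close> negates both \<open>?S\<close> and the sign, and turns \<open>?A\<close> into \<open>?B = - ?A\<close>; so
      \<open>?S\<close> and \<open>?A\<close> vanish separately.\<close>
    have 1: "?S' + (- ?p) * ?B = 0"
      using rel[of x z y t] that \<open>permutation_sign _ = - ?p\<close> by auto
    have 2: "?S + ?p * ?A = 0" using rel[OF that] .
    have 3: "?S + ?S' = 0"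
      using anti[of z x] anti[of z t] anti[of z y] anti[of y x] anti[of y t] by (simp add: algebra_simps)
    have "?p * ?A - ?p * ?B = (?S + ?p * ?A) + (?S' + (- ?p) * ?B) - (?S + ?S')" by simp
    also have "\<dots> = 0" unfolding 1 2 3 by simp
    finally have "?p * ?A - ?p * ?B = 0" .
    then have "?p * (2 * (q x y + q z t - (q x z + q y t))) = 0"
      using sym[of x z] sym[of t z] sym[of x y] sym[of t y] by (simp add: algebra_simps)
    moreover have "?p \<noteq> 0" by (rule permutation_sign_nonzero) (use that X in auto)
    ultimately have "2 * (q x y + q z t - (q x z + q y t)) = 0" by (metis mult_eq_0_iff)
    then have "q x y + q z t - (q x z + q y t) = 0" by (simp only: mult_eq_0_iff) simp
    then show ?thesis by simp
  qed
  have jac: "s x y + s y z + s z x = 0" if "{x, y, z} \<subseteq> X" "distinct [x, y, z]" for x y z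
  proof -
    have "card {x, y, z} < card X" using X(2) card_length[of "[x, y, z]"] by simp
    then obtain t where t: "t \<in> X" "t \<notin> {x, y, z}"
      by (metis card_mono finite.emptyI finite_insert not_le subsetI)
    have r: "s a b + s t b + 2 * s b c + s c a + s c t = 0"
      if "{a, b, c} = {x, y, z}" "distinct [a, b, c]" for a b c
    proof -
      have "{a, b, c, t} = insert t {a, b, c}" by blast
      then have sub: "{a, b, c, t} \<subseteq> X" using that(1) \<open>{x, y, z} \<subseteq> X\<close> t(1) by simp
      have "t \<notin> {a, b, c}" using t(2) that(1) by simp
      then have dist: "distinct [a, b, c, t]" using that(2) by auto
      have "q a b - q t b - q c a + q c t = 0"
        using four[OF sub dist] sym[of c a] sym[of t b] by (simp add: algebra_simps)
      then show ?thesis using rel[OF sub dist] by simp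
    qed
    \<comment> \<open>For \<open>J x y z = s x y + s y z + s z x\<close>, replacing one argument by \<open>t\<close> negates \<open>J\<close>. The three
      resulting values add up to \<open>J x y z\<close> by antisymmetry of \<open>s\<close>, whence \<open>4 J x y z = 0\<close>.\<close>
    have "s x y + s t y + 2 * s y z + s z x + s z t = 0" by (rule r) (use that in auto)
    moreover have "s y z + s t z + 2 * s z x + s x y + s x t = 0" by (rule r) (use that in auto)
    moreover have "s z x + s t x + 2 * s x y + s y z + s y t = 0" by (rule r) (use that in auto)
    moreover have "4 * (s x y + s y z + s z x) =
      (s x y + s t y + 2 * s y z + s z x + s z t) + (s y z + s t z + 2 * s z x + s x y + s x t)
      + (s z x + s t x + 2 * s x y + s y z + s y t)"
      using anti[of t z] anti[of t x] anti[of t y] by (simp add: algebra_simps)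
    ultimately have "4 * (s x y + s y z + s z x) = 0" by (simp only: add_0)
    then show ?thesis by (simp only: mult_eq_0_iff) simp
  qed
  obtain v where v: "v \<in> X" using X by fastforce
  define P where "P a = (if a = v then 0 else s a v)" for a
  have P: "s a b = P a - P b" if "a \<in> X" "b \<in> X" "a \<noteq> b" for a b
    using jac[of a b v] anti[of v b] anti[of v a] v that unfolding P_def
    by (auto simp: algebra_simps eq_neg_iff_add_eq_0)
  have "3 \<le> card X" using X by simp
  then obtain E where E: "\<And>a b. a \<in> X \<Longrightarrow> b \<in> X \<Longrightarrow> a \<noteq> b \<Longrightarrow> q a b = E a + E b"
    using edge_function_is_vertex_sum[of X q] sym four by metis
  show thesis
  proof (rule that[of P E])
    fix a b cs assume "distinct (a # b # cs)" "set (a # b # cs) = X"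
    then show "\<Phi> (a # b # cs) = P a - P b + permutation_sign (a # b # cs) * (E a + E b)"
      using \<Phi>[of a b cs] P[of a b] E[of a b] by auto
  qed
qed

text \<open>The tail has at most one letter, so that the alternating part is everything. There are no four
  distinct points, and the four-point condition is vacuous.\<close>

lemma alternating_short:
  assumes X: "finite X" "card X = 2 \<or> card X = 3"
  obtains E where "\<And>a b cs. distinct (a # b # cs) \<Longrightarrow> set (a # b # cs) = X \<Longrightarrow>
    \<Phi> (a # b # cs) = permutation_sign (a # b # cs) * (E a + E b)"
proof -
  let ?r = "\<lambda>a b. sorted_list_of_set (X - {a, b})"
  define q where "q a b = permutation_sign (a # b # ?r a b) * \<Phi> (a # b # ?r a b)" for a b
  have \<Phi>: "\<Phi> (a # b # cs) = permutation_sign (a # b # cs) * q a b"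
    if d: "distinct (a # b # cs)" and s: "set (a # b # cs) = X" for a b cs
  proof -
    have "card (set (a # b # cs)) = length (a # b # cs)" using d by (rule distinct_card)
    then have "length cs \<le> 1" using s X(2) by auto
    moreover have "set (?r a b) = set cs" using that by auto
    ultimately have "?r a b = cs"
      by (cases cs) (use X(1) in \<open>auto simp: sorted_list_of_set_sort_remdups\<close>)
    then show ?thesis
      using permutation_sign_square[OF d, where 'f = 'f] unfolding q_def by (simp flip: mult.assoc)
  qed
  have comm: "X - {b, a} = X - {a, b}" for a b by auto
  have sym: "q b a = q a b" for a b
    unfolding q_def comm[of b a]
    using permutation_sign_swap[of "[]" b a, where 'f = 'f] by (simp add: swap_head[of b a])
  have "\<exists>E. \<forall>a\<in>X. \<forall>b\<in>X. a \<noteq> b \<longrightarrow> q a b = E a + E b"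
  proof (cases "card X = 2")
    case True
    then obtain u v where uv: "X = {u, v}" "u \<noteq> v" by (auto simp: card_2_iff)
    show ?thesis
      by (rule exI[of _ "\<lambda>_. q u v / 2"]) (use uv sym[of u v] in auto)
  next
    case False
    then have three: "card X = 3" using X by auto
    have False if "{x, y, z, t} \<subseteq> X" "distinct [x, y, z, t]" for x y z t
    proof -
      have "card {x, y, z, t} = 4" using that(2) by auto
      then show False using card_mono[OF X(1) that(1)] three by simp
    qed
    then show ?thesis
      using edge_function_is_vertex_sum[of X q] sym three by (metis order_refl)
  qed
  then show thesis using that \<Phi> by fastforce
qed

end

text \<open>The coefficients of \<open>P a\<close> and of \<open>E a\<close> in \<open>\<Phi> l = P b - P c \<plusminus> (E b + E c)\<close>, where \<open>b\<close> and \<open>c\<close> are the first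
  two letters; both are \<open>1\<close> on the word
  with the single letter \<open>a\<close>.\<close>

definition lie_coeff :: "nat \<Rightarrow> nat list \<Rightarrow> 'f::field_char_0" where
  "lie_coeff a l = of_bool (l ! 0 = a) - of_bool (1 < length l \<and> l ! 1 = a)"

definition alt_coeff :: "nat \<Rightarrow> nat list \<Rightarrow> 'f::field_char_0" where
  "alt_coeff a l = permutation_sign l * (of_bool (l ! 0 = a) + of_bool (1 < length l \<and> l ! 1 = a))"

lemma (in malcev_word_function) spanned_by_coeffs:
  assumes X: "finite X"
  obtains P E where "\<And>l. distinct l \<Longrightarrow> set l = X \<Longrightarrow> l \<noteq> [] \<Longrightarrow>
    \<Phi> l = (\<Sum>a\<in>X. P a * lie_coeff a l + E a * alt_coeff a l)"
proof (cases "card X \<le> 1")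
  case True
  show thesis
  proof (rule that[of "\<lambda>_. 0" "\<lambda>a. \<Phi> [a]"])
    fix l :: "nat list" assume l: "distinct l" "set l = X" "l \<noteq> []"
    then have "length l = 1" using True by (metis One_nat_def Suc_leI distinct_card le_antisym length_greater_0_conv)
    then obtain x where x: "l = [x]" by (auto simp: length_Suc_conv)
    then have "X = {x}" using l by auto
    then show "\<Phi> l = (\<Sum>a\<in>X. 0 * lie_coeff a l + \<Phi> [a] * alt_coeff a l)"
      using x by (simp add: alt_coeff_def permutation_sign_def koszul_sign_eq_grassmann)
  qed
next
  case False
  obtain P E where PE: "\<And>a b cs. distinct (a # b # cs) \<Longrightarrow> set (a # b # cs) = X \<Longrightarrow>
    \<Phi> (a # b # cs) = P a - P b + permutation_sign (a # b # cs) * (E a + E b)"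
  proof (cases "4 \<le> card X")
    case True
    then show ?thesis using sum_of_symmetric_and_alternating[OF X True] that by metis
  next
    case F: False
    then have "card X = 2 \<or> card X = 3" using False by linarith
    then obtain E where "\<And>a b cs. distinct (a # b # cs) \<Longrightarrow> set (a # b # cs) = X \<Longrightarrow>
      \<Phi> (a # b # cs) = permutation_sign (a # b # cs) * (E a + E b)"
      using alternating_short[OF X] by blast
    then show ?thesis using that[of "\<lambda>_. 0" E] by simp
  qed
  show thesis
  proof (rule that[of P E])
    fix l :: "nat list" assume l: "distinct l" "set l = X" "l \<noteq> []"
    have "length l = card X" using l distinct_card by fastforce
    then obtain a b cs where abcs: "l = a # b # cs"
      using False by (cases l rule: swap2.cases) auto
    have ab: "a \<in> X" "b \<in> X" using l abcs by auto
    have "(\<Sum>c\<in>X. P c * lie_coeff c l + E c * alt_coeff c l)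
       = (\<Sum>c\<in>X. (if a = c then P c + permutation_sign l * E c else 0)
          + (if b = c then permutation_sign l * E c - P c else 0))"
      by (rule sum.cong) (auto simp: lie_coeff_def alt_coeff_def abcs algebra_simps)
    also have "\<dots> = P a - P b + permutation_sign l * (E a + E b)"
      using ab X by (simp add: sum.distrib algebra_simps)
    finally show "\<Phi> l = (\<Sum>a\<in>X. P a * lie_coeff a l + E a * alt_coeff a l)"
      using PE l unfolding abcs by simp
  qed
qed

text \<open>Every functional that vanishes on \<open>N\<close> is, on words with letters \<open>X\<close>, a combination of the
  coefficients \<open>lie_coeff a\<close> and \<open>alt_coeff a\<close>, so it also vanishes at \<open>f\<close>.\<close>

lemma malcev_ideal_membership:
  fixes N :: "(nat, 'f::field_char_0) npoly set"
  assumes "malcev_ideal N" and f: "multilinear_on X f"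
    and left: "\<And>w. w \<in> supp f \<Longrightarrow> w = left_word (letters w)"
    and lie: "\<And>a. a \<in> X \<Longrightarrow> (\<Sum>w\<in>supp f. coeff f w * lie_coeff a (letters w)) = 0"
    and alt: "\<And>a. a \<in> X \<Longrightarrow> (\<Sum>w\<in>supp f. coeff f w * alt_coeff a (letters w)) = 0"
  shows "f \<in> N"
proof (rule ccontr)
  interpret malcev_ideal N by fact
  assume "f \<notin> N"
  then obtain \<theta> :: "(nat, 'f) npoly \<Rightarrow> 'f" where add: "\<And>g h. \<theta> (g + h) = \<theta> g + \<theta> h"
    and scale: "\<And>c g. \<theta> (nscale c g) = c * \<theta> g"
    and N: "\<And>g. g \<in> N \<Longrightarrow> \<theta> g = 0" and "\<theta> f \<noteq> 0"
    using separating_functional by blast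
  define \<Phi> where "\<Phi> l = \<theta> (monomial (left_word l) 1)" for l
  have zero: "\<theta> 0 = 0" using N zero_mem by blast
  have diff: "\<theta> (g - h) = \<theta> g - \<theta> h" for g h using add[of "g - h" h] by simp
  have lw: "left_word (a # b # cs) = extend_word (Prod (Gen a) (Gen b)) cs" for a b :: nat and cs
    by (simp add: left_word_def)
  interpret malcev_word_function \<Phi>
  proof
    fix a b cs
    have "\<theta> (extend (nvar b \<star> nvar a + nvar a \<star> nvar b) cs) = 0"
      by (intro N extend_mem anticommutative)
    then have "\<Phi> (b # a # cs) + \<Phi> (a # b # cs) = 0"
      by (simp add: extend_add add nvar_def \<Phi>_def lw)
    then show "\<Phi> (b # a # cs) = - \<Phi> (a # b # cs)" by (simp add: eq_neg_iff_add_eq_0)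
  next
    fix a b x y z :: nat and us vs
    obtain u v :: "nat nword" where uv: "extend_word (Prod (Gen a) (Gen b)) us = Prod u v"
      by (cases us rule: rev_cases) (auto simp: extend_word_append)
    let ?s = "\<lambda>w :: nat nword. monomial w (1::'f)"
    have "\<theta> (extend (?s u \<star> ?s v \<star> nvar x \<star> nvar y \<star> nvar z - ?s u \<star> ?s v \<star> nvar y \<star> nvar z \<star> nvar x) vs) = 0"
      by (intro N extend_mem cyclic_mem)
    then show "\<Phi> (a # b # us @ x # y # z # vs) = \<Phi> (a # b # us @ y # z # x # vs)"
      by (simp add: extend_diff diff nvar_def \<Phi>_def lw extend_word_append uv)
  next
    fix x y z t vs
    have "\<theta> (extend (malcev_linear (nvar x) (nvar y) (nvar z) (nvar t)) vs) = 0"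
      by (intro N extend_mem malcev_linear_mem)
    then show "\<Phi> (x # y # z # t # vs) + \<Phi> (t # y # z # x # vs) + \<Phi> (y # z # x # t # vs)
      + \<Phi> (y # z # t # x # vs) + \<Phi> (z # x # t # y # vs) + \<Phi> (z # t # x # y # vs) = 0"
      by (simp add: malcev_linear_def extend_add add nvar_def \<Phi>_def lw)
  qed
  have "f \<noteq> 0" using \<open>\<theta> f \<noteq> 0\<close> zero by auto
  then obtain w0 where "w0 \<in> supp f" by fastforce
  then have "finite X" using f by (auto simp: multilinear_on_def)
  then obtain P E where PE: "\<And>l. distinct l \<Longrightarrow> set l = X \<Longrightarrow> l \<noteq> [] \<Longrightarrow>
    \<Phi> l = (\<Sum>a\<in>X. P a * lie_coeff a l + E a * alt_coeff a l)"
    using spanned_by_coeffs by metis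
  have sum: "\<theta> (\<Sum>w\<in>K. monomial w (g w)) = (\<Sum>w\<in>K. g w * \<theta> (monomial w 1))"
    if "finite K" for K g
    using that
  proof (induction K)
    case (insert w K)
    have "\<theta> (monomial w (g w)) = g w * \<theta> (monomial w 1)"
      using scale[of "g w" "monomial w 1"] by simp
    then show ?case using insert by (simp add: add)
  qed (simp add: zero)
  let ?c = "coeff f"
  have "\<theta> f = (\<Sum>w\<in>supp f. ?c w * \<theta> (monomial w 1))"
    by (subst npoly_sum_single, subst sum) auto
  also have "\<dots> = (\<Sum>w\<in>supp f. \<Sum>a\<in>X.
      P a * (?c w * lie_coeff a (letters w)) + E a * (?c w * alt_coeff a (letters w)))"
  proof (rule sum.cong[OF refl])
    fix w assume w: "w \<in> supp f"
    have "\<theta> (monomial w 1) = \<Phi> (letters w)"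
      unfolding \<Phi>_def using left[OF w] by simp
    also have "\<dots> = (\<Sum>a\<in>X. P a * lie_coeff a (letters w) + E a * alt_coeff a (letters w))"
      by (rule PE) (use f w in \<open>auto simp: multilinear_on_def\<close>)
    finally show "?c w * \<theta> (monomial w 1) = (\<Sum>a\<in>X.
      P a * (?c w * lie_coeff a (letters w)) + E a * (?c w * alt_coeff a (letters w)))"
      by (simp add: sum_distrib_left algebra_simps)
  qed
  also have "\<dots> = (\<Sum>a\<in>X. P a * (\<Sum>w\<in>supp f. ?c w * lie_coeff a (letters w))
      + E a * (\<Sum>w\<in>supp f. ?c w * alt_coeff a (letters w)))"
    by (subst sum.swap) (simp add: sum.distrib sum_distrib_left)
  also have "\<dots> = 0" by (simp add: lie alt)
  finally show False using \<open>\<theta> f \<noteq> 0\<close> by simp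
qed

section \<open>Quotients of superalgebras\<close>

lemma nonassoc_algebra_image:
  assumes A: "nonassoc_algebra A" and car: "carrier Q = \<phi> ` carrier A"
    and add: "\<And>x y. x \<in> carrier A \<Longrightarrow> y \<in> carrier A \<Longrightarrow> \<phi> x \<oplus>\<^bsub>Q\<^esub> \<phi> y = \<phi> (x \<oplus>\<^bsub>A\<^esub> y)"
    and mul: "\<And>x y. x \<in> carrier A \<Longrightarrow> y \<in> carrier A \<Longrightarrow> \<phi> x \<otimes>\<^bsub>Q\<^esub> \<phi> y = \<phi> (x \<otimes>\<^bsub>A\<^esub> y)"
    and scal: "\<And>c x. x \<in> carrier A \<Longrightarrow> c \<odot>\<^bsub>Q\<^esub> \<phi> x = \<phi> (c \<odot>\<^bsub>A\<^esub> x)"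
    and zero: "\<zero>\<^bsub>Q\<^esub> = \<phi> \<zero>\<^bsub>A\<^esub>"
  shows "nonassoc_algebra Q"
proof -
  interpret A: nonassoc_algebra A by fact
  have group: "abelian_group Q"
  proof (rule abelian_groupI)
    fix x assume "x \<in> carrier Q"
    then obtain x' where x: "x' \<in> carrier A" "x = \<phi> x'" using car by auto
    have "\<phi> (\<ominus>\<^bsub>A\<^esub> x') \<oplus>\<^bsub>Q\<^esub> x = \<zero>\<^bsub>Q\<^esub>" using x by (simp add: add zero A.l_neg)
    then show "\<exists>y\<in>carrier Q. y \<oplus>\<^bsub>Q\<^esub> x = \<zero>\<^bsub>Q\<^esub>" using x car by blast
  qed (auto simp: car add zero A.a_ac)
  show ?thesis
  proof (intro nonassoc_algebra.intro moduleI)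
    show "nonassoc_algebra_axioms Q"
      by unfold_locales
        (auto simp: car add mul scal A.prod_closed A.prod_add_left A.prod_add_right
          A.prod_smult_left A.prod_smult_right)
  qed (auto simp: cring_base_field group car add scal A.scalar_add A.scalar_add_right)
qed

lemma superalgebra_image:
  assumes A: "superalgebra A" and Q: "nonassoc_algebra Q" and car: "carrier Q = \<phi> ` carrier A"
    and add: "\<And>x y. x \<in> carrier A \<Longrightarrow> y \<in> carrier A \<Longrightarrow> \<phi> x \<oplus>\<^bsub>Q\<^esub> \<phi> y = \<phi> (x \<oplus>\<^bsub>A\<^esub> y)"
    and mul: "\<And>x y. x \<in> carrier A \<Longrightarrow> y \<in> carrier A \<Longrightarrow> \<phi> x \<otimes>\<^bsub>Q\<^esub> \<phi> y = \<phi> (x \<otimes>\<^bsub>A\<^esub> y)"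
    and scal: "\<And>c x. x \<in> carrier A \<Longrightarrow> c \<odot>\<^bsub>Q\<^esub> \<phi> x = \<phi> (c \<odot>\<^bsub>A\<^esub> x)"
    and zero: "\<zero>\<^bsub>Q\<^esub> = \<phi> \<zero>\<^bsub>A\<^esub>"
    and grade: "\<And>i. grade Q i = \<phi> ` grade A i"
    and inter: "\<And>x y. x \<in> grade A 0 \<Longrightarrow> y \<in> grade A 1 \<Longrightarrow> \<phi> x = \<phi> y \<Longrightarrow> \<phi> x = \<phi> \<zero>\<^bsub>A\<^esub>"
  shows "superalgebra Q"
proof -
  interpret A: superalgebra A by fact
  interpret Q: nonassoc_algebra Q by fact
  note c = A.grade_carrier
  show ?thesis
  proof (rule superalgebra.intro[OF Q], rule superalgebra_axioms.intro)
    show "submodule (grade Q i) base_field Q" for i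
    proof (rule Q.submodule_base_fieldI)
      show "grade Q i \<subseteq> carrier Q" using c by (auto simp: grade car)
    qed (auto simp: grade zero c add scal A.grade_add A.grade_scalar)
    show "grade Q 0 \<inter> grade Q 1 = {\<zero>\<^bsub>Q\<^esub>}"
    proof
      show "grade Q 0 \<inter> grade Q 1 \<subseteq> {\<zero>\<^bsub>Q\<^esub>}"
        using inter by (fastforce simp: grade zero)
      show "{\<zero>\<^bsub>Q\<^esub>} \<subseteq> grade Q 0 \<inter> grade Q 1"
        by (auto simp: grade zero)
    qed
    show "grade Q 0 <+>\<^bsub>Q\<^esub> grade Q 1 = carrier Q"
    proof
      show "grade Q 0 <+>\<^bsub>Q\<^esub> grade Q 1 \<subseteq> carrier Q"
        unfolding set_add_def' by (auto simp: grade car add c)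
      show "carrier Q \<subseteq> grade Q 0 <+>\<^bsub>Q\<^esub> grade Q 1"
      proof
        fix x assume "x \<in> carrier Q"
        then obtain x' where x: "x = \<phi> x'" "x' \<in> carrier A" using car by auto
        then obtain y z where "y \<in> grade A 0" "z \<in> grade A 1" "x' = y \<oplus>\<^bsub>A\<^esub> z"
          using A.carrier_decomp by blast
        moreover from this have "x = \<phi> y \<oplus>\<^bsub>Q\<^esub> \<phi> z" using x(1) c by (simp add: add)
        ultimately show "x \<in> grade Q 0 <+>\<^bsub>Q\<^esub> grade Q 1"
          unfolding set_add_def' grade by blast
      qed
    qed
    show "x \<otimes>\<^bsub>Q\<^esub> y \<in> grade Q (i + j)" if xy_mem: "x \<in> grade Q i" "y \<in> grade Q j" for x y i j
    proof -
      obtain x' y' where xy: "x' \<in> grade A i" "x = \<phi> x'" "y' \<in> grade A j" "y = \<phi> y'"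
        using xy_mem unfolding grade by blast
      then have "x \<otimes>\<^bsub>Q\<^esub> y = \<phi> (x' \<otimes>\<^bsub>A\<^esub> y')" using mul c by simp
      then show ?thesis unfolding grade using A.grade_prod[OF xy(1,3)] by blast
    qed
  qed
qed

locale superalgebra_quotient = superalgebra A for A :: "('f::field_char_0, 'a) superalgebra" (structure) +
  fixes I :: "'a set"
  assumes graded_ideal: "graded_ideal I A"
begin

abbreviation "Q \<equiv> quotient_superalgebra A I"
abbreviation "\<pi> x \<equiv> I +> x"

lemma ideal_submodule: "submodule I base_field A"
  using graded_ideal by (simp add: graded_ideal_def)

lemmas ideal_mem = submodule_base_fieldD[OF ideal_submodule nonassoc_algebra_axioms]

lemma ideal_prod: "x \<in> I \<Longrightarrow> y \<in> carrier A \<Longrightarrow> x \<otimes> y \<in> I" "x \<in> I \<Longrightarrow> y \<in> carrier A \<Longrightarrow> y \<otimes> x \<in> I"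
  using graded_ideal by (auto simp: graded_ideal_def)

sublocale I: abelian_subgroup I A
  using ideal_submodule abelian_group_axioms
  by (intro abelian_subgroupI3 additive_subgroupI submodule.axioms(1)) 

lemma coset_eq_iff: "x \<in> carrier A \<Longrightarrow> y \<in> carrier A \<Longrightarrow> \<pi> x = \<pi> y \<longleftrightarrow> x \<ominus> y \<in> I"
  using I.a_rcos_module[of y x] I.a_repr_independence'[of x y] I.a_rcos_self[of x] I.a_rcos_self[of y]
    a_repr_independence[of x I y] I.additive_subgroup_axioms
  by (auto simp: a_minus_def additive_subgroup_def)

lemma coset_mem: "x' \<in> \<pi> x \<Longrightarrow> x \<in> carrier A \<Longrightarrow> \<exists>i\<in>I. x' = i \<oplus> x"
  by (auto simp: a_r_coset_def')

lemma coset_add_ideal: "i \<in> I \<Longrightarrow> x \<in> carrier A \<Longrightarrow> \<pi> (i \<oplus> x) = \<pi> x"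
proof -
  assume i: "i \<in> I" and x: "x \<in> carrier A"
  have "(i \<oplus> x) \<ominus> x = i"
    using i x ideal_mem(1) by (auto simp: a_minus_def a_assoc r_neg)
  then show ?thesis using i x ideal_mem(1) by (subst coset_eq_iff) auto
qed

lemma coset_zero: "\<pi> x = \<pi> \<zero> \<longleftrightarrow> x \<in> I" if "x \<in> carrier A"
  using that coset_eq_iff[of x \<zero>] scalar_minus_one[of \<zero>] by (simp add: a_minus_def)

lemma quotient_simps:
  "carrier Q = \<pi> ` carrier A"
  "x \<in> carrier A \<Longrightarrow> y \<in> carrier A \<Longrightarrow> \<pi> x \<oplus>\<^bsub>Q\<^esub> \<pi> y = \<pi> (x \<oplus> y)"
  "x \<in> carrier A \<Longrightarrow> y \<in> carrier A \<Longrightarrow> \<pi> x \<otimes>\<^bsub>Q\<^esub> \<pi> y = \<pi> (x \<otimes> y)"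
  "x \<in> carrier A \<Longrightarrow> c \<odot>\<^bsub>Q\<^esub> \<pi> x = \<pi> (c \<odot> x)"
  "\<zero>\<^bsub>Q\<^esub> = \<pi> \<zero>"
  "grade Q i = \<pi> ` grade A i"
proof -
  show "carrier Q = \<pi> ` carrier A"
    by (auto simp: quotient_superalgebra_def A_RCOSETS_def')
  show "\<zero>\<^bsub>Q\<^esub> = \<pi> \<zero>"
    using ideal_mem(1) by (simp add: quotient_superalgebra_def)
  show "grade Q i = \<pi> ` grade A i"
    by (simp add: quotient_superalgebra_def)
  show "\<pi> x \<oplus>\<^bsub>Q\<^esub> \<pi> y = \<pi> (x \<oplus> y)" if "x \<in> carrier A" "y \<in> carrier A"
    using I.a_rcos_sum[OF that] by (simp add: quotient_superalgebra_def)
  show "c \<odot>\<^bsub>Q\<^esub> \<pi> x = \<pi> (c \<odot> x)" if x: "x \<in> carrier A"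
  proof -
    have "\<pi> (c \<odot> x') = \<pi> (c \<odot> x)" if "x' \<in> \<pi> x" for x'
    proof -
      obtain i where i: "i \<in> I" "x' = i \<oplus> x" using coset_mem[OF \<open>x' \<in> \<pi> x\<close> x] by blast
      then have "c \<odot> x' = c \<odot> i \<oplus> c \<odot> x" using x ideal_mem(1) by (auto simp: scalar_add_right)
      then show ?thesis using i x ideal_mem(4) by (simp add: coset_add_ideal)
    qed
    then have "(\<Union>x'\<in>\<pi> x. \<pi> (c \<odot> x')) = (\<Union>x'\<in>\<pi> x. \<pi> (c \<odot> x))" by (rule SUP_cong[OF refl])
    also have "\<dots> = \<pi> (c \<odot> x)" using I.a_rcos_self[OF x] by blast
    finally show ?thesis by (simp add: quotient_superalgebra_def)
  qed
  show "\<pi> x \<otimes>\<^bsub>Q\<^esub> \<pi> y = \<pi> (x \<otimes> y)" if x: "x \<in> carrier A" and y: "y \<in> carrier A"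
  proof -
    have "\<pi> (x' \<otimes> y') = \<pi> (x \<otimes> y)" if x': "x' \<in> \<pi> x" and y': "y' \<in> \<pi> y" for x' y'
    proof -
      obtain i j where i: "i \<in> I" "x' = i \<oplus> x" and j: "j \<in> I" "y' = j \<oplus> y"
        using coset_mem x' y' x y by meson
      have ij: "i \<in> carrier A" "j \<in> carrier A" using i j ideal_mem(1) by auto
      have "x' \<otimes> y' = (i \<otimes> y' \<oplus> x \<otimes> j) \<oplus> x \<otimes> y"
        using i j ij x y by (simp add: prod_add_left prod_add_right prod_closed a_ac)
      moreover have "i \<otimes> y' \<oplus> x \<otimes> j \<in> I"
        using i j ij x y by (intro ideal_mem(3) ideal_prod) auto
      ultimately show ?thesis using x y by (simp add: coset_add_ideal prod_closed)
    qed
    then have "(\<Union>x'\<in>\<pi> x. \<Union>y'\<in>\<pi> y. \<pi> (x' \<otimes> y')) = (\<Union>x'\<in>\<pi> x. \<Union>y'\<in>\<pi> y. \<pi> (x \<otimes> y))"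
      by (intro SUP_cong[OF refl])
    also have "\<dots> = \<pi> (x \<otimes> y)" using I.a_rcos_self[OF x] I.a_rcos_self[OF y] by blast
    finally show ?thesis by (simp add: quotient_superalgebra_def rcoset_mult_def)
  qed
qed

lemma quotient_algebra: "nonassoc_algebra Q"
  by (rule nonassoc_algebra_image[OF nonassoc_algebra_axioms, of Q \<pi>]) (rule quotient_simps; assumption)+

lemma quotient_superalgebra: "superalgebra Q"
proof (rule superalgebra_image[OF superalgebra_axioms quotient_algebra, of \<pi>])
  fix x y assume xy: "x \<in> grade A 0" "y \<in> grade A 1" "\<pi> x = \<pi> y"
  then have "x \<oplus> ((- 1) \<odot> y) \<in> I"
    using coset_eq_iff[of x y] grade_carrier by (auto simp: a_minus_def scalar_minus_one)
  then have "x \<in> I"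
    using graded_ideal xy grade_scalar[of y 1 "- 1"] unfolding graded_ideal_def by blast
  then show "\<pi> x = \<pi> \<zero>" using xy grade_carrier[of x 0] coset_zero[of x] by simp
qed (rule quotient_simps; assumption)+

lemma quotient_hom: "algebra_hom A Q \<pi>"
  by (auto simp: algebra_hom_def quotient_simps)

lemma quotient_satisfies_super_iff:
  "satisfies_super Q f \<longleftrightarrow> (\<forall>p a. (\<forall>i. a i \<in> grade A (p i)) \<longrightarrow> eval A a (superization p f) \<in> I)"
proof -
  have eval: "eval Q (\<lambda>i. \<pi> (a i)) (superization p f) = \<zero>\<^bsub>Q\<^esub> \<longleftrightarrow> eval A a (superization p f) \<in> I"
    if "\<And>i. a i \<in> grade A (p i)" for p :: "nat \<Rightarrow> bit" and a
  proof -
    have a: "a i \<in> carrier A" for i using that grade_carrier by blast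
    show ?thesis
      unfolding algebra_hom_eval[OF nonassoc_algebra_axioms quotient_algebra quotient_hom a, symmetric]
        quotient_simps(5)
      by (rule coset_zero) (simp add: a)
  qed
  show ?thesis
  proof
    assume "satisfies_super Q f"
    then show "\<forall>p a. (\<forall>i. a i \<in> grade A (p i)) \<longrightarrow> eval A a (superization p f) \<in> I"
      using eval by (fastforce simp: satisfies_super_def quotient_simps)
  next
    assume *: "\<forall>p a. (\<forall>i. a i \<in> grade A (p i)) \<longrightarrow> eval A a (superization p f) \<in> I"
    show "satisfies_super Q f"
      unfolding satisfies_super_def
    proof (intro allI impI)
      fix p :: "nat \<Rightarrow> bit" and b assume "\<forall>i. b i \<in> grade Q (p i)"
      then have "\<forall>i. \<exists>x. x \<in> grade A (p i) \<and> b i = \<pi> x" by (auto simp: quotient_simps)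
      then obtain a where a: "\<And>i. a i \<in> grade A (p i)" "b = (\<lambda>i. \<pi> (a i))"
        by (metis (no_types) ext)
      then show "eval Q b (superization p f) = \<zero>\<^bsub>Q\<^esub>" using * eval by blast
    qed
  qed
qed

end

section \<open>The free superalgebras of the variety\<close>

lemma free_simps [simp]:
  "carrier (free_nonassoc_superalgebra r s) = {f. supp f \<subseteq> super_words r s}"
  "mult (free_nonassoc_superalgebra r s) = (\<star>)"
  "zero (free_nonassoc_superalgebra r s) = 0"
  "add (free_nonassoc_superalgebra r s) = (+)"
  "smult (free_nonassoc_superalgebra r s) = nscale"
  "grade (free_nonassoc_superalgebra r s) i =
     {f. supp f \<subseteq> {w \<in> super_words r s. word_parity w = i}}"
  by (simp_all add: free_nonassoc_superalgebra_def)

lemma keys_nmult: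
  "supp (f \<star> g) \<subseteq> {Prod u v | u v. u \<in> supp f \<and> v \<in> supp g}"
proof
  fix w assume w: "w \<in> supp (f \<star> g)"
  obtain u where u: "u \<in> supp f" "w \<in> supp (\<Sum>v\<in>supp g.
      monomial (Prod u v) (coeff f u * coeff g v))"
    using subsetD[OF keys_sum w[unfolded nmult_def]] by blast
  obtain v where "v \<in> supp g" "w \<in> supp
      (monomial (Prod u v) (coeff f u * coeff g v))"
    using subsetD[OF keys_sum u(2)] by blast
  then show "w \<in> {Prod u v | u v. u \<in> supp f \<and> v \<in> supp g}"
    using u by (auto split: if_splits)
qed

lemma super_words_Prod [simp]: "Prod u v \<in> super_words r s \<longleftrightarrow> u \<in> super_words r s \<and> v \<in> super_words r s"
  by (auto simp: super_words_def)

lemma free_algebra: "nonassoc_algebra (free_nonassoc_superalgebra r s :: ('f::field_char_0, _) superalgebra)"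
  (is "nonassoc_algebra ?A")
proof -
  have "abelian_group ?A"
  proof (rule abelian_groupI)
    fix x assume "x \<in> carrier ?A"
    then show "\<exists>y\<in>carrier ?A. y \<oplus>\<^bsub>?A\<^esub> x = \<zero>\<^bsub>?A\<^esub>" by (intro bexI[of _ "- x"]) auto
  qed (use keys_add in \<open>fastforce simp: algebra_simps\<close>)+
  moreover have "nscale c f + nscale d f = nscale (c + d) f" "nscale c (f + g) = nscale c f + nscale c g"
    "nscale c (nscale d f) = nscale (c * d) f" "nscale 1 f = f"
    for c d and f g :: "(nat + nat, 'f) npoly"
    by (rule poly_mapping_eqI; simp add: lookup_add algebra_simps)+
  ultimately have "Module.module base_field ?A"
    by (intro moduleI) (auto simp: cring_base_field dest: subsetD[OF keys_nscale])
  then show ?thesis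
  proof (rule nonassoc_algebra.intro)
    show "nonassoc_algebra_axioms ?A"
    proof
      fix x y assume "x \<in> carrier ?A" "y \<in> carrier ?A"
      then have "w \<in> super_words r s" if "w \<in> supp (x \<star> y)" for w
        using subsetD[OF keys_nmult that] by auto
      then show "x \<otimes>\<^bsub>?A\<^esub> y \<in> carrier ?A" by auto
    qed (simp_all add: nmult_distribs nmult_nscale_left nmult_nscale_right)
  qed
qed

lemma free_is_superalgebra: "superalgebra (free_nonassoc_superalgebra r s :: ('f::field_char_0, _) superalgebra)"
  (is "superalgebra ?A")
proof -
  interpret nonassoc_algebra ?A by (rule free_algebra)
  show ?thesis
  proof (rule superalgebra.intro[OF free_algebra], rule superalgebra_axioms.intro)
    show "submodule (grade ?A i) base_field ?A" for i
    proof (rule submodule_base_fieldI)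
      show "x \<oplus>\<^bsub>?A\<^esub> y \<in> grade ?A i" if "x \<in> grade ?A i" "y \<in> grade ?A i" for x y
        using that keys_add[of x y] by auto
      show "c \<odot>\<^bsub>?A\<^esub> x \<in> grade ?A i" if "x \<in> grade ?A i" for c x
        using that keys_nscale[of c x] by auto
    qed auto
    show "grade ?A 0 \<inter> grade ?A 1 = {\<zero>\<^bsub>?A\<^esub>}"
    proof -
      have "x = 0" if "x \<in> grade ?A 0" "x \<in> grade ?A 1" for x
      proof -
        have "supp x = {}" using that by fastforce
        then show ?thesis by simp
      qed
      then show ?thesis by auto
    qed
    show "grade ?A 0 <+>\<^bsub>?A\<^esub> grade ?A 1 = carrier ?A"
    proof
      show "grade ?A 0 <+>\<^bsub>?A\<^esub> grade ?A 1 \<subseteq> carrier ?A"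
        unfolding set_add_def' using keys_add by fastforce
      show "carrier ?A \<subseteq> grade ?A 0 <+>\<^bsub>?A\<^esub> grade ?A 1"
      proof
        fix f assume f: "f \<in> carrier ?A"
        define g where "g i = (\<Sum>w\<in>{w\<in>supp f. word_parity w = i}.
          monomial w (coeff f w))" for i
        have "supp (g i) \<subseteq> {w\<in>supp f. word_parity w = i}" for i
        proof
          fix w assume w: "w \<in> supp (g i)"
          have "w \<in> (\<Union>w\<in>{w\<in>supp f. word_parity w = i}.
            supp (monomial w (coeff f w)))"
            by (rule subsetD[OF keys_sum w[unfolded g_def]])
          then show "w \<in> {w\<in>supp f. word_parity w = i}" by (auto split: if_splits)
        qed
        then have g: "g i \<in> grade ?A i" for i using f by fastforce
        have "f = (\<Sum>w\<in>supp f. monomial w (coeff f w))"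
          by (rule npoly_sum_single)
        also have "supp f = {w\<in>supp f. word_parity w = 0}
            \<union> {w\<in>supp f. word_parity w = 1}"
          using bit.exhaust by fastforce
        also have "(\<Sum>w\<in>\<dots>. monomial w (coeff f w)) = g 0 + g 1"
          unfolding g_def by (rule sum.union_disjoint) auto
        finally show "f \<in> grade ?A 0 <+>\<^bsub>?A\<^esub> grade ?A 1"
          unfolding set_add_def' using g by (auto simp del: free_simps(6))
      qed
    qed
    show "x \<otimes>\<^bsub>?A\<^esub> y \<in> grade ?A (i + j)" if "x \<in> grade ?A i" "y \<in> grade ?A j" for x y i j
    proof -
      have "w \<in> super_words r s \<and> word_parity w = i + j" if w: "w \<in> supp (x \<star> y)" for w
      proof -
        obtain u v where uv: "w = Prod u v" "u \<in> supp x" "v \<in> supp y"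
          using subsetD[OF keys_nmult w] by blast
        then have "u \<in> super_words r s \<and> word_parity u = i" "v \<in> super_words r s \<and> word_parity v = j"
          using \<open>x \<in> grade ?A i\<close> \<open>y \<in> grade ?A j\<close> by auto
        then show ?thesis using uv by simp
      qed
      then show ?thesis by auto
    qed
  qed
qed

definition variety_ideal :: "nat \<Rightarrow> nat \<Rightarrow> (nat + nat, 'f::field_char_0) npoly set" where
  "variety_ideal r s = \<Inter>{I. graded_ideal I (free_nonassoc_superalgebra r s) \<and>
     variety_superalgebra malcev_metabelian (quotient_superalgebra (free_nonassoc_superalgebra r s) I)}"

lemma graded_ideal_Inter:
  assumes A: "superalgebra A" and "\<I> \<noteq> {}" "\<And>I. I \<in> \<I> \<Longrightarrow> graded_ideal I A"
  shows "graded_ideal (\<Inter>\<I>) A"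
proof -
  interpret superalgebra A by fact
  have sub: "submodule I base_field A" if "I \<in> \<I>" for I
    using assms(3)[OF that] by (simp add: graded_ideal_def)
  note D = submodule_base_fieldD[OF sub nonassoc_algebra_axioms]
  have "submodule (\<Inter>\<I>) base_field A"
  proof (rule submodule_base_fieldI)
    obtain I0 where "I0 \<in> \<I>" using assms(2) by blast
    then show "\<Inter>\<I> \<subseteq> carrier A" using D(1)[of I0] by blast
    show "\<zero>\<^bsub>A\<^esub> \<in> \<Inter>\<I>" using D(2) by simp
    show "x \<oplus>\<^bsub>A\<^esub> y \<in> \<Inter>\<I>" if "x \<in> \<Inter>\<I>" "y \<in> \<Inter>\<I>" for x y
      using that D(3) by simp
    show "c \<odot>\<^bsub>A\<^esub> x \<in> \<Inter>\<I>" if "x \<in> \<Inter>\<I>" for c x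
      using that D(4) by simp
  qed
  moreover have "x \<otimes>\<^bsub>A\<^esub> y \<in> \<Inter>\<I>" "y \<otimes>\<^bsub>A\<^esub> x \<in> \<Inter>\<I>" if "x \<in> \<Inter>\<I>" "y \<in> carrier A" for x y
    by (rule InterI, use that assms(3)[unfolded graded_ideal_def] in blast)+
  moreover have "x \<in> \<Inter>\<I>" "y \<in> \<Inter>\<I>"
    if "x \<in> grade A 0" "y \<in> grade A 1" "x \<oplus>\<^bsub>A\<^esub> y \<in> \<Inter>\<I>" for x y
    by (rule InterI, use that assms(3)[unfolded graded_ideal_def] in blast)+
  ultimately show ?thesis
    unfolding graded_ideal_def by (intro conjI ballI impI)
qed

lemma graded_ideal_carrier:
  assumes A: "superalgebra A"
  shows "graded_ideal (carrier A) A"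
proof -
  interpret superalgebra A by fact
  show ?thesis
    using carrier_is_submodule grade_carrier prod_closed unfolding graded_ideal_def by blast
qed

text \<open>In this form the condition on \<open>I\<close> is visibly closed under intersections.\<close>

lemma quotient_in_variety_iff:
  assumes "superalgebra A" "graded_ideal I A"
  shows "variety_superalgebra malcev_metabelian (quotient_superalgebra A I) \<longleftrightarrow>
    (\<forall>f\<in>{anticommutative_poly, metabelian_poly, malcev_poly}. \<forall>p a. (\<forall>i. a i \<in> grade A (p i)) \<longrightarrow>
      eval A a (superization p f) \<in> I)"
proof -
  interpret superalgebra A by fact
  interpret superalgebra_quotient A I by unfold_locales fact
  show ?thesis
    unfolding variety_superalgebra_malcev_metabelian_iff quotient_satisfies_super_iff
    using quotient_superalgebra by simp
qed

lemma variety_ideal_graded: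
  "graded_ideal (variety_ideal r s) (free_nonassoc_superalgebra r s :: ('f::field_char_0, _) superalgebra)"
  and free_superalgebra_in_variety:
  "variety_superalgebra malcev_metabelian
     (free_superalgebra malcev_metabelian r s :: ('f::field_char_0, _) superalgebra)"
proof -
  let ?A = "free_nonassoc_superalgebra r s :: ('f, _) superalgebra"
  let ?\<I> = "{I. graded_ideal I ?A \<and> variety_superalgebra malcev_metabelian (quotient_superalgebra ?A I)}"
  interpret superalgebra ?A by (rule free_is_superalgebra)
  have "carrier ?A \<in> ?\<I>"
  proof -
    have g: "graded_ideal (carrier ?A) ?A" by (rule graded_ideal_carrier[OF superalgebra_axioms])
    have "eval ?A a (superization p f) \<in> carrier ?A" if "\<forall>i. a i \<in> grade ?A (p i)"
      for f :: "(nat, 'f) npoly" and p and a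
      by (rule eval_closed) (use that grade_carrier in blast)
    then show ?thesis using g by (simp add: quotient_in_variety_iff[OF superalgebra_axioms g] del: free_simps)
  qed
  then have ne: "?\<I> \<noteq> {}" by blast
  show g: "graded_ideal (variety_ideal r s) ?A"
    unfolding variety_ideal_def by (rule graded_ideal_Inter[OF superalgebra_axioms ne]) simp
  have "eval ?A a (superization p f) \<in> I"
    if "I \<in> ?\<I>" "f \<in> {anticommutative_poly, metabelian_poly, malcev_poly}" "\<forall>i. a i \<in> grade ?A (p i)"
    for I f a and p :: "nat \<Rightarrow> bit"
    using that quotient_in_variety_iff[OF superalgebra_axioms, of I] by blast
  then have "variety_superalgebra malcev_metabelian (quotient_superalgebra ?A (variety_ideal r s))"
    unfolding quotient_in_variety_iff[OF superalgebra_axioms g] unfolding variety_ideal_def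
    by (intro ballI allI impI InterI)
  then show "variety_superalgebra malcev_metabelian
     (free_superalgebra malcev_metabelian r s :: ('f, _) superalgebra)"
    unfolding free_superalgebra_def variety_ideal_def .
qed

lemma free_superalgebra_eq:
  "free_superalgebra malcev_metabelian r s = quotient_superalgebra (free_nonassoc_superalgebra r s) (variety_ideal r s)"
  by (simp add: free_superalgebra_def variety_ideal_def)

definition free_generator :: "nat \<Rightarrow> nat \<Rightarrow> nat + nat \<Rightarrow> (nat + nat, 'f::field_char_0) npoly set" where
  "free_generator r s g = variety_ideal r s +>\<^bsub>free_nonassoc_superalgebra r s\<^esub> nvar g"

definition generators :: "nat \<Rightarrow> nat \<Rightarrow> (nat + nat) set" where
  "generators r s = Inl ` {..<r} \<union> Inr ` {..<s}"

lemma nvar_in_grade: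
  "g \<in> generators r s \<Longrightarrow> nvar g \<in> grade (free_nonassoc_superalgebra r s) (word_parity (Gen g))"
  by (auto simp: nvar_def super_words_def generators_def)

lemma free_generator_in_grade:
  assumes "g \<in> generators r s"
  shows "free_generator r s g \<in> grade
    (free_superalgebra malcev_metabelian r s :: ('f::field_char_0, _) superalgebra) (word_parity (Gen g))"
proof -
  let ?A = "free_nonassoc_superalgebra r s :: ('f, _) superalgebra"
  interpret superalgebra ?A by (rule free_is_superalgebra)
  interpret superalgebra_quotient ?A "variety_ideal r s"
    by unfold_locales (rule variety_ideal_graded)
  show ?thesis
    unfolding free_superalgebra_eq quotient_simps free_generator_def using nvar_in_grade[OF assms] by blast
qed

text \<open>A homogeneous element comes from a combination of words of its parity, and a word is a generator
  or a product. The set \<open>P\<close> limits the parities for which generators have to be provided: if there are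
  no generators of parity \<open>i\<close>, then \<open>P = {i}\<close> shows that the component of parity \<open>i\<close> lies in the square.\<close>

lemma free_superalgebra_graded_span:
  fixes H :: "(nat + nat, 'f::field_char_0) npoly set set" and r s :: nat
  defines "F \<equiv> free_superalgebra malcev_metabelian r s :: ('f, _) superalgebra"
  assumes H: "submodule H base_field F" and prods: "\<And>x y. x \<in> carrier F \<Longrightarrow> y \<in> carrier F \<Longrightarrow> x \<otimes>\<^bsub>F\<^esub> y \<in> H"
    and gens: "\<And>g. g \<in> generators r s \<Longrightarrow> word_parity (Gen g) \<in> P \<Longrightarrow> free_generator r s g \<in> H"
    and x: "x \<in> grade F i" and i: "i \<in> P"
  shows "x \<in> H"
proof -
  let ?A = "free_nonassoc_superalgebra r s :: ('f, _) superalgebra"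
  interpret superalgebra ?A by (rule free_is_superalgebra)
  interpret superalgebra_quotient ?A "variety_ideal r s"
    by unfold_locales (rule variety_ideal_graded)
  have F: "F = Q" unfolding F_def by (rule free_superalgebra_eq)
  interpret F: superalgebra F unfolding F by (rule quotient_superalgebra)
  note D = submodule_base_fieldD[OF H F.nonassoc_algebra_axioms]
  have car: "\<pi> f \<in> carrier F" if "f \<in> carrier ?A" for f using that unfolding F quotient_simps by blast
  have word: "\<pi> (monomial w 1) \<in> H" if w: "w \<in> super_words r s" "word_parity w = i" for w
  proof (cases w)
    case (Gen g)
    have "g \<in> generators r s" using w unfolding Gen by (auto simp: super_words_def generators_def)
    then show ?thesis using gens[of g] w(2) i unfolding free_generator_def nvar_def Gen by simp
  next
    case (Prod u v)
    have uv: "monomial u 1 \<in> carrier ?A" "monomial v 1 \<in> carrier ?A"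
      using w Prod by auto
    have "\<pi> (monomial u 1) \<otimes>\<^bsub>F\<^esub> \<pi> (monomial v 1)
      = \<pi> (monomial u 1 \<otimes>\<^bsub>?A\<^esub> monomial v 1)"
      unfolding F by (rule quotient_simps(3)[OF uv])
    then show ?thesis using prods[OF car[OF uv(1)] car[OF uv(2)]] Prod by simp
  qed
  obtain f where f: "f \<in> grade ?A i" "x = \<pi> f" using x unfolding F quotient_simps by blast
  let ?t = "\<lambda>w. monomial w (coeff f w)"
  have sum: "(sum ?t K) \<in> carrier ?A
      \<and> \<pi> (sum ?t K) \<in> H"
    if "finite K" "K \<subseteq> supp f" for K
    using that
  proof (induction K)
    case empty
    then show ?case using D(2) quotient_simps(5) unfolding F by simp
  next
    case (insert w K)
    have w: "w \<in> super_words r s" "word_parity w = i" using insert.prems f(1) by auto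
    have s: "monomial w 1 \<in> carrier ?A" "?t w \<in> carrier ?A"
      using w by auto
    have "coeff f w \<odot>\<^bsub>F\<^esub> \<pi> (monomial w 1)
      = \<pi> (coeff f w \<odot>\<^bsub>?A\<^esub> monomial w 1)"
      unfolding F by (rule quotient_simps(4)[OF s(1)])
    then have 1: "\<pi> (?t w) \<in> H"
      using D(4)[OF word[OF w], of "coeff f w"] by simp
    have IH: "(sum ?t K) \<in> carrier ?A"
      "\<pi> (sum ?t K) \<in> H"
      using insert by blast+
    have "\<pi> (?t w) \<oplus>\<^bsub>F\<^esub> \<pi> (sum ?t K)
     = \<pi> (?t w \<oplus>\<^bsub>?A\<^esub> (sum ?t K))"
      unfolding F by (rule quotient_simps(2)[OF s(2) IH(1)])
    then have "\<pi> (?t w \<oplus>\<^bsub>?A\<^esub> (sum ?t K)) \<in> H"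
      using D(3)[OF 1 IH(2)] by simp
    moreover have "?t w \<oplus>\<^bsub>?A\<^esub> (sum ?t K) \<in> carrier ?A"
      by (rule a_closed[OF s(2) IH(1)])
    ultimately show ?case using insert.hyps by simp
  qed
  show ?thesis
    using sum[of "supp f"] npoly_sum_single[of f] f(2) by simp
qed

text \<open>The kernel of the evaluation at \<open>b\<close> is one of the ideals whose intersection defines the free
  superalgebra, so an evaluation that vanishes there vanishes in \<open>B\<close>.\<close>

lemma free_satisfies_super_transfer:
  fixes B :: "('f::field_char_0, 'b) superalgebra"
  assumes B: "variety_superalgebra malcev_metabelian B"
    and b: "\<And>g. b g \<in> grade B (word_parity (Gen g))"
    and f: "satisfies_super (free_superalgebra malcev_metabelian r s :: ('f, _) superalgebra) f"
    and g: "\<And>i. g i \<in> generators r s"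
  shows "eval B (\<lambda>i. b (g i)) (superization (\<lambda>i. word_parity (Gen (g i))) f) = \<zero>\<^bsub>B\<^esub>"
proof -
  let ?A = "free_nonassoc_superalgebra r s :: ('f, _) superalgebra"
  interpret A: superalgebra ?A by (rule free_is_superalgebra)
  interpret B: superalgebra B using B by (simp add: variety_superalgebra_def)
  interpret V: superalgebra_quotient ?A "variety_ideal r s"
    by unfold_locales (rule variety_ideal_graded)
  have bc: "b g \<in> carrier B" for g using B.grade_carrier[OF b] .
  have hom: "algebra_hom ?A B (eval B b)"
    using bc by (auto simp: algebra_hom_def B.eval_add B.eval_nmult B.eval_nscale)
  have word: "eval_word B b w \<in> grade B (word_parity w)" for w
  proof (induction w)
    case (Gen g)
    then show ?case using b[of g] by simp
  next
    case (Prod u v)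
    then show ?case using B.grade_prod by simp
  qed
  have graded: "eval B b h \<in> grade B i" if "h \<in> grade ?A i" for h i
    unfolding eval_def
  proof (rule B.finsum_in_submodule[OF B.grade_subspace])
    fix w assume "w \<in> supp h"
    then have "word_parity w = i" using that by auto
    then show "coeff h w \<odot>\<^bsub>B\<^esub> eval_word B b w \<in> grade B i"
      using B.grade_scalar[OF word[of w]] by simp
  qed simp
  let ?K = "{h \<in> carrier ?A. eval B b h = \<zero>\<^bsub>B\<^esub>}"
  have K: "graded_ideal ?K ?A"
    unfolding graded_ideal_def
  proof (intro conjI ballI impI)
    show "submodule ?K base_field ?A"
    proof (rule A.submodule_base_fieldI)
      show "\<zero>\<^bsub>?A\<^esub> \<in> ?K" using A.zero_closed by simp
      show "x \<oplus>\<^bsub>?A\<^esub> y \<in> ?K" if "x \<in> ?K" "y \<in> ?K" for x y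
        using that A.a_closed[of x y] by (simp add: B.eval_add bc)
      show "c \<odot>\<^bsub>?A\<^esub> x \<in> ?K" if "x \<in> ?K" for c x
        using that A.scalar_closed[of x c] by (simp add: B.eval_nscale bc)
    qed auto
  next
    fix x y assume "x \<in> ?K" "y \<in> carrier ?A"
    then show "x \<otimes>\<^bsub>?A\<^esub> y \<in> ?K" "y \<otimes>\<^bsub>?A\<^esub> x \<in> ?K"
      using A.prod_closed[of x y] A.prod_closed[of y x] by (simp_all add: B.eval_nmult bc)
  next
    fix x y assume xy: "x \<in> grade ?A 0" "y \<in> grade ?A 1" "x \<oplus>\<^bsub>?A\<^esub> y \<in> ?K"
    let ?x = "eval B b x" and ?y = "eval B b y"
    have 0: "?x \<oplus>\<^bsub>B\<^esub> ?y = \<zero>\<^bsub>B\<^esub>" using xy by (simp add: B.eval_add bc)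
    then have "?x = (- 1) \<odot>\<^bsub>B\<^esub> ?y" using bc by (simp add: B.scalar_minus_one B.minus_equality)
    then have "?x \<in> grade B 1" using graded[OF xy(2)] B.grade_scalar by simp
    then have x0: "?x = \<zero>\<^bsub>B\<^esub>" using graded[OF xy(1)] B.grade_inter by blast
    then have y0: "?y = \<zero>\<^bsub>B\<^esub>" using 0 bc by simp
    show "x \<in> ?K" using x0 A.grade_carrier[OF xy(1)] by simp
    show "y \<in> ?K" using y0 A.grade_carrier[OF xy(2)] by simp
  qed
  have ev: "eval B b (eval ?A a (superization p h)) = eval B (\<lambda>i. eval B b (a i)) (superization p h)"
    if "\<And>i. a i \<in> carrier ?A" for a :: "nat \<Rightarrow> _" and p :: "nat \<Rightarrow> bit" and h
    by (rule algebra_hom_eval[OF A.nonassoc_algebra_axioms B.nonassoc_algebra_axioms hom that])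
  have "variety_superalgebra malcev_metabelian (quotient_superalgebra ?A ?K)"
    unfolding quotient_in_variety_iff[OF A.superalgebra_axioms K]
  proof (intro ballI allI impI)
    fix h :: "(nat, 'f) npoly" and p :: "nat \<Rightarrow> bit" and a
    assume h: "h \<in> {anticommutative_poly, metabelian_poly, malcev_poly}" and a: "\<forall>i. a i \<in> grade ?A (p i)"
    have ac: "a i \<in> carrier ?A" for i using a A.grade_carrier by blast
    have "satisfies_super B h"
      using B h unfolding variety_superalgebra_malcev_metabelian_iff by blast
    then have "eval B b (eval ?A a (superization p h)) = \<zero>\<^bsub>B\<^esub>"
      unfolding ev[OF ac] using graded a by (simp add: satisfies_super_def del: free_simps)
    moreover have "eval ?A a (superization p h) \<in> carrier ?A" using ac by (rule A.eval_closed)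
    ultimately show "eval ?A a (superization p h) \<in> ?K" by blast
  qed
  then have sub: "variety_ideal r s \<subseteq> ?K"
    unfolding variety_ideal_def using K by blast
  let ?p = "\<lambda>i. word_parity (Gen (g i))"
  have a: "nvar (g i) \<in> grade ?A (?p i)" for i using nvar_in_grade[OF g] .
  have ac: "nvar (g i) \<in> carrier ?A" for i using A.grade_carrier[OF a] .
  have "eval ?A (\<lambda>i. nvar (g i)) (superization ?p f) \<in> variety_ideal r s"
    by (rule f[unfolded free_superalgebra_eq V.quotient_satisfies_super_iff, rule_format]) (rule a)
  then have "eval B b (eval ?A (\<lambda>i. nvar (g i)) (superization ?p f)) = \<zero>\<^bsub>B\<^esub>" using sub by blast
  then show ?thesis unfolding ev[OF ac] using bc by simp
qed

section \<open>Two small superalgebras of the variety\<close>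

type_synonym 'f triple = "'f \<times> 'f \<times> 'f"

fun triple_add :: "'f::field_char_0 triple \<Rightarrow> 'f triple \<Rightarrow> 'f triple" where
  "triple_add (a, b, c) (a', b', c') = (a + a', b + b', c + c')"

fun triple_scale :: "'f::field_char_0 \<Rightarrow> 'f triple \<Rightarrow> 'f triple" where
  "triple_scale k (a, b, c) = (k * a, k * b, k * c)"

text \<open>On a basis \<open>x\<close> (even), \<open>y\<close>, \<open>z\<close> (odd), the two cases of interest are \<open>yx = -xy = y\<close> for
  \<open>(\<kappa>, \<mu>) = (1, 0)\<close>, and \<open>xy = -yx = z\<close>, \<open>yz = zy = x\<close> for \<open>(\<kappa>, \<mu>) = (0, 1)\<close>; all other products of
  basis elements are zero.\<close>

fun triple_mult :: "'f::field_char_0 \<Rightarrow> 'f \<Rightarrow> 'f triple \<Rightarrow> 'f triple \<Rightarrow> 'f triple" where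
  "triple_mult \<kappa> \<mu> (a, b, c) (a', b', c') =
     (\<mu> * (b * c' + c * b'), \<kappa> * (b * a' - a * b'), \<mu> * (a * b' - b * a'))"

definition triple_model :: "'f::field_char_0 \<Rightarrow> 'f \<Rightarrow> ('f, 'f triple) superalgebra" where
  "triple_model \<kappa> \<mu> = \<lparr>carrier = UNIV, mult = triple_mult \<kappa> \<mu>, one = undefined,
     zero = (0, 0, 0), add = triple_add, smult = triple_scale,
     grade = (\<lambda>i. if i = 0 then {(a, b, c). b = 0 \<and> c = 0} else {(a, b, c). a = 0})\<rparr>"

lemma triple_model_simps [simp]:
  "carrier (triple_model \<kappa> \<mu>) = UNIV" "mult (triple_model \<kappa> \<mu>) = triple_mult \<kappa> \<mu>"
  "zero (triple_model \<kappa> \<mu>) = (0, 0, 0)" "add (triple_model \<kappa> \<mu>) = triple_add"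
  "smult (triple_model \<kappa> \<mu>) = triple_scale"
  "grade (triple_model \<kappa> \<mu>) 0 = {(a, b, c). b = 0 \<and> c = 0}"
  "grade (triple_model \<kappa> \<mu>) 1 = {(a, b, c). a = 0}"
  by (simp_all add: triple_model_def)

lemma triple_model_algebra: "nonassoc_algebra (triple_model \<kappa> (\<mu>::'f::field_char_0))"
proof -
  let ?T = "triple_model \<kappa> \<mu>"
  have "abelian_group ?T"
  proof (rule abelian_groupI)
    show "\<exists>y\<in>carrier ?T. y \<oplus>\<^bsub>?T\<^esub> x = \<zero>\<^bsub>?T\<^esub>" for x
      by (rule bexI[of _ "triple_scale (- 1) x"]) (cases x; simp)+
  qed (auto simp: add_ac)
  then have "Module.module base_field ?T"
    by (intro moduleI) (auto simp: cring_base_field algebra_simps)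
  then show ?thesis
    by (rule nonassoc_algebra.intro) (unfold_locales; auto simp: algebra_simps)
qed

lemma triple_model_superalgebra: "superalgebra (triple_model \<kappa> (\<mu>::'f::field_char_0))"
proof -
  let ?T = "triple_model \<kappa> \<mu>"
  interpret nonassoc_algebra ?T by (rule triple_model_algebra)
  have parity: "i = 0 \<or> i = 1" for i :: bit by (cases i) auto
  show ?thesis
  proof (rule superalgebra.intro[OF triple_model_algebra], rule superalgebra_axioms.intro)
    show "submodule (grade ?T i) base_field ?T" for i
      using parity[of i] by (intro submodule_base_fieldI) auto
    show "grade ?T 0 \<inter> grade ?T 1 = {\<zero>\<^bsub>?T\<^esub>}" by auto
    have "(a, b, c) \<in> grade ?T 0 <+>\<^bsub>?T\<^esub> grade ?T 1" for a b c
      unfolding set_add_def' by (auto intro!: exI[of _ a])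
    then show "grade ?T 0 <+>\<^bsub>?T\<^esub> grade ?T 1 = carrier ?T" by auto
    show "x \<otimes>\<^bsub>?T\<^esub> y \<in> grade ?T (i + j)" if "x \<in> grade ?T i" "y \<in> grade ?T j" for x y i j
      using that parity[of i] parity[of j] by auto
  qed
qed

text \<open>A finite computation, for each choice of the parities of the arguments.\<close>

lemma triple_model_in_variety:
  assumes "(\<kappa>, \<mu>) = (1, 0) \<or> (\<kappa>, \<mu>) = (0, 1::'f::field_char_0)"
  shows "variety_superalgebra malcev_metabelian (triple_model \<kappa> \<mu>)"
proof -
  let ?T = "triple_model \<kappa> \<mu>"
  interpret superalgebra ?T by (rule triple_model_superalgebra)
  have par: "(p i = 0 \<and> (\<exists>x. a i = (x, 0, 0))) \<or> (p i = 1 \<and> (\<exists>y z. a i = (0, y, z)))"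
    if "\<forall>i. a i \<in> grade ?T (p i)" for p :: "nat \<Rightarrow> bit" and a i
    using that[rule_format, of i] by (cases "p i"; cases "a i") auto
  have "satisfies_super ?T anticommutative_poly"
    unfolding satisfies_super_def
  proof (intro allI impI)
    fix p :: "nat \<Rightarrow> bit" and a assume a: "\<forall>i. a i \<in> grade ?T (p i)"
    show "eval ?T a (superization p anticommutative_poly) = \<zero>\<^bsub>?T\<^esub>"
      using par[OF a, of 0] par[OF a, of 1]
      by (auto simp: nvar_def superization_add eval_add koszul_sign_Cons pair_sign_def algebra_simps)
  qed
  moreover have "satisfies_super ?T metabelian_poly"
    unfolding satisfies_super_def
  proof (intro allI impI)
    fix p :: "nat \<Rightarrow> bit" and a assume a: "\<forall>i. a i \<in> grade ?T (p i)"
    show "eval ?T a (superization p metabelian_poly) = \<zero>\<^bsub>?T\<^esub>"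
      using par[OF a, of 0] par[OF a, of 1] par[OF a, of 2] par[OF a, of 3] assms
      by (auto simp: nvar_def)
  qed
  moreover have "satisfies_super ?T malcev_poly"
    unfolding satisfies_super_def
  proof (intro allI impI)
    fix p :: "nat \<Rightarrow> bit" and a assume a: "\<forall>i. a i \<in> grade ?T (p i)"
    show "eval ?T a (superization p malcev_poly) = \<zero>\<^bsub>?T\<^esub>"
      using par[OF a, of 0] par[OF a, of 1] par[OF a, of 2] par[OF a, of 3] assms
      by (auto simp: nvar_def malcev_linear_def superization_add eval_add koszul_sign_Cons pair_sign_def
          algebra_simps)
  qed
  ultimately show ?thesis
    unfolding variety_superalgebra_malcev_metabelian_iff by (simp add: superalgebra_axioms)
qed

lemma eval_extend_word:
  "eval_word A a (extend_word w cs) = foldl (\<lambda>v c. v \<otimes>\<^bsub>A\<^esub> a c) (eval_word A a w) cs"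
  by (induction cs arbitrary: w) auto

lemma triple_finsum:
  assumes "finite K"
  shows "(\<Oplus>\<^bsub>triple_model \<kappa> \<mu>\<^esub>w\<in>K. (f w, g w, h w)) = (sum f K, sum g K, sum h K :: 'f::field_char_0)"
proof -
  interpret nonassoc_algebra "triple_model \<kappa> \<mu>" by (rule triple_model_algebra)
  show ?thesis using assms by induction simp_all
qed

lemma triple_eval:
  assumes "\<And>w. w \<in> supp f \<Longrightarrow> eval_word (triple_model \<kappa> \<mu>) a w = triple_scale (\<phi> w) v"
  shows "eval (triple_model \<kappa> \<mu>) a f =
    triple_scale (\<Sum>w\<in>supp f. coeff f w * \<phi> w) (v :: 'f::field_char_0 triple)"
proof -
  interpret nonassoc_algebra "triple_model \<kappa> \<mu>" by (rule triple_model_algebra)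
  obtain x y z where v: "v = (x, y, z)" by (cases v)
  let ?c = "\<lambda>w. coeff f w * \<phi> w"
  have "eval (triple_model \<kappa> \<mu>) a f = (\<Oplus>\<^bsub>triple_model \<kappa> \<mu>\<^esub>w\<in>supp f. (?c w * x, ?c w * y, ?c w * z))"
    unfolding eval_def by (rule finsum_cong') (auto simp: assms v mult.assoc)
  then show ?thesis by (simp add: triple_finsum v sum_distrib_right)
qed

definition left_form :: "nat set \<Rightarrow> (nat, 'f::field_char_0) npoly \<Rightarrow> bool" where
  "left_form X f \<longleftrightarrow> multilinear_on X f \<and> (\<forall>w\<in>supp f. w = left_word (letters w))"

text \<open>Right multiplication by \<open>x\<close> fixes \<open>y\<close> and kills \<open>x\<close>, so the word survives only if its only odd
  letter is one of the first two.\<close>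

lemma lie_model_word:
  assumes "distinct l" "a \<in> set l"
  shows "eval_word (triple_model 1 0) (\<lambda>i. if i = a then (0, 1, 0) else (1, 0, 0)) (left_word l) =
    triple_scale (lie_coeff a l) (0, 1, 0 :: 'f::field_char_0)"
proof -
  let ?g = "\<lambda>i. if i = a then (0, 1, 0) else (1, 0, 0 :: 'f)"
  let ?m = "foldl (\<lambda>v c. triple_mult 1 0 v (?g c))"
  have zero: "?m (0, 0, 0) cs = (0, 0, 0)" for cs by (induction cs) auto
  have fix_y: "?m (0, y, 0) cs = (0, y, 0)" if "a \<notin> set cs" for y cs
    using that by (induction cs arbitrary: y) auto
  obtain b bs where l: "l = b # bs" using assms(2) by (cases l) auto
  show ?thesis
  proof (cases "b = a")
    case True
    then show ?thesis using assms by (cases bs) (auto simp: l left_word_def eval_extend_word fix_y lie_coeff_def)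
  next
    case False
    then obtain c cs where bs: "bs = c # cs" using assms by (cases bs) (auto simp: l)
    show ?thesis
      using False assms by (auto simp: l bs left_word_def eval_extend_word fix_y zero lie_coeff_def)
  qed
qed

text \<open>The left-normed word \<open>xy\<dots>y\<close> with \<open>n\<close> letters: right multiplication by \<open>y\<close> interchanges \<open>x\<close> and \<open>z\<close>.\<close>

definition alternating_value :: "nat \<Rightarrow> 'f::field_char_0 triple" where
  "alternating_value n = (if odd n then (1, 0, 0) else (0, 0, 1))"

text \<open>Since \<open>yy = 0\<close>, the word survives only if its only even letter is one of the first two.\<close>

lemma alternating_model_word:
  assumes "distinct l" "a \<in> set l"
  shows "eval_word (triple_model 0 1) (\<lambda>i. if i = a then (1, 0, 0) else (0, 1, 0)) (left_word l) =
    triple_scale (lie_coeff a l) (alternating_value (length l) :: 'f::field_char_0 triple)"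
proof -
  let ?g = "\<lambda>i. if i = a then (1, 0, 0) else (0, 1, 0 :: 'f)"
  let ?m = "foldl (\<lambda>v c. triple_mult 0 1 v (?g c))"
  have zero: "?m (0, 0, 0) cs = (0, 0, 0)" for cs by (induction cs) auto
  have step: "?m (triple_scale t (alternating_value n)) cs = triple_scale t (alternating_value (n + length cs))"
    if "a \<notin> set cs" for t n cs
    using that
  proof (induction cs arbitrary: n)
    case (Cons c cs)
    have "triple_mult 0 1 (triple_scale t (alternating_value n)) (?g c) = triple_scale t (alternating_value (Suc n))"
      using Cons.prems by (simp add: alternating_value_def)
    then show ?case using Cons by simp
  qed simp
  have value_1: "alternating_value (Suc 0) = (1, 0, 0 :: 'f)"
    and value_2: "alternating_value 2 = (0, 0, 1 :: 'f)"
    by (simp_all add: alternating_value_def)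
  obtain b bs where l: "l = b # bs" using assms(2) by (cases l) auto
  show ?thesis
  proof (cases "b = a")
    case True
    then have a: "a \<notin> set bs" using assms l by auto
    have "lie_coeff a l = (1 :: 'f)" using a True by (cases bs) (auto simp: l lie_coeff_def)
    then show ?thesis
      using True step[OF a, of 1 1] by (simp add: l left_word_def eval_extend_word value_1)
  next
    case False
    then obtain c cs where bs: "bs = c # cs" using assms by (cases bs) (auto simp: l)
    show ?thesis
    proof (cases "c = a")
      case True
      then have a: "a \<notin> set cs" using assms l bs by auto
      have "lie_coeff a l = (- 1 :: 'f)" using True False by (simp add: l bs lie_coeff_def)
      then show ?thesis
        using True False step[OF a, of "- 1" 2] by (simp add: l bs left_word_def eval_extend_word value_2)
    next
      case c: False
      then have "lie_coeff a l = (0 :: 'f)" using False by (simp add: l bs lie_coeff_def)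
      then show ?thesis
        using False c by (simp add: l bs left_word_def eval_extend_word zero alternating_value_def)
    qed
  qed
qed

text \<open>The inversions between the even letter \<open>a\<close> and the odd ones count in \<open>permutation_sign\<close>, but not in
  the Koszul sign. If \<open>a\<close> is the first letter, they contribute \<open>grassmann_sign {a} (set l - {a})\<close>; if it
  is the second one, a further factor \<open>-1\<close>, which is also the quotient of the signs in \<open>lie_coeff\<close> and
  \<open>alt_coeff\<close>.\<close>

lemma koszul_sign_one_even:
  assumes "distinct l" "a \<in> set l"
  shows "koszul_sign (\<lambda>i. if i = a then 0 else 1) l * lie_coeff a l =
    (grassmann_sign {a} (set l - {a}) * alt_coeff a l :: 'f::field_char_0)"
proof -
  let ?p = "\<lambda>i. if i = a then 0 else 1 :: bit"
  have main: "koszul_sign ?p (a # cs) = (grassmann_sign {a} (set cs) * permutation_sign (a # cs) :: 'f)"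
    if "distinct (a # cs)" for cs
  proof -
    have "grassmann_list_sign (odd_singleton ?p) cs = (grassmann_list_sign (odd_singleton (\<lambda>_. 1)) cs :: 'f)"
      by (rule grassmann_list_sign_cong) (use that in \<open>auto simp: odd_singleton_def\<close>)
    moreover have "(\<Union>i\<in>set cs. odd_singleton (\<lambda>_. 1) i) = set cs" by (simp add: UN_odd_singleton)
    ultimately show ?thesis
      using that by (simp add: permutation_sign_def koszul_sign_eq_grassmann odd_singleton_def flip: mult.assoc)
  qed
  obtain b bs where l: "l = b # bs" using assms(2) by (cases l) auto
  show ?thesis
  proof (cases "b = a")
    case True
    then have "lie_coeff a l = (1 :: 'f)" "alt_coeff a l = (permutation_sign l :: 'f)" "set l - {a} = set bs"
      using assms by (cases bs; auto simp: l lie_coeff_def alt_coeff_def)+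
    then show ?thesis using main[of bs] True assms by (simp add: l)
  next
    case False
    then obtain c cs where bs: "bs = c # cs" using assms by (cases bs) (auto simp: l)
    show ?thesis
    proof (cases "c = a")
      case True
      have d: "distinct ([] @ a # b # cs)" using assms True by (auto simp: l bs)
      have k: "koszul_sign ?p (b # a # cs) = (koszul_sign ?p (a # b # cs) :: 'f)"
        using grassmann_list_sign_swap[of "odd_singleton ?p" "[]" a b cs, where 'f = 'f, OF _ _ d] d
        by (simp add: koszul_sign_eq_grassmann odd_singleton_def[of ?p a])
      have p: "permutation_sign (b # a # cs) = - (permutation_sign (a # b # cs) :: 'f)"
        using permutation_sign_swap[of "[]" b a cs] by simp
      have "lie_coeff a l = (- 1 :: 'f)" "alt_coeff a l = (permutation_sign l :: 'f)" "set l - {a} = set (b # cs)"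
        using True False assms by (auto simp: l bs lie_coeff_def alt_coeff_def)
      then show ?thesis using main[of "b # cs"] True d k p by (simp add: l bs)
    next
      case c: False
      then show ?thesis using False by (simp add: l bs lie_coeff_def alt_coeff_def)
    qed
  qed
qed

lemma lie_model_eval:
  assumes f: "left_form X f" and a: "a \<in> X"
  shows "eval (triple_model 1 0) (\<lambda>i. if i = a then (0, 1, 0) else (1, 0, 0))
      (superization (\<lambda>i. if i = a then 1 else 0) f) =
    triple_scale (\<Sum>w\<in>supp f. coeff f w * lie_coeff a (letters w))
      (0, 1, 0 :: 'f::field_char_0)"
proof -
  have "eval_word (triple_model 1 0) (\<lambda>i. if i = a then (0, 1, 0) else (1, 0, 0)) w
    = triple_scale (lie_coeff a (letters w)) (0, 1, 0 :: 'f)" if "w \<in> supp f" for w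
    using lie_model_word[of "letters w" a, where 'f = 'f] that f a
    unfolding left_form_def multilinear_on_def by metis
  then show ?thesis
    by (subst triple_eval[where \<phi> = "\<lambda>w. lie_coeff a (letters w)" and v = "(0, 1, 0)"])
      (simp_all add: koszul_sign_one_odd)
qed

lemma alternating_model_eval:
  assumes f: "left_form X f" and a: "a \<in> X"
  shows "eval (triple_model 0 1) (\<lambda>i. if i = a then (1, 0, 0) else (0, 1, 0))
      (superization (\<lambda>i. if i = a then 0 else 1) f) =
    triple_scale (grassmann_sign {a} (X - {a})
        * (\<Sum>w\<in>supp f. coeff f w * alt_coeff a (letters w)))
      (alternating_value (card X) :: 'f::field_char_0 triple)"
proof -
  let ?p = "\<lambda>i. if i = a then 0 else 1 :: bit"
  have l: "distinct (letters w)" "set (letters w) = X" "left_word (letters w) = w" "length (letters w) = card X"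
    if "w \<in> supp f" for w
    using f that distinct_card[of "letters w"] by (auto simp: left_form_def multilinear_on_def)
  have "eval_word (triple_model 0 1) (\<lambda>i. if i = a then (1, 0, 0) else (0, 1, 0)) w
    = triple_scale (lie_coeff a (letters w)) (alternating_value (card X) :: 'f triple)"
    if w: "w \<in> supp f" for w
    using alternating_model_word[of "letters w" a, where 'f = 'f] l[OF w] a by simp
  then have "eval (triple_model 0 1) (\<lambda>i. if i = a then (1, 0, 0) else (0, 1, 0)) (superization ?p f)
    = triple_scale (\<Sum>w\<in>supp f. koszul_sign ?p (letters w) * coeff f w * lie_coeff a (letters w))
        (alternating_value (card X))"
    by (subst triple_eval[where \<phi> = "\<lambda>w. lie_coeff a (letters w)" and v = "alternating_value (card X)"]) simp_all
  also have "(\<Sum>w\<in>supp f. koszul_sign ?p (letters w) * coeff f w * lie_coeff a (letters w))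
    = grassmann_sign {a} (X - {a}) * (\<Sum>w\<in>supp f. coeff f w * alt_coeff a (letters w))"
    unfolding sum_distrib_left
  proof (rule sum.cong[OF refl])
    fix w assume w: "w \<in> supp f"
    have "koszul_sign ?p (letters w) * coeff f w * lie_coeff a (letters w)
      = coeff f w * (koszul_sign ?p (letters w) * lie_coeff a (letters w))" by (simp add: mult_ac)
    also have "\<dots> = grassmann_sign {a} (X - {a}) * (coeff f w * alt_coeff a (letters w))"
      using koszul_sign_one_even[of "letters w" a, where 'f = 'f] l[OF w] a by (simp add: mult_ac)
    finally show "koszul_sign ?p (letters w) * coeff f w * lie_coeff a (letters w) =
      grassmann_sign {a} (X - {a}) * (coeff f w * alt_coeff a (letters w))" .
  qed
  finally show ?thesis .
qed

section \<open>Superalgebras on another carrier type\<close>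

definition transport :: "('a \<Rightarrow> 'b) \<Rightarrow> ('f::field_char_0, 'a) superalgebra \<Rightarrow> ('f, 'b) superalgebra" where
  "transport j A = \<lparr>carrier = j ` carrier A, mult = (\<lambda>u v. j (inv_into UNIV j u \<otimes>\<^bsub>A\<^esub> inv_into UNIV j v)), one = undefined,
     zero = j \<zero>\<^bsub>A\<^esub>, add = (\<lambda>u v. j (inv_into UNIV j u \<oplus>\<^bsub>A\<^esub> inv_into UNIV j v)), smult = (\<lambda>c u. j (c \<odot>\<^bsub>A\<^esub> inv_into UNIV j u)),
     grade = (\<lambda>i. j ` grade A i)\<rparr>"

lemma transport_superalgebra:
  assumes A: "superalgebra A" and j: "inj j"
  shows "superalgebra (transport j A)" "algebra_hom A (transport j A) j"
proof -
  interpret superalgebra A by fact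
  have alg: "nonassoc_algebra (transport j A)"
    by (rule nonassoc_algebra_image[OF nonassoc_algebra_axioms, of _ j]) (simp_all add: transport_def j)
  show "superalgebra (transport j A)"
  proof (rule superalgebra_image[OF A alg, of j])
    show "j x = j \<zero>\<^bsub>A\<^esub>" if "x \<in> grade A 0" "y \<in> grade A 1" "j x = j y" for x y
      using that grade_inter inj_eq[OF j] by auto
  qed (simp_all add: transport_def j)
  show "algebra_hom A (transport j A) j"
    by (simp add: algebra_hom_def transport_def j)
qed

lemma transport_satisfies_super_iff:
  assumes A: "superalgebra A" and j: "inj j"
  shows "satisfies_super (transport j A) f \<longleftrightarrow> satisfies_super A f"
proof -
  interpret superalgebra A by fact
  interpret T: superalgebra "transport j A" by (rule transport_superalgebra[OF assms])
  have ev: "eval (transport j A) (\<lambda>i. j (a i)) (superization p f) = \<zero>\<^bsub>transport j A\<^esub> \<longleftrightarrow>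
      eval A a (superization p f) = \<zero>\<^bsub>A\<^esub>" if "\<And>i. a i \<in> grade A (p i)" for a and p :: "nat \<Rightarrow> bit"
  proof -
    have "a i \<in> carrier A" for i using grade_carrier[OF that] .
    then have "j (eval A a (superization p f)) = eval (transport j A) (\<lambda>i. j (a i)) (superization p f)"
      by (intro algebra_hom_eval nonassoc_algebra_axioms T.nonassoc_algebra_axioms transport_superalgebra(2) assms)
    moreover have "\<zero>\<^bsub>transport j A\<^esub> = j \<zero>\<^bsub>A\<^esub>" by (simp add: transport_def)
    ultimately show ?thesis using inj_eq[OF j] by metis
  qed
  show ?thesis
  proof
    assume T: "satisfies_super (transport j A) f"
    show "satisfies_super A f"
      unfolding satisfies_super_def
    proof (intro allI impI)
      fix p :: "nat \<Rightarrow> bit" and a assume a: "\<forall>i. a i \<in> grade A (p i)"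
      then have ja: "j (a i) \<in> grade (transport j A) (p i)" for i by (simp add: transport_def)
      have "eval (transport j A) (\<lambda>i. j (a i)) (superization p f) = \<zero>\<^bsub>transport j A\<^esub>"
        by (rule T[unfolded satisfies_super_def, rule_format]) (rule ja)
      then show "eval A a (superization p f) = \<zero>\<^bsub>A\<^esub>" using ev[of a p] a by blast
    qed
  next
    assume S: "satisfies_super A f"
    show "satisfies_super (transport j A) f"
      unfolding satisfies_super_def
    proof (intro allI impI)
      fix p :: "nat \<Rightarrow> bit" and b assume "\<forall>i. b i \<in> grade (transport j A) (p i)"
      then have "\<forall>i. \<exists>x. x \<in> grade A (p i) \<and> b i = j x" by (auto simp: transport_def)
      then obtain a where a: "\<And>i. a i \<in> grade A (p i)" "\<And>i. b i = j (a i)" by metis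
      then have "b = (\<lambda>i. j (a i))" by auto
      then show "eval (transport j A) b (superization p f) = \<zero>\<^bsub>transport j A\<^esub>"
        using ev[of a p] a(1) S unfolding satisfies_super_def by simp
    qed
  qed
qed

text \<open>The field is infinite, hence equipotent with its square.\<close>

lemma triple_injection:
  fixes \<iota> :: "'f::field_char_0 \<Rightarrow> 'u"
  assumes "inj \<iota>"
  obtains j :: "'f triple \<Rightarrow> 'u" where "inj j"
proof -
  have inf: "infinite (UNIV :: 'f set)" by (rule infinite_UNIV_char_0)
  obtain h :: "'f \<times> 'f \<Rightarrow> 'f" where "bij_betw h (UNIV \<times> UNIV) UNIV"
    using card_of_ordIso[THEN iffD2, OF card_of_Times_same_infinite[OF inf]] by (elim exE)
  then have h: "inj h" by (simp add: bij_betw_def)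
  have "inj (\<lambda>(a, b, c). \<iota> (h (a, h (b, c))))"
    by (rule injI) (simp add: split_beta inj_eq[OF assms] inj_eq[OF h] prod_eq_iff)
  then show thesis by (rule that)
qed

section \<open>One even and one odd generator suffice\<close>

text \<open>The kernels of all evaluations in the envelope are ideals of this kind.\<close>

lemma variety_superalgebra_satisfies_identity:
  assumes A: "variety_superalgebra malcev_metabelian (A :: ('f::field_char_0, 'a) superalgebra)"
    and f: "multilinear f" and N: "\<And>N. malcev_ideal N \<Longrightarrow> f \<in> N"
  shows "satisfies_super A f"
proof -
  interpret superalgebra A using A by (simp add: variety_superalgebra_def)
  have G: "satisfies G anticommutative_poly" "satisfies G metabelian_poly" "satisfies G malcev_poly"
    using A by (simp_all add: variety_superalgebra_def envelope.in_variety_malcev_metabelian_iff)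
  have "satisfies G f"
    unfolding satisfies_def
  proof (intro allI impI)
    fix u :: "nat \<Rightarrow> nat set \<Rightarrow> 'a" assume "\<forall>i. u i \<in> carrier G"
    then have "malcev_ideal {f. eval G u f = \<zero>\<^bsub>G\<^esub>}"
      by (intro envelope.kernel_malcev_ideal G) auto
    then show "eval G u f = \<zero>\<^bsub>G\<^esub>" using N by blast
  qed
  with f show ?thesis by (rule envelope_satisfies_imp_satisfies_super)
qed

lemma satisfies_super_diff:
  assumes A: "superalgebra A" and "satisfies_super A f" "satisfies_super A g"
  shows "satisfies_super A (f - g)"
  unfolding satisfies_super_def
proof (intro allI impI)
  interpret superalgebra A by fact
  fix p :: "nat \<Rightarrow> bit" and a assume a: "\<forall>i. a i \<in> grade A (p i)"
  then have "a i \<in> carrier A" for i using grade_carrier by blast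
  then show "eval A a (superization p (f - g)) = \<zero>\<^bsub>A\<^esub>"
    using assms(2,3) a by (simp add: superization_diff eval_diff satisfies_super_def a_minus_def scalar_minus_one[symmetric])
qed

lemma left_form_normal_form: "multilinear_on X f \<Longrightarrow> left_form X (normal_form f)"
  unfolding left_form_def
proof (intro conjI ballI multilinear_on_normal_form)
  fix w assume "w \<in> supp (normal_form f)"
  then obtain w' where "w = left_word (straighten w')" by (rule keys_normal_form)
  then show "w = left_word (letters w)" using straighten_letters(3)[of w'] by simp
qed

text \<open>After passing to the normal form, the two models, evaluated with one variable \<open>a\<close> of one parity and
  the others of the opposite parity, compute the coefficients \<open>lie_coeff a\<close> and \<open>alt_coeff a\<close> of the
  polynomial. These arguments use one even and one odd element only, so the coefficients vanish as
  soon as the polynomial is an identity of the free superalgebra on such generators.\<close>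

lemma free_superalgebra_1_1_identity:
  assumes A: "variety_superalgebra malcev_metabelian (A :: ('f::field_char_0, 'a) superalgebra)"
    and f: "multilinear f"
    and F: "satisfies_super (free_superalgebra malcev_metabelian 1 1 :: ('f, _) superalgebra) f"
  shows "satisfies_super A f"
proof -
  let ?F = "free_superalgebra malcev_metabelian 1 1 :: ('f, _) superalgebra"
  note FV = free_superalgebra_in_variety[of 1 1, where 'f = 'f]
  have superF: "superalgebra ?F" and superA: "superalgebra A"
    using FV A by (simp_all add: variety_superalgebra_def)
  obtain X where X: "multilinear_on X f" using f by (auto simp: multilinear_iff)
  let ?g = "normal_form f"
  have g: "left_form X ?g" by (rule left_form_normal_form[OF X])
  then have gX: "multilinear_on X ?g" by (simp add: left_form_def)
  have fg: "multilinear (f - ?g)" using multilinear_on_diff[OF X gX] by (auto simp: multilinear_iff)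
  have diff: "f - ?g \<in> N" if "malcev_ideal N" for N :: "(nat, 'f) npoly set"
    by (rule metabelian_ideal.normal_form_mem[OF malcev_ideal.axioms(1)[OF that]])
  have "satisfies_super ?F (f - ?g)"
    by (rule variety_superalgebra_satisfies_identity[OF FV fg diff])
  then have Fg: "satisfies_super ?F ?g"
    using satisfies_super_diff[OF superF F, of "f - ?g"] by simp
  have "eval B (\<lambda>i. if i = a then u else v) (superization (\<lambda>i. if i = a then q else q') ?g) = \<zero>\<^bsub>B\<^esub>"
    if B: "variety_superalgebra malcev_metabelian B" and u: "u \<in> grade B q" and v: "v \<in> grade B q'" and qq: "q' = 1 + q"
    for B :: "('f, 'f triple) superalgebra" and a u v q q'
  proof -
    have q: "q = 0 \<and> q' = 1 \<or> q = 1 \<and> q' = 0" using qq by (cases q) auto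
    define gen where "gen i = (if (if i = a then q else q') = 0 then Inl 0 else Inr 0 :: nat + nat)" for i
    define b where "b h = (if word_parity (Gen h) = q then u else v)" for h :: "nat + nat"
    have "b h \<in> grade B (word_parity (Gen h))" for h
      using u v q by (cases "word_parity (Gen h)") (auto simp: b_def)
    moreover have "gen i \<in> generators 1 1" for i by (auto simp: gen_def generators_def)
    ultimately have "eval B (\<lambda>i. b (gen i)) (superization (\<lambda>i. word_parity (Gen (gen i))) ?g) = \<zero>\<^bsub>B\<^esub>"
      by (intro free_satisfies_super_transfer[OF B _ Fg])
    moreover have "word_parity (Gen (gen i)) = (if i = a then q else q')" for i
      using q by (auto simp: gen_def)
    moreover from this have "b (gen i) = (if i = a then u else v)" for i
      using q by (auto simp: b_def)
    ultimately show ?thesis by simp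
  qed
  note B = this
  have "?g \<in> N" if N: "malcev_ideal N" for N
  proof (rule malcev_ideal_membership[OF N gX])
    show "w = left_word (letters w)" if "w \<in> supp ?g" for w
      using g that by (auto simp: left_form_def)
    fix a assume a: "a \<in> X"
    show "(\<Sum>w\<in>supp ?g. coeff ?g w * lie_coeff a (letters w)) = 0"
      using B[OF triple_model_in_variety[of 1 0], of "(0, 1, 0)" 1 "(1, 0, 0)" 0 a]
        lie_model_eval[OF g a] by simp
    show "(\<Sum>w\<in>supp ?g. coeff ?g w * alt_coeff a (letters w)) = 0"
      using B[OF triple_model_in_variety[of 0 1], of "(1, 0, 0)" 0 "(0, 1, 0)" 1 a]
        alternating_model_eval[OF g a] by (simp add: alternating_value_def split: if_splits)
  qed
  then have "f \<in> N" if "malcev_ideal N" for N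
    using metabelian_ideal.add_mem[OF malcev_ideal.axioms(1)[OF that] diff[OF that], of ?g] that by simp
  then show ?thesis by (intro variety_superalgebra_satisfies_identity[OF A f])
qed

lemma supervariety_1_1:
  "supervariety_rank malcev_metabelian (1, 1) =
    (all_variety_superalgebras malcev_metabelian :: ('f::field_char_0, 'u) superalgebra set)"
proof -
  have "satisfies_super (free_superalgebra malcev_metabelian 1 1 :: ('f, _) superalgebra) f"
    if "f \<in> {anticommutative_poly, metabelian_poly, malcev_poly}" for f
    using free_superalgebra_in_variety[of 1 1, where 'f = 'f] that
    unfolding variety_superalgebra_malcev_metabelian_iff by blast
  then have "variety_superalgebra malcev_metabelian A"
    if "A \<in> supervariety_generated (free_superalgebra malcev_metabelian 1 1)" for A :: "('f, 'u) superalgebra"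
    using that multilinear_polys[where 'f = 'f]
    unfolding variety_superalgebra_malcev_metabelian_iff supervariety_generated_def by blast
  moreover have "A \<in> supervariety_generated (free_superalgebra malcev_metabelian 1 1)"
    if "variety_superalgebra malcev_metabelian A" for A :: "('f, 'u) superalgebra"
    using free_superalgebra_1_1_identity[OF that] that
    by (auto simp: supervariety_generated_def variety_superalgebra_def)
  ultimately show ?thesis
    by (auto simp: supervariety_rank_def all_variety_superalgebras_def)
qed

section \<open>Generators of one parity do not suffice\<close>

text \<open>On variables of parity \<open>q\<close>, the superization of this polynomial is the difference of the two words.\<close>

definition parity_identity :: "bit \<Rightarrow> nat \<Rightarrow> (nat, 'f::field_char_0) npoly" where
  "parity_identity q n = monomial (left_word (0 # 1 # 2 # 3 # [4..<n])) 1
     + monomial (left_word (0 # 1 # 3 # 2 # [4..<n])) (if q = 0 then - 1 else 1)"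

lemma left_form_parity_identity:
  assumes "4 \<le> n"
  shows "left_form {..<n} (parity_identity q n :: (nat, 'f::field_char_0) npoly)"
proof -
  let ?u = "0 # 1 # 2 # 3 # [4..<n]" and ?v = "0 # 1 # 3 # 2 # [4..<n]"
  have sets: "set ?u = {..<n}" "set ?v = {..<n}" using assms by auto
  have dist: "distinct ?u" "distinct ?v" by auto
  have "supp (parity_identity q n :: (nat, 'f) npoly) \<subseteq> {left_word ?u, left_word ?v}"
    unfolding parity_identity_def by (rule order_trans[OF keys_add]) auto
  then have "w = left_word ?u \<or> w = left_word ?v"
    if "w \<in> supp (parity_identity q n :: (nat, 'f) npoly)" for w
    using that by blast
  moreover have "letters (left_word ?u) = ?u" "letters (left_word ?v) = ?v" by simp_all
  ultimately show ?thesis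
    unfolding left_form_def multilinear_on_def using sets dist by metis
qed

lemma sum_parity_identity:
  fixes \<phi> :: "nat nword \<Rightarrow> 'f::field_char_0"
  shows "(\<Sum>w\<in>supp (parity_identity q n :: (nat, 'f) npoly). coeff (parity_identity q n) w * \<phi> w)
    = \<phi> (left_word (0 # 1 # 2 # 3 # [4..<n])) + (if q = 0 then - 1 else 1) * \<phi> (left_word (0 # 1 # 3 # 2 # [4..<n]))"
proof -
  let ?u = "left_word (0 # 1 # 2 # 3 # [4..<n])" and ?v = "left_word (0 # 1 # 3 # 2 # [4..<n])"
  have "letters ?u \<noteq> letters ?v" by simp
  then have ne: "?u \<noteq> ?v" by metis
  have "supp (parity_identity q n :: (nat, 'f) npoly) \<subseteq> {?u, ?v}"
    unfolding parity_identity_def by (rule order_trans[OF keys_add]) auto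
  then have "(\<Sum>w\<in>supp (parity_identity q n :: (nat, 'f) npoly). coeff (parity_identity q n) w * \<phi> w)
    = (\<Sum>w\<in>{?u, ?v}. coeff (parity_identity q n) w * \<phi> w)"
    by (intro sum.mono_neutral_left) (auto simp: in_keys_iff)
  also have "\<dots> = \<phi> ?u + (if q = 0 then - 1 else 1) * \<phi> ?v"
    using ne by (simp add: parity_identity_def lookup_add lookup_single)
  finally show ?thesis .
qed

lemma triple_model_not_parity_identity:
  assumes "4 \<le> n"
  shows "\<not> satisfies_super (triple_model 1 (0::'f::field_char_0)) (parity_identity 1 n)"
    "\<not> satisfies_super (triple_model 0 (1::'f)) (parity_identity 0 n)"
proof -
  have zero: "0 \<in> {..<n}" using assms by auto
  show "\<not> satisfies_super (triple_model 1 (0::'f)) (parity_identity 1 n)"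
  proof
    assume "satisfies_super (triple_model 1 (0::'f)) (parity_identity 1 n)"
    then have "eval (triple_model 1 0) (\<lambda>i. if i = 0 then (0, 1, 0) else (1, 0, 0))
      (superization (\<lambda>i. if i = 0 then 1 else 0) (parity_identity 1 n)) = (0, 0, 0::'f)"
      by (simp add: satisfies_super_def)
    then show False
      unfolding lie_model_eval[OF left_form_parity_identity[OF assms] zero] sum_parity_identity
      by (simp add: lie_coeff_def)
  qed
  show "\<not> satisfies_super (triple_model 0 (1::'f)) (parity_identity 0 n)"
  proof
    assume "satisfies_super (triple_model 0 (1::'f)) (parity_identity 0 n)"
    then have 0: "eval (triple_model 0 1) (\<lambda>i. if i = 0 then (1, 0, 0) else (0, 1, 0))
      (superization (\<lambda>i. if i = 0 then 0 else 1) (parity_identity 0 n)) = (0, 0, 0::'f)"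
      by (simp add: satisfies_super_def)
    have "permutation_sign (0 # 1 # 3 # 2 # [4..<n]) = - (permutation_sign (0 # 1 # 2 # 3 # [4..<n]) :: 'f)"
      using permutation_sign_swap[of "[0, 1]" 3 2 "[4..<n]"] by simp
    moreover have "permutation_sign (0 # 1 # 2 # 3 # [4..<n]) \<noteq> (0 :: 'f)"
      by (rule permutation_sign_nonzero) auto
    ultimately show False
      using 0 unfolding alternating_model_eval[OF left_form_parity_identity[OF assms] zero] sum_parity_identity
      by (auto simp: alt_coeff_def alternating_value_def split: if_splits)
  qed
qed

text \<open>The Koszul sign of a 3-cycle of arguments of equal parity is \<open>1\<close>.\<close>

lemma cyclic_superidentity:
  fixes A :: "('f::field_char_0, 'a) superalgebra" (structure)
  assumes A: "variety_superalgebra malcev_metabelian A"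
    and "u \<in> grade A i" "v \<in> grade A j" "x \<in> grade A q" "y \<in> grade A q" "z \<in> grade A q"
  shows "u \<otimes> v \<otimes> x \<otimes> y \<otimes> z = u \<otimes> v \<otimes> y \<otimes> z \<otimes> x"
proof -
  interpret superalgebra A using A by (simp add: variety_superalgebra_def)
  let ?s = "\<lambda>l. monomial (left_word l) (1::'f) :: (nat, 'f) npoly"
  let ?f = "?s [0, 1, 2, 3, 4] - ?s [0, 1, 3, 4, 2]"
  have "multilinear_on {0, 1, 2, 3, 4} ?f"
    by (intro multilinear_on_diff multilinear_on_single) auto
  then have "multilinear ?f" by (auto simp: multilinear_iff)
  moreover have "?f \<in> N" if "malcev_ideal N" for N
    using malcev_ideal.cyclic_mem[OF that, of "nvar 0" "nvar 1" "nvar 2" "nvar 3" "nvar 4"]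
    by (simp add: nvar_def left_word_def)
  ultimately have f: "satisfies_super A ?f"
    by (rule variety_superalgebra_satisfies_identity[OF A])
  define p :: "nat \<Rightarrow> bit" where "p k = (if k = 0 then i else if k = 1 then j else q)" for k
  define a where "a k = (if k = 0 then u else if k = 1 then v else if k = 2 then x else if k = 3 then y else z)" for k :: nat
  have a: "a k \<in> grade A (p k)" for k using assms by (auto simp: a_def p_def)
  then have ac: "a k \<in> carrier A" for k using grade_carrier by blast
  have "koszul_sign p [0, 1, 2, 3, 4] = (1::'f)" "koszul_sign p [0, 1, 3, 4, 2] = (1::'f)"
    by (simp_all add: koszul_sign_Cons pair_sign_def p_def)
  then have "superization p ?f = ?f" by (simp add: superization_diff)
  moreover have "eval A a (superization p ?f) = \<zero>"
    by (rule f[unfolded satisfies_super_def, rule_format]) (rule a)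
  ultimately have "eval A a ?f = \<zero>" by (simp only:)
  then have "eval_word A a (left_word [0, 1, 2, 3, 4]) \<ominus> eval_word A a (left_word [0, 1, 3, 4, 2]) = \<zero>"
    by (simp add: eval_diff ac)
  then have "eval_word A a (left_word [0, 1, 2, 3, 4]) = eval_word A a (left_word [0, 1, 3, 4, 2])"
    using ac by (simp add: minus_eq_zero_iff)
  then show ?thesis by (simp add: left_word_def a_def)
qed


text \<open>The superidentity speaks about homogeneous elements, and these span.\<close>

lemma metabelian_product_zero:
  fixes A :: "('f::field_char_0, 'a) superalgebra" (structure)
  assumes A: "variety_superalgebra malcev_metabelian A"
    and xyzt: "x \<in> carrier A" "y \<in> carrier A" "z \<in> carrier A" "t \<in> carrier A"
  shows "(x \<otimes> y) \<otimes> (z \<otimes> t) = \<zero>"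
proof -
  interpret superalgebra A using A by (simp add: variety_superalgebra_def)
  let ?a = "\<lambda>i::nat. if i = 0 then x else if i = 1 then y else if i = 2 then z else t"
  have "eval A ?a metabelian_poly = \<zero>"
  proof (rule eval_zero_on_spanning_set[OF spans_homogeneous, of "{0, 1, 2, 3}"])
    fix b :: "nat \<Rightarrow> 'a"
    assume b: "\<And>i. i \<in> {0, 1, 2, 3} \<Longrightarrow> b i \<in> grade A 0 \<union> grade A 1"
    define b' where "b' i = (if i \<in> {0, 1, 2, 3} then b i else \<zero>)" for i
    define p :: "nat \<Rightarrow> bit" where "p i = (if b' i \<in> grade A 0 then 0 else 1)" for i
    have b': "b' i \<in> grade A (p i)" for i using b[of i] by (auto simp: b'_def p_def)
    have "satisfies_super A metabelian_poly"
      using A unfolding variety_superalgebra_malcev_metabelian_iff by blast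
    then have "eval A b' (superization p metabelian_poly) = \<zero>"
      by (rule satisfies_super_def[THEN iffD1, rule_format]) (rule b')
    moreover have "koszul_sign p [0, 1, 2, 3] = (1 :: 'f)"
      by (rule koszul_sign_sorted) simp
    ultimately have "eval A b' metabelian_poly = \<zero>" by (simp add: nvar_def)
    moreover have "eval A b metabelian_poly = eval A b' metabelian_poly"
      by (rule eval_cong) (use grade_carrier[OF b'] in \<open>auto simp: nvar_def b'_def\<close>)
    ultimately show "eval A b metabelian_poly = \<zero>" by simp
  qed (use xyzt in \<open>auto simp: nvar_def\<close>)
  then show ?thesis using xyzt by (simp add: eval_nmult)
qed

lemma foldl_absorbing:
  assumes "\<And>x. x \<in> M \<Longrightarrow> f x v = z" "\<And>x y. x \<in> M \<Longrightarrow> y \<in> C \<Longrightarrow> f x y \<in> M"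
    and "\<And>y. y \<in> C \<Longrightarrow> f z y = z" and "x \<in> M" "v \<in> set vs" "set vs \<subseteq> C"
  shows "foldl f x vs = z"
proof -
  obtain us ws where vs: "vs = us @ v # ws" using assms(5) by (meson split_list)
  have "foldl f x us \<in> M" if "set us \<subseteq> C" for us
    using that by (induction us rule: rev_induct) (auto simp: assms(2,4))
  moreover have "foldl f z ws = z" if "set ws \<subseteq> C" for ws
    using that by (induction ws) (auto simp: assms(3))
  ultimately show ?thesis using assms(1,6) vs by simp
qed

text \<open>Modulo the square of \<open>A\<close>, the algebra is spanned by \<open>E\<close>, and elements of the other parity lie in the
  square. All variables
  but the first two act on products, and products annihilate products, so these \<open>card E + 3\<close> variables
  may be restricted to \<open>E\<close>. Two of them then have the same value; by the cyclic superidentity the word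
  is invariant under interchanging the next two letters after the first product, and the two words
  of the identity cancel.\<close>

lemma parity_identity_if_generated:
  fixes A :: "('f::field_char_0, 'a) superalgebra" (structure)
  defines "PP \<equiv> {x \<otimes> y | x y. x \<in> carrier A \<and> y \<in> carrier A}"
  assumes A: "variety_superalgebra malcev_metabelian A"
    and E: "finite E" "E \<subseteq> grade A q" and spans: "spans A (E \<union> PP)"
    and other: "\<And>x i H. x \<in> grade A i \<Longrightarrow> i \<noteq> q \<Longrightarrow> submodule H base_field A \<Longrightarrow> PP \<subseteq> H \<Longrightarrow> x \<in> H"
  shows "satisfies_super A (parity_identity q (card E + 5))"
proof -
  let ?m = "card E + 5"
  let ?l = "[4..<?m]"
  let ?u = "left_word (0 # 1 # 2 # 3 # ?l)" and ?v = "left_word (0 # 1 # 3 # 2 # ?l)"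
  interpret superalgebra A using A by (simp add: variety_superalgebra_def)
  define D where "D = {v \<in> carrier A. \<forall>w\<in>PP. w \<otimes> v = \<zero>}"
  have PPc: "PP \<subseteq> carrier A" by (auto simp: PP_def prod_closed)
  have D: "submodule D base_field A"
    using PPc by (intro submodule_base_fieldI) (auto simp: D_def prod_add_right prod_smult_right prod_closed subset_iff)
  have PPD: "PP \<subseteq> D"
    unfolding D_def using metabelian_product_zero[OF A] PPc prod_closed unfolding PP_def by auto
  have word: "eval_word A a (left_word (x # y # cs)) = foldl (\<otimes>) (a x \<otimes> a y) (map a cs)"
    for a :: "nat \<Rightarrow> 'a" and x y cs
    by (simp add: left_word_def eval_extend_word foldl_map)
  have word_zero: "eval_word A a (left_word (x # y # cs)) = \<zero>"
    if "\<And>i. a i \<in> carrier A" "a c \<in> D" "c \<in> set cs" for a :: "nat \<Rightarrow> 'a" and x y c cs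
    unfolding word
  proof (rule foldl_absorbing[where M = PP and v = "a c" and C = "carrier A"])
    show "w \<otimes> z \<in> PP" if "w \<in> PP" "z \<in> carrier A" for w z using that PPc unfolding PP_def by blast
  qed (use that in \<open>auto simp: D_def PP_def\<close>)
  show ?thesis
    unfolding satisfies_super_def
  proof (intro allI impI)
    fix p :: "nat \<Rightarrow> bit" and a assume a: "\<forall>i. a i \<in> grade A (p i)"
    have ac: "a i \<in> carrier A" for i using a grade_carrier by blast
    show "eval A a (superization p (parity_identity q ?m)) = \<zero>"
    proof (cases "\<exists>c\<in>{2..<?m}. p c \<noteq> q")
      \<comment> \<open>an argument of the other parity lies in the square\<close>
      case True
      then obtain c where c: "2 \<le> c" "c < ?m" "p c \<noteq> q" by auto
      have "a c \<in> D" using other[OF _ c(3) D PPD] a by blast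
      moreover have "c \<in> set (2 # 3 # ?l)" "c \<in> set (3 # 2 # ?l)" using c by auto
      ultimately have "eval_word A a ?u = \<zero>" "eval_word A a ?v = \<zero>"
        using word_zero[of a c] ac by blast+
      then show ?thesis by (simp add: parity_identity_def superization_add eval_add ac)
    next
      case False
      then have pq: "p 2 = q" "p 3 = q" by auto
      have kos: "koszul_sign p (0 # 1 # 2 # 3 # ?l) = (1 :: 'f)"
        by (rule koszul_sign_sorted) auto
      have "koszul_sign p (0 # 1 # 3 # 2 # ?l) =
          ((- 1) ^ (card (odd_singleton p 2) * card (odd_singleton p 3)) * koszul_sign p (0 # 1 # 2 # 3 # ?l) :: 'f)"
        using grassmann_list_sign_swap[of "odd_singleton p" "[0, 1]" 2 3 ?l, where 'f = 'f]
        by (simp add: koszul_sign_eq_grassmann)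
      then have "(if q = 0 then - 1 else 1) * koszul_sign p (0 # 1 # 3 # 2 # ?l) = (- 1 :: 'f)"
        using pq kos by (cases q) (simp_all add: odd_singleton_def)
      then have super: "superization p (parity_identity q ?m) = monomial ?u 1 - monomial ?v (1 :: 'f)"
        using kos by (simp add: parity_identity_def superization_add mult.commute flip: single_uminus)
      show ?thesis
        unfolding super
      proof (rule eval_zero_on_spanning_set[OF spans, of "{2..<?m}"])
        fix w assume "w \<in> supp (monomial ?u 1 - monomial ?v (1 :: 'f))"
        then have "w = ?u \<or> w = ?v"
          using subsetD[OF keys_diff] by fastforce
        then show "distinct (letters w) \<and> {2..<?m} \<subseteq> set (letters w)" by auto
      next
        fix b :: "nat \<Rightarrow> 'a"
        assume b0: "\<And>i. i \<notin> {2..<?m} \<Longrightarrow> b i = a i" and b: "\<And>i. i \<in> {2..<?m} \<Longrightarrow> b i \<in> E \<union> PP"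
        have bc: "b i \<in> carrier A" for i
        proof (cases "i \<in> {2..<?m}")
          case True
          then show ?thesis using b[OF True] spans unfolding spans_def by blast
        qed (use b0[of i] ac in simp)
        have "eval_word A b ?u = eval_word A b ?v"
        proof (cases "\<exists>c\<in>{2..<?m}. b c \<in> D")
          case True
          then obtain c where c: "2 \<le> c" "c < ?m" "b c \<in> D" by auto
          have "c \<in> set (2 # 3 # ?l)" "c \<in> set (3 # 2 # ?l)" using c by auto
          then have "eval_word A b ?u = \<zero>" "eval_word A b ?v = \<zero>"
            using word_zero[of b c] bc c(3) by blast+
          then show ?thesis by simp
        next
          case False
          then have bE: "b i \<in> E" if "i \<in> {2..<?m}" for i using b[OF that] that PPD by blast
          \<comment> \<open>The cyclic invariance must hold on all lists; \<open>d\<close> sends entries outside \<open>E\<close> to zero,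
            which is homogeneous of any parity.\<close>
          define d where "d e = (if e \<in> E then e else \<zero>)" for e
          have d: "d e \<in> grade A q" for e using E(2) by (auto simp: d_def)
          have ab: "b 0 \<in> grade A (p 0)" "b 1 \<in> grade A (p 1)" using b0[of 0] b0[of 1] a by auto
          define h where "h es = foldl (\<otimes>) (b 0 \<otimes> b 1) (map d es)" for es
          have prod: "\<exists>x y i j. x \<in> grade A i \<and> y \<in> grade A j \<and> h us = x \<otimes> y" for us
          proof (induction us rule: rev_induct)
            case Nil
            then show ?case using ab unfolding h_def by auto
          next
            case (snoc e us)
            then obtain x y i j where "x \<in> grade A i" "y \<in> grade A j" "h us = x \<otimes> y" by blast
            then have "h us \<in> grade A (i + j)" "h (us @ [e]) = h us \<otimes> d e"
              using grade_prod by (auto simp: h_def)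
            then show ?case using d[of e] by blast
          qed
          have cyc: "h (us @ x # y # z # vs) = h (us @ y # z # x # vs)" for us x y z vs
          proof -
            obtain u v i j where "u \<in> grade A i" "v \<in> grade A j" "h us = u \<otimes> v"
              using prod[of us] by blast
            then have "h us \<otimes> d x \<otimes> d y \<otimes> d z = h us \<otimes> d y \<otimes> d z \<otimes> d x"
              using cyclic_superidentity[OF A _ _ d d d] by simp
            then show ?thesis by (simp add: h_def)
          qed
          let ?es = "b 2 # b 3 # map b ?l"
          have "set ?es \<subseteq> E" using bE by auto
          then have "card (set ?es) \<le> card E" by (rule card_mono[OF E(1)])
          moreover have "length ?es = card E + 3" by simp
          ultimately have "\<not> distinct ?es" using distinct_card[of ?es] by linarith
          then have "h ?es = h (swap2 ?es)" by (rule cyclic_repeated_swap2[of h, OF cyc])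
          moreover have "map d ?es = ?es" "map d (swap2 ?es) = swap2 ?es" using bE by (auto simp: d_def)
          ultimately show ?thesis
            unfolding word h_def by (simp only: swap2.simps list.map)
        qed
        then show "eval A b (monomial ?u 1 - monomial ?v 1) = \<zero>"
          using bc by (simp add: eval_diff minus_eq_zero_iff)
      qed (use ac in auto)
    qed
  qed
qed

lemma parity_identity_in_free_superalgebra:
  assumes parity: "\<And>g. g \<in> generators r s \<Longrightarrow> word_parity (Gen g) = q"
  obtains n where "4 \<le> n" "satisfies_super
    (free_superalgebra malcev_metabelian r s :: ('f::field_char_0, _) superalgebra) (parity_identity q n)"
proof -
  let ?F = "free_superalgebra malcev_metabelian r s :: ('f, _) superalgebra"
  let ?E = "free_generator r s ` generators r s :: (nat + nat, 'f) npoly set set"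
  let ?P = "{x \<otimes>\<^bsub>?F\<^esub> y | x y. x \<in> carrier ?F \<and> y \<in> carrier ?F}"
  have FV: "variety_superalgebra malcev_metabelian ?F" by (rule free_superalgebra_in_variety)
  then interpret superalgebra ?F by (simp add: variety_superalgebra_def)
  have E: "finite ?E" "?E \<subseteq> grade ?F q"
  proof -
    show "finite ?E" by (simp add: generators_def)
    show "?E \<subseteq> grade ?F q"
    proof
      fix e assume "e \<in> ?E"
      then obtain g where "g \<in> generators r s" "e = free_generator r s g" by blast
      then show "e \<in> grade ?F q" using free_generator_in_grade[of g r s, where 'f = 'f] parity by simp
    qed
  qed
  have "spans ?F (?E \<union> ?P)"
    unfolding spans_def
  proof (intro conjI allI impI)
    show "?E \<union> ?P \<subseteq> carrier ?F" using E(2) grade_carrier prod_closed by blast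
    fix H assume H: "submodule H base_field ?F \<and> ?E \<union> ?P \<subseteq> H"
    have "x \<in> H" if "x \<in> grade ?F i" for x i
      by (rule free_superalgebra_graded_span[OF conjunct1[OF H] _ _ that, of UNIV]) (use H in blast)+
    then show "carrier ?F \<subseteq> H"
      using spans_homogeneous H unfolding spans_def by blast
  qed
  moreover have "x \<in> H" if "x \<in> grade ?F i" "i \<noteq> q" "submodule H base_field ?F" "?P \<subseteq> H" for x i H
    by (rule free_superalgebra_graded_span[OF that(3) _ _ that(1), of "{i}"]) (use parity that(2,4) in auto)
  ultimately have "satisfies_super ?F (parity_identity q (card ?E + 5))"
    by (intro parity_identity_if_generated[OF FV E])
  then show thesis by (intro that[of "card ?E + 5"]) simp
qed

text \<open>The free superalgebra satisfies a parity identity, but one of the two models does not.\<close>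

lemma one_parity_not_enough:
  fixes \<iota> :: "'f::field_char_0 \<Rightarrow> 'u"
  assumes "inj \<iota>" and "r = 0 \<or> s = 0"
  shows "(supervariety_rank malcev_metabelian (r, s) :: ('f, 'u) superalgebra set)
    \<noteq> all_variety_superalgebras malcev_metabelian"
proof
  assume eq: "(supervariety_rank malcev_metabelian (r, s) :: ('f, 'u) superalgebra set)
    = all_variety_superalgebras malcev_metabelian"
  obtain j :: "'f triple \<Rightarrow> 'u" where j: "inj j" using triple_injection[OF assms(1)] .
  have mem: "transport j (triple_model \<kappa> \<mu>) \<in> supervariety_rank malcev_metabelian (r, s)"
    if "(\<kappa>, \<mu>) = (1, 0) \<or> (\<kappa>, \<mu>) = (0, 1)" for \<kappa> \<mu> :: 'f
    unfolding eq all_variety_superalgebras_def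
    using triple_model_in_variety[OF that] transport_superalgebra[OF triple_model_superalgebra j]
    unfolding variety_superalgebra_malcev_metabelian_iff
    by (simp add: transport_satisfies_super_iff[OF triple_model_superalgebra j])
  show False
  proof (cases "(r, s) = (0, 0)")
    case True
    then have "carrier (transport j (triple_model 1 0)) = {\<zero>\<^bsub>transport j (triple_model 1 (0::'f))\<^esub>}"
      using mem[of 1 0] by (simp add: supervariety_rank_def)
    then have "j (1, 0, 0) = j (0, 0, 0)" by (auto simp: transport_def)
    then show False using inj_eq[OF j] by simp
  next
    case False
    have no: "\<not> satisfies_super (free_superalgebra malcev_metabelian r s :: ('f, _) superalgebra) f"
      if "multilinear f" "\<not> satisfies_super (triple_model \<kappa> \<mu>) f"
        "(\<kappa>, \<mu>) = (1, 0) \<or> (\<kappa>, \<mu>) = (0, 1)" for \<kappa> \<mu> :: 'f and f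
      using mem[OF that(3)] that(1,2) False
      by (auto simp: supervariety_rank_def supervariety_generated_def
          transport_satisfies_super_iff[OF triple_model_superalgebra j])
    have ml: "multilinear (parity_identity q n :: (nat, 'f) npoly)" if "4 \<le> n" for q n
      using left_form_parity_identity[OF that, where 'f = 'f] by (auto simp: left_form_def multilinear_iff)
    show False
    proof (cases "s = 0")
      case True
      then have "word_parity (Gen g) = 0" if "g \<in> generators r s" for g
        using that by (auto simp: generators_def)
      then obtain n where "4 \<le> n"
        "satisfies_super (free_superalgebra malcev_metabelian r s :: ('f, _) superalgebra) (parity_identity 0 n)"
        by (rule parity_identity_in_free_superalgebra)
      then show False using no[OF ml triple_model_not_parity_identity(2)] by blast
    next
      case False
      then have "word_parity (Gen g) = 1" if "g \<in> generators r s" for g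
        using that assms(2) by (auto simp: generators_def)
      then obtain n where "4 \<le> n"
        "satisfies_super (free_superalgebra malcev_metabelian r s :: ('f, _) superalgebra) (parity_identity 1 n)"
        by (rule parity_identity_in_free_superalgebra)
      then show False using no[OF ml triple_model_not_parity_identity(1)] by blast
    qed
  qed
qed

theorem corollary4p1:
  fixes \<iota> :: "'f::field_char_0 \<Rightarrow> 'u"
  assumes universe: "inj \<iota>"
  shows "basic_spectrum TYPE('u) (malcev_metabelian :: (nat, 'f) npoly set) = {(1, 1)}"
proof -
  let ?V = "supervariety_rank malcev_metabelian :: _ \<Rightarrow> ('f, 'u) superalgebra set"
  let ?all = "all_variety_superalgebras malcev_metabelian :: ('f, 'u) superalgebra set"
  have no: "?V (r, s) \<noteq> ?all" if "r = 0 \<or> s = 0" for r s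
    using one_parity_not_enough[OF universe that] .
  have yes: "?V (1, 1) = ?all" by (rule supervariety_1_1)
  have "basic_superrank TYPE('u) (malcev_metabelian :: (nat, 'f) npoly set) (r, s) \<longleftrightarrow> (r, s) = (1, 1)" for r s
  proof
    assume b: "basic_superrank TYPE('u) (malcev_metabelian :: (nat, 'f) npoly set) (r, s)"
    then have "?V (r, s) = ?all" by (simp add: basic_superrank_def)
    then have "\<not> (r = 0 \<or> s = 0)" using no[of r s] by blast
    then have "1 \<le> r" "1 \<le> s" by auto
    then show "(r, s) = (1, 1)"
      using b yes unfolding basic_superrank_def by auto
  next
    assume rs: "(r, s) = (1, 1)"
    have "?V (r', s') \<noteq> ?all" if "(r', s') \<noteq> (1, 1)" "r' \<le> 1" "s' \<le> 1" for r' s'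
      using that by (intro no) auto
    then show "basic_superrank TYPE('u) (malcev_metabelian :: (nat, 'f) npoly set) (r, s)"
      using rs yes by (simp add: basic_superrank_def)
  qed
  then show ?thesis by (auto simp: basic_spectrum_def)
qed

end
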